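(* Let $K$ be a field, let $G$ be a connected decomposable graph with vertex set $[n]$, and let $G=G_1\cup G_2$ be a decomposition of $G$, i.e. $G_1$ and $G_2$ are subgraphs of $G$ whose union is $G$, with $V(G_1)\cap V(G_2)=\{v\}$, where $v$ is a free vertex of $G_1$ and of $G_2$. Let $S=K[x_1,\ldots,x_n,y_1,\ldots,y_n]$ and let $J_G,J_{G_1},J_{G_2}\subset S$ be the binomial edge ideals of $G,G_1,G_2$. Then \[ B_{S/J_G}(s,t)=B_{S/J_{G_1}}(s,t)\,B_{S/J_{G_2}}(s,t). \]
   Context: All graphs are finite and simple. $G=G_1\cup G_2$ means $V(G)=V(G_1)\cup V(G_2)$ and $E(G)=E(G_1)\cup E(G_2)$. A clique of a graph is a set of pairwise adjacent vertices; the clique degree of a vertex is the number of maximal cliques of the graph containing it; a vertex is free if its clique degree is 1. The polynomial ring $S$ is standard graded. For a graph $H$ with $V(H)\subseteq[n]$, its binomial edge ideal in $S$ is $J_H=(x_iy_j-x_jy_i : \{i,j\}\in E(H),\ i<j)\subset S$. For a finitely generated graded $S$-module $M$, $\beta_{i,j}(M)=\dim_K\operatorname{Tor}^S_i(M,K)_j$, and $B_M(s,t)=\sum_{i,j}\beta_{i,j}(M)s^it^j$ is the Betti polynomial of $M$. *)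

theory Defs
  imports
    "HOL-Library.Poly_Mapping"
    "HOL-Library.Function_Algebras"
    "HOL-Computational_Algebra.Polynomial"
begin

section \<open>Finite simple graphs\<close>

record 'v sgraph =
  verts :: "'v set"
  edges :: "'v set set"

definition simple_graph :: "'v sgraph \<Rightarrow> bool" where
  "simple_graph G \<longleftrightarrow> finite (verts G) \<and>
     (\<forall>e\<in>edges G. \<exists>u\<in>verts G. \<exists>w\<in>verts G. u \<noteq> w \<and> e = {u, w})"

definition subgraph :: "'v sgraph \<Rightarrow> 'v sgraph \<Rightarrow> bool" where
  "subgraph H G \<longleftrightarrow> simple_graph H \<and> verts H \<subseteq> verts G \<and> edges H \<subseteq> edges G"

definition graph_union :: "'v sgraph \<Rightarrow> 'v sgraph \<Rightarrow> 'v sgraph" where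
  "graph_union G H = \<lparr>verts = verts G \<union> verts H, edges = edges G \<union> edges H\<rparr>"

definition connected_graph :: "'v sgraph \<Rightarrow> bool" where
  "connected_graph G \<longleftrightarrow> verts G \<noteq> {} \<and>
     (\<forall>u\<in>verts G. \<forall>w\<in>verts G. (u, w) \<in> {(a, b). {a, b} \<in> edges G}\<^sup>*)"

definition clique :: "'v sgraph \<Rightarrow> 'v set \<Rightarrow> bool" where
  "clique G C \<longleftrightarrow> C \<subseteq> verts G \<and> (\<forall>u\<in>C. \<forall>w\<in>C. u \<noteq> w \<longrightarrow> {u, w} \<in> edges G)"

definition maximal_clique :: "'v sgraph \<Rightarrow> 'v set \<Rightarrow> bool" where
  "maximal_clique G C \<longleftrightarrow> clique G C \<and> (\<forall>D. clique G D \<longrightarrow> C \<subseteq> D \<longrightarrow> D = C)"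

definition clique_degree :: "'v sgraph \<Rightarrow> 'v \<Rightarrow> nat" where
  "clique_degree G v = card {C. maximal_clique G C \<and> v \<in> C}"

definition free_vertex :: "'v sgraph \<Rightarrow> 'v \<Rightarrow> bool" where
  "free_vertex G v \<longleftrightarrow> v \<in> verts G \<and> clique_degree G v = 1"

definition decomposition :: "'v sgraph \<Rightarrow> 'v sgraph \<Rightarrow> 'v sgraph \<Rightarrow> 'v \<Rightarrow> bool" where
  "decomposition G G1 G2 v \<longleftrightarrow>
     subgraph G1 G \<and> subgraph G2 G \<and> G = graph_union G1 G2 \<and>
     verts G1 \<inter> verts G2 = {v} \<and> free_vertex G1 v \<and> free_vertex G2 v"

definition decomposable :: "'v sgraph \<Rightarrow> bool" where
  "decomposable G \<longleftrightarrow> (\<exists>G1 G2 v. decomposition G G1 G2 v)"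

section \<open>Polynomial rings and binomial edge ideals\<close>

text \<open>The polynomial ring over \<open>'k\<close> in the variables indexed by \<open>'w\<close>: finitely supported
  functions from monomials (exponent vectors) to coefficients, with the convolution product.\<close>

type_synonym ('w, 'k) mpoly = "('w \<Rightarrow>\<^sub>0 nat) \<Rightarrow>\<^sub>0 'k"

definition Var :: "'w \<Rightarrow> ('w, 'k::comm_ring_1) mpoly" where
  "Var w = Poly_Mapping.single (Poly_Mapping.single w 1) 1"

definition mdeg :: "('w \<Rightarrow>\<^sub>0 nat) \<Rightarrow> nat" where
  "mdeg m = (\<Sum>w\<in>Poly_Mapping.keys m. Poly_Mapping.lookup m w)"

definition const_coeff :: "('w, 'k::zero) mpoly \<Rightarrow> 'k" where
  "const_coeff p = Poly_Mapping.lookup p 0"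

lemma module_times: "module ((*) :: 'a::comm_ring_1 \<Rightarrow> 'a \<Rightarrow> 'a)"
  by standard (simp_all add: algebra_simps)

definition ideal_gen :: "'a::comm_ring_1 set \<Rightarrow> 'a set" where
  "ideal_gen B = module.span (*) B"

text \<open>The ring \<open>S\<close>: the variable \<open>x\<^sub>i\<close> is indexed by \<open>Inl i\<close>, the variable \<open>y\<^sub>i\<close> by \<open>Inr i\<close>.
  When \<open>'v\<close> is a finite linearly ordered type with \<open>n\<close> elements, it plays the role of \<open>[n]\<close>.\<close>

type_synonym ('v, 'k) xy_poly = "('v + 'v, 'k) mpoly"

definition binomial_edge_ideal :: "'v::linorder sgraph \<Rightarrow> ('v, 'k::comm_ring_1) xy_poly set" where
  "binomial_edge_ideal H = ideal_gen
     {Var (Inl i) * Var (Inr j) - Var (Inl j) * Var (Inr i) | i j. {i, j} \<in> edges H \<and> i < j}"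

section \<open>Graded Betti numbers of \<open>S/I\<close>\<close>

text \<open>A sequence of graded free modules of finite rank and matrices between them. The module
  \<open>F\<^sub>i\<close> is the direct sum of the \<open>S(-d)\<close>, \<open>d = shift F i k\<close>, over \<open>k < rnk F i\<close>; its elements
  are the functions \<open>nat \<Rightarrow> S\<close> vanishing outside \<open>{..<rnk F i}\<close>. The map from \<open>F\<^sub>i\<^sub>+\<^sub>1\<close> to \<open>F\<^sub>i\<close>
  has matrix \<open>diff F i\<close>, with the row index first.\<close>

record 's graded_free_seq =
  rnk :: "nat \<Rightarrow> nat"
  shift :: "nat \<Rightarrow> nat \<Rightarrow> nat"
  diff :: "nat \<Rightarrow> nat \<Rightarrow> nat \<Rightarrow> 's"

definition free_mod :: "nat \<Rightarrow> (nat \<Rightarrow> 'a::zero) set" where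
  "free_mod r = {f. \<forall>k. r \<le> k \<longrightarrow> f k = 0}"

definition mat_app ::
  "nat \<Rightarrow> nat \<Rightarrow> (nat \<Rightarrow> nat \<Rightarrow> 'a::comm_ring_1) \<Rightarrow> (nat \<Rightarrow> 'a) \<Rightarrow> nat \<Rightarrow> 'a" where
  "mat_app r c A f = (\<lambda>l. if l < r then \<Sum>k<c. A l k * f k else 0)"

text \<open>\<open>F\<close> is a graded free resolution of \<open>S/I\<close>, for a homogeneous ideal \<open>I\<close>. The augmentation
  from \<open>F\<^sub>0\<close> to \<open>S/I\<close> sends the \<open>k\<close>-th basis element to the class of the homogeneous
  polynomial \<open>g k\<close> of degree \<open>shift F 0 k\<close>. The conditions say, in this order: the augmentation
  and the matrices are homogeneous of degree 0, the augmentation is surjective, and the augmented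
  sequence is exact at \<open>F\<^sub>0\<close> and at \<open>F\<^sub>i\<^sub>+\<^sub>1\<close> for all \<open>i\<close>.\<close>

definition graded_free_resolution ::
  "('w, 'k::field) mpoly graded_free_seq \<Rightarrow> ('w, 'k) mpoly set \<Rightarrow> bool" where
  "graded_free_resolution F I \<longleftrightarrow> (\<exists>g.
     (\<forall>k<rnk F 0. \<forall>m\<in>Poly_Mapping.keys (g k). mdeg m = shift F 0 k) \<and>
     (\<forall>i. \<forall>l<rnk F i. \<forall>k<rnk F (Suc i). \<forall>m\<in>Poly_Mapping.keys (diff F i l k).
        mdeg m + shift F i l = shift F (Suc i) k) \<and>
     (\<forall>p. \<exists>f\<in>free_mod (rnk F 0). p - (\<Sum>k<rnk F 0. f k * g k) \<in> I) \<and>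
     {f \<in> free_mod (rnk F 0). (\<Sum>k<rnk F 0. f k * g k) \<in> I} =
       mat_app (rnk F 0) (rnk F 1) (diff F 0) ` free_mod (rnk F 1) \<and>
     (\<forall>i. {f \<in> free_mod (rnk F (Suc i)). mat_app (rnk F i) (rnk F (Suc i)) (diff F i) f = 0} =
       mat_app (rnk F (Suc i)) (rnk F (Suc (Suc i))) (diff F (Suc i)) `
         free_mod (rnk F (Suc (Suc i)))))"

text \<open>The degree \<open>j\<close> part of the complex obtained by tensoring \<open>F\<close> over \<open>S\<close> with \<open>K\<close>, the
  quotient of \<open>S\<close> by the ideal of all variables: each \<open>S(-d)\<close> becomes a copy of \<open>K\<close> in degree \<open>d\<close>,
  and each matrix entry is replaced by its residue class, that is, by its constant coefficient.\<close>

definition strand :: "('w, 'k::field) mpoly graded_free_seq \<Rightarrow> nat \<Rightarrow> nat \<Rightarrow> (nat \<Rightarrow> 'k) set" where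
  "strand F i j = {f \<in> free_mod (rnk F i). \<forall>k<rnk F i. shift F i k \<noteq> j \<longrightarrow> f k = 0}"

definition strand_map ::
  "('w, 'k::field) mpoly graded_free_seq \<Rightarrow> nat \<Rightarrow> (nat \<Rightarrow> 'k) \<Rightarrow> nat \<Rightarrow> 'k" where
  "strand_map F i = mat_app (rnk F i) (rnk F (Suc i)) (\<lambda>l k. const_coeff (diff F i l k))"

definition tor_cycles :: "('w, 'k::field) mpoly graded_free_seq \<Rightarrow> nat \<Rightarrow> nat \<Rightarrow> (nat \<Rightarrow> 'k) set" where
  "tor_cycles F i j =
     (case i of 0 \<Rightarrow> strand F 0 j | Suc i' \<Rightarrow> {f \<in> strand F (Suc i') j. strand_map F i' f = 0})"

definition tor_boundaries ::
  "('w, 'k::field) mpoly graded_free_seq \<Rightarrow> nat \<Rightarrow> nat \<Rightarrow> (nat \<Rightarrow> 'k) set" where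
  "tor_boundaries F i j = strand_map F i ` strand F (Suc i) j"

lemma vector_space_fun: "vector_space (\<lambda>(c::'k::field) (f::nat \<Rightarrow> 'k) k. c * f k)"
  by standard (simp_all add: fun_eq_iff algebra_simps)

definition kdim :: "(nat \<Rightarrow> 'k::field) set \<Rightarrow> nat" where
  "kdim V = vector_space.dim (\<lambda>c f k. c * f k) V"

text \<open>\<open>tor_dim F i j\<close> is the dimension of the quotient of cycles by boundaries (both are
  finite-dimensional, and the boundaries are contained in the cycles). \<open>betti I i j\<close> is
  \<open>dim\<^sub>K Tor\<^sub>i(S/I, K)\<^sub>j\<close>, computed from an arbitrary graded free resolution of \<open>S/I\<close>.\<close>

definition tor_dim :: "('w, 'k::field) mpoly graded_free_seq \<Rightarrow> nat \<Rightarrow> nat \<Rightarrow> nat" where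
  "tor_dim F i j = kdim (tor_cycles F i j) - kdim (tor_boundaries F i j)"

definition betti :: "('w::finite, 'k::field) mpoly set \<Rightarrow> nat \<Rightarrow> nat \<Rightarrow> nat" where
  "betti I = tor_dim (SOME F. graded_free_resolution F I)"

text \<open>The Betti polynomial of \<open>S/I\<close>, as a polynomial in \<open>s\<close> whose coefficients are polynomials
  in \<open>t\<close>. The sum is finite by Hilbert's syzygy theorem.\<close>

definition betti_poly :: "('w::finite, 'k::field) mpoly set \<Rightarrow> int poly poly" where
  "betti_poly I = (\<Sum>(i, j) | betti I i j \<noteq> 0. monom (monom (int (betti I i j)) j) i)"

end

theory Submission
  imports Defs "HOL-Computational_Algebra.Primes"
begin

text \<open>A monomial of \<open>S\<close> modulo \<open>J\<^sub>H\<close> is determined by its multidegree and by its \<open>x\<close>-degrees on the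
  connected components of the subgraph induced by its support. If \<open>v\<close> is a free vertex of \<open>H\<close>, it is
  adjacent to at most one component of any induced subgraph of \<open>H - v\<close>. Hence \<open>y\<^sub>v\<close> is a
  nonzerodivisor on \<open>S/J\<^sub>H\<close>, and over the polynomial ring \<open>T\<close> in \<open>x\<^sub>v, y\<^sub>v\<close> and the variables outside
  \<open>H\<close>, the module \<open>S/J\<^sub>H\<close> is a direct sum of powers of the ideal \<open>(x\<^sub>v, y\<^sub>v)\<close>. Let \<open>F\<close> be a minimal
  resolution of \<open>S/J\<^bsub>G\<^sub>1\<^esub>\<close> with matrices over \<open>T\<close>, where \<open>H = G\<^sub>2\<close>. Since \<open>y\<^sub>v\<close> is regular on
  \<open>S/J\<^bsub>G\<^sub>1\<^esub>\<close>, the subcomplexes \<open>(x\<^sub>v, y\<^sub>v)\<^sup>c F\<close> are acyclic in positive degrees, so that the modules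
  \<open>Tor\<^sub>i(S/J\<^bsub>G\<^sub>1\<^esub>, S/J\<^bsub>G\<^sub>2\<^esub>)\<close> vanish for \<open>i > 0\<close>. The tensor product of minimal resolutions is
  therefore a minimal resolution of \<open>S/J\<^sub>G\<close>, and its ranks are the convolution of the given ranks.
  If one of the Betti polynomials had infinitely many terms, both sides of the claim would be the
  junk value \<open>0\<close>, so Hilbert's syzygy theorem plays no role.\<close>

text \<open>Fix the multidegree on the vertices of \<open>H\<close> other than \<open>v\<close> and
  the \<open>x\<close>-degrees on the components not touching \<open>v\<close>. What still varies is
  a monomial of \<open>T\<close> and the way the total degree \<open>c\<close> of the component
  touching \<open>v\<close> splits into \<open>x\<close>- and \<open>y\<close>-degree. Moving that
  component to \<open>x_v\<close>, \<open>y_v\<close> gives all multiples of x_v^t y_v^(c-t) by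
  monomials of \<open>T\<close>, with t at most c: this is the power (x_v, y_v)^c. Freeness enters
  because neighbours of \<open>v\<close> are adjacent. Two components touching \<open>v\<close>
  would have separate \<open>x\<close>-degrees as long as \<open>v\<close> is outside the support,
  but only a common one after multiplication by y_v.

  The two factors play different roles: the resolution of the first must have entries in
  \<open>T\<close>, so that it acts on each summand of the second. This is possible because the
  graphs share only \<open>v\<close>.

  The second obstacle is that \<open>betti\<close> picks an arbitrary resolution. Its value is
  accessible only once some resolution of finite rank exists, which needs the Noetherian property,
  and all resolutions give the same Tor, which needs chain maps and homotopies. Minimality then
  turns Betti numbers into counts of basis elements.\<close>

abbreviation "lookup \<equiv> Poly_Mapping.lookup"
abbreviation "keys \<equiv> Poly_Mapping.keys"
abbreviation "single \<equiv> Poly_Mapping.single"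

section \<open>Coefficients, terms and cancellation of monomials\<close>

lemma lookup_single_mult_add:
  fixes p :: "('w \<Rightarrow>\<^sub>0 nat) \<Rightarrow>\<^sub>0 'k::comm_ring_1"
  shows "lookup (single n c * p) (n + m) = c * lookup p m"
proof -
  have "lookup (single n c * p) (n + m) =
    (\<Sum>l. lookup (single n c) l * (\<Sum>q. lookup p q when n + m = l + q))"
    by (rule lookup_mult)
  also have "\<dots> = (\<Sum>l. (c * (\<Sum>q. lookup p q when n + m = n + q)) when n = l)"
    by (rule arg_cong[where f = Sum_any]) (auto simp: lookup_single when_def)
  also have "\<dots> = c * lookup p m"
    by simp
  finally show ?thesis .
qed

lemma poly_mapping_sum_single:
  fixes p :: "'a \<Rightarrow>\<^sub>0 'b::comm_monoid_add"
  assumes "finite A" "keys p \<subseteq> A"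
  shows "p = (\<Sum>m\<in>A. single m (lookup p m))"
proof (rule poly_mapping_eqI)
  fix k
  have "(\<Sum>m\<in>A. lookup (single m (lookup p m)) k) = (\<Sum>m\<in>A. if m = k then lookup p k else 0)"
    by (rule sum.cong) (auto simp: lookup_single)
  also have "\<dots> = lookup p k"
    using assms by (auto simp: in_keys_iff)
  finally show "lookup p k = lookup (\<Sum>m\<in>A. single m (lookup p m)) k"
    by (simp add: lookup_sum)
qed

lemma mpoly_induct [case_names single add]:
  fixes p :: "'a \<Rightarrow>\<^sub>0 'b::comm_monoid_add"
  assumes "\<And>m c. P (single m c)" "\<And>p q. P p \<Longrightarrow> P q \<Longrightarrow> P (p + q)"
  shows "P p"
proof -
  have "P (\<Sum>m\<in>A. single m (lookup p m))" if "finite A" for A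
    using that
  proof (induction A)
    case empty
    then show ?case using assms(1)[of undefined 0] by simp
  qed (use assms in auto)
  then show ?thesis
    using poly_mapping_sum_single[OF finite_keys order_refl, of p] finite_keys by metis
qed

text \<open>Multiplication by a monomial only shifts the exponents, so all coefficients can be read
  off again. All later cancellation of variables rests on this.\<close>

lemma single_cancel:
  fixes p :: "('w \<Rightarrow>\<^sub>0 nat) \<Rightarrow>\<^sub>0 'k::comm_ring_1"
  assumes "single n 1 * p = single n 1 * q"
  shows "p = q"
  by (rule poly_mapping_eqI) (metis assms lookup_single_mult_add mult_1)

section \<open>Linear pushforward along a map of monomials\<close>

text \<open>The linear extension of a partial map of monomials: terms violating \<open>Q\<close> are
  dropped, the others are moved along \<open>\<tau>\<close>, and collisions add up. Homogeneous
  parts, retractions onto subrings and the label components \<open>Phi\<close> are all instances, so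
  additivity and linearity are proved once.\<close>

definition push :: "('a \<Rightarrow> bool) \<Rightarrow> ('a \<Rightarrow> 'b) \<Rightarrow> ('a \<Rightarrow>\<^sub>0 'k::comm_ring_1) \<Rightarrow> 'b \<Rightarrow>\<^sub>0 'k" where
  "push Q \<tau> p = (\<Sum>m\<in>{m \<in> keys p. Q m}. single (\<tau> m) (lookup p m))"

lemma push_superset:
  assumes "finite A" "keys p \<subseteq> A"
  shows "push Q \<tau> p = (\<Sum>m\<in>A. single (\<tau> m) (lookup p m) when Q m)"
  unfolding push_def
proof (rule sum.mono_neutral_cong_left)
  show "\<forall>i\<in>A - {m \<in> keys p. Q m}. (single (\<tau> i) (lookup p i) when Q i) = 0"
    by (auto simp: in_keys_iff when_def)
qed (use assms in auto)

lemma push_add: "push Q \<tau> (p + q) = push Q \<tau> p + push Q \<tau> q"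
proof -
  have fin: "finite (keys p \<union> keys q)" (is "finite ?A")
    by simp
  have "push Q \<tau> (p + q) = (\<Sum>m\<in>?A. single (\<tau> m) (lookup (p + q) m) when Q m)"
    by (rule push_superset[OF fin keys_add])
  also have "\<dots> = (\<Sum>m\<in>?A. single (\<tau> m) (lookup p m) when Q m) +
      (\<Sum>m\<in>?A. single (\<tau> m) (lookup q m) when Q m)"
    by (simp add: lookup_add single_add when_add_distrib sum.distrib)
  also have "\<dots> = push Q \<tau> p + push Q \<tau> q"
    using push_superset[OF fin, of p Q \<tau>] push_superset[OF fin, of q Q \<tau>] by simp
  finally show ?thesis .
qed

lemma push_0 [simp]: "push Q \<tau> 0 = 0"
  by (simp add: push_def)

lemma push_uminus: "push Q \<tau> (- p) = - push Q \<tau> p"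
  by (metis add.right_inverse add_eq_0_iff push_0 push_add)

lemma push_diff: "push Q \<tau> (p - q) = push Q \<tau> p - push Q \<tau> q"
  using push_add[of Q \<tau> p "- q"] by (simp add: push_uminus)

lemma push_sum: "push Q \<tau> (sum f A) = (\<Sum>a\<in>A. push Q \<tau> (f a))"
  by (induction A rule: infinite_finite_induct) (simp_all add: push_add)

lemma push_single: "push Q \<tau> (single m c) = (single (\<tau> m) c when Q m)"
  by (subst push_superset[of "{m}"]) auto

text \<open>Linearity over those \<open>a\<close> whose monomials shift \<open>Q\<close> and
  \<open>\<tau>\<close> equivariantly. The data before and after multiplication may differ, which
  accommodates the degree shift caused by a homogeneous matrix entry.\<close>

lemma push_mult:
  fixes a p :: "('w \<Rightarrow>\<^sub>0 nat) \<Rightarrow>\<^sub>0 'k::comm_ring_1"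
  assumes "\<And>n m. n \<in> keys a \<Longrightarrow> Q (n + m) \<longleftrightarrow> Q' m"
    and "\<And>n m. n \<in> keys a \<Longrightarrow> Q' m \<Longrightarrow> \<tau> (n + m) = n + \<tau>' m"
  shows "push Q \<tau> (a * p) = a * push Q' \<tau>' p"
proof (induction p rule: mpoly_induct)
  case (single m c)
  have "push Q \<tau> (a * single m c) =
      push Q \<tau> ((\<Sum>n\<in>keys a. single n (lookup a n)) * single m c)"
    by (subst poly_mapping_sum_single[OF finite_keys order_refl, of a]) (rule refl)
  also have "\<dots> = (\<Sum>n\<in>keys a. single (\<tau> (n + m)) (lookup a n * c) when Q (n + m))"
    by (simp add: sum_distrib_right mult_single push_sum push_single)
  also have "\<dots> = (\<Sum>n\<in>keys a. single n (lookup a n) * push Q' \<tau>' (single m c))"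
    by (rule sum.cong) (auto simp: push_single mult_single assms when_def)
  also have "\<dots> = a * push Q' \<tau>' (single m c)"
    by (subst (3) poly_mapping_sum_single[OF finite_keys order_refl, of a]) (simp add: sum_distrib_right)
  finally show ?case .
qed (simp add: push_add algebra_simps)

lemma keys_push: "keys (push Q \<tau> p) \<subseteq> \<tau> ` {m \<in> keys p. Q m}"
proof
  fix k assume "k \<in> keys (push Q \<tau> p)"
  then have "(\<Sum>m\<in>{m \<in> keys p. Q m}. lookup (single (\<tau> m) (lookup p m)) k) \<noteq> 0"
    by (simp add: in_keys_iff push_def lookup_sum)
  then obtain m where "m \<in> {m \<in> keys p. Q m}"
      "lookup (single (\<tau> m) (lookup p m)) k \<noteq> 0"
    by (meson sum.neutral)
  then show "k \<in> \<tau> ` {m \<in> keys p. Q m}"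
    by (auto simp: lookup_single when_def split: if_splits)
qed

lemma push_cong:
  assumes "\<And>m. m \<in> keys p \<Longrightarrow> Q m \<longleftrightarrow> Q' m"
    and "\<And>m. m \<in> keys p \<Longrightarrow> Q' m \<Longrightarrow> \<tau> m = \<tau>' m"
  shows "push Q \<tau> p = push Q' \<tau>' p"
  unfolding push_def using assms by (intro sum.cong) auto

lemma push_True_id: "push (\<lambda>_. True) (\<lambda>m. m) p = p"
  using poly_mapping_sum_single[OF finite_keys order_refl, of p] by (simp add: push_def)

lemma push_push: "push (\<lambda>_. True) \<rho> (push Q \<tau> p) = push Q (\<lambda>m. \<rho> (\<tau> m)) p"
proof (induction p rule: mpoly_induct)
  case (single m c)
  then show ?case by (cases "Q m") (simp_all add: push_single)
qed (simp add: push_add)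

section \<open>Degrees and subrings of polynomials\<close>

lemma mdeg_eq: "mdeg (m :: 'w::finite \<Rightarrow>\<^sub>0 nat) = (\<Sum>w\<in>UNIV. lookup m w)"
  unfolding mdeg_def by (rule sum.mono_neutral_left) (auto simp: in_keys_iff)

lemma mdeg_add: "mdeg (m + n :: 'w::finite \<Rightarrow>\<^sub>0 nat) = mdeg m + mdeg n"
  by (simp add: mdeg_eq lookup_add sum.distrib)

lemma mdeg_0 [simp]: "mdeg 0 = 0"
  by (simp add: mdeg_def)

lemma mdeg_eq_0_iff: "mdeg m = 0 \<longleftrightarrow> m = 0"
  by (auto simp: mdeg_def in_keys_iff poly_mapping_eqI)

lemma mdeg_single [simp]: "mdeg (single w n) = n"
  by (simp add: mdeg_def)

definition homog :: "nat \<Rightarrow> ('w, 'k::zero) mpoly \<Rightarrow> bool" where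
  "homog e p \<longleftrightarrow> (\<forall>m\<in>keys p. mdeg m = e)"

definition polys_in :: "'w set \<Rightarrow> ('w, 'k::zero) mpoly set" where
  "polys_in W = {p. \<forall>m\<in>keys p. keys m \<subseteq> W}"

text \<open>The part of degree \<open>e - s\<close>, which is zero if \<open>e < s\<close>.\<close>

definition hpart_shift :: "nat \<Rightarrow> nat \<Rightarrow> ('w, 'k::comm_ring_1) mpoly \<Rightarrow> ('w, 'k) mpoly" where
  "hpart_shift e s = push (\<lambda>m. mdeg m + s = e) (\<lambda>m. m)"

text \<open>This is why a homogeneous matrix between shifted free modules commutes with taking
  homogeneous components of vectors.\<close>

lemma hpart_shift_mult:
  fixes a p :: "('w::finite, 'k::comm_ring_1) mpoly"
  assumes "\<forall>m\<in>keys a. mdeg m + s = t"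
  shows "hpart_shift e s (a * p) = a * hpart_shift e t p"
  unfolding hpart_shift_def
  by (rule push_mult) (use assms in \<open>auto simp: mdeg_add algebra_simps\<close>)

lemma hpart_shift_sum: "hpart_shift e s (sum f A) = (\<Sum>a\<in>A. hpart_shift e s (f a))"
  by (simp add: hpart_shift_def push_sum)

lemma keys_hpart_shift: "m \<in> keys (hpart_shift e s p) \<Longrightarrow> mdeg m + s = e"
  unfolding hpart_shift_def using keys_push by fastforce

lemma hpart_shift_id: "\<forall>m\<in>keys p. mdeg m + s = e \<Longrightarrow> hpart_shift e s p = p"
  unfolding hpart_shift_def by (subst (2) push_True_id[symmetric]) (rule push_cong, auto)

lemma const_coeff_add: "const_coeff (p + q) = const_coeff p + const_coeff q"
  for p q :: "('w, 'k::comm_ring_1) mpoly"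
  by (simp add: const_coeff_def lookup_add)

lemma const_coeff_0 [simp]: "const_coeff (0 :: ('w, 'k::comm_ring_1) mpoly) = 0"
  by (simp add: const_coeff_def)

lemma const_coeff_1 [simp]: "const_coeff (1 :: ('w, 'k::comm_ring_1) mpoly) = 1"
  by (simp add: const_coeff_def)

lemma const_coeff_sum: "const_coeff (sum f A) = (\<Sum>a\<in>A. const_coeff (f a))"
  for f :: "'a \<Rightarrow> ('w, 'k::comm_ring_1) mpoly"
  by (simp add: const_coeff_def lookup_sum)

lemma monomial_add_eq_0_iff: "m + n = 0 \<longleftrightarrow> m = 0 \<and> n = 0" for m n :: "'w \<Rightarrow>\<^sub>0 nat"
  by (auto simp: poly_mapping_eq_iff fun_eq_iff lookup_add)

text \<open>Exponents are nonnegative, so only the two constant terms contribute to the constant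
  term of a product. Hence \<open>const_coeff\<close> is the ring map from S to K along which
  complexes are reduced.\<close>

lemma const_coeff_mult: "const_coeff (p * q) = const_coeff p * const_coeff q"
  for p q :: "('w, 'k::comm_ring_1) mpoly"
proof (induction p rule: mpoly_induct)
  case (single m c)
  show ?case
  proof (induction q rule: mpoly_induct)
    case (single n d)
    have "0 = m + n \<longleftrightarrow> m = 0 \<and> n = 0"
      by (metis monomial_add_eq_0_iff)
    then show ?case
      by (auto simp: const_coeff_def mult_single lookup_single when_def monomial_add_eq_0_iff)
  qed (simp add: algebra_simps const_coeff_add)
qed (simp add: algebra_simps const_coeff_add)

section \<open>Scalar action on vectors, and splitting monomials along a set of variables\<close>

definition fscale :: "'a::comm_ring_1 \<Rightarrow> ('b \<Rightarrow> 'a) \<Rightarrow> 'b \<Rightarrow> 'a" where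
  "fscale a f = (\<lambda>k. a * f k)"

interpretation fmod: module fscale
  by standard (simp_all add: fscale_def fun_eq_iff algebra_simps)

interpretation ringmod: module "(*) :: 'a::comm_ring_1 \<Rightarrow> 'a \<Rightarrow> 'a"
  by (rule module_times)

text \<open>For this module, \<open>scale_scale\<close> reassociates products and loops together with \<open>mult_ac\<close>.\<close>

declare ringmod.scale_scale [simp del]

text \<open>The label of a monomial determines the factor \<open>\<sigma>\<close> split off from it,
  and \<open>\<tau>\<close> is the remaining factor. Grouping the terms by label therefore recovers
  \<open>p\<close>.\<close>

lemma push_decompose:
  fixes p :: "('w \<Rightarrow>\<^sub>0 nat) \<Rightarrow>\<^sub>0 'k::comm_ring_1"
  assumes "finite E" "\<And>m. m \<in> keys p \<Longrightarrow> lab m \<in> E" "\<And>m. m \<in> keys p \<Longrightarrow> \<sigma> (lab m) + \<tau> m = m"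
  shows "p = (\<Sum>x\<in>E. single (\<sigma> x) 1 * push (\<lambda>m. lab m = x) \<tau> p)"
proof -
  have "(\<Sum>x\<in>E. single (\<sigma> x) 1 * push (\<lambda>m. lab m = x) \<tau> p) =
      (\<Sum>x\<in>E. \<Sum>m\<in>keys p. (single (\<sigma> x + \<tau> m) (lookup p m) when lab m = x))"
    by (simp add: push_superset[OF finite_keys order_refl] sum_distrib_left mult_when mult_single)
  also have "\<dots> = (\<Sum>m\<in>keys p. \<Sum>x\<in>E. (single (\<sigma> x + \<tau> m) (lookup p m) when lab m = x))"
    by (rule sum.swap)
  also have "\<dots> = (\<Sum>m\<in>keys p. single m (lookup p m))"
    using assms by (intro sum.cong refl) (simp add: when_def)
  also have "\<dots> = p"
    using poly_mapping_sum_single[OF finite_keys order_refl, of p] by simp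
  finally show ?thesis by simp
qed

definition restr :: "'w set \<Rightarrow> ('w::finite \<Rightarrow>\<^sub>0 nat) \<Rightarrow> 'w \<Rightarrow>\<^sub>0 nat" where
  "restr W m = Abs_poly_mapping (\<lambda>w. if w \<in> W then lookup m w else 0)"

lemma lookup_restr: "lookup (restr W m) w = (if w \<in> W then lookup m w else 0)"
  by (simp add: restr_def)

lemma restr_add: "restr W (m + n) = restr W m + restr W n"
  by (rule poly_mapping_eqI) (simp add: lookup_restr lookup_add)

lemma restr_id: "keys m \<subseteq> W \<Longrightarrow> restr W m = m"
  by (rule poly_mapping_eqI) (auto simp: lookup_restr in_keys_iff)

lemma restr_compl_0: "keys m \<subseteq> W \<Longrightarrow> restr (- W) m = 0"
  by (rule poly_mapping_eqI) (auto simp: lookup_restr in_keys_iff)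

lemma restr_split: "restr (- W) m + restr W m = m"
  by (rule poly_mapping_eqI) (simp add: lookup_restr lookup_add)

lemma keys_restr: "keys (restr W m) \<subseteq> W"
  by (auto simp: in_keys_iff lookup_restr split: if_splits)

text \<open>A minimal graded free resolution of \<open>S/I\<close> with \<open>F\<^sub>0 = S\<close>. The module \<open>F\<^sub>i\<close> has a basis indexed
  by \<open>B i\<close>, whose elements have degrees \<open>s i\<close>, and the only index of \<open>F\<^sub>0\<close> is \<open>z\<close>. A vector is an
  arbitrary function, of which only the values on the index set matter.\<close>

definition free_res :: "(nat \<Rightarrow> 'b set) \<Rightarrow> (nat \<Rightarrow> 'b \<Rightarrow> nat) \<Rightarrow> (nat \<Rightarrow> 'b \<Rightarrow> 'b \<Rightarrow> ('w, 'k::field) mpoly) \<Rightarrow>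
    'b \<Rightarrow> ('w, 'k) mpoly set \<Rightarrow> bool" where
  "free_res B s D z I \<longleftrightarrow> (\<forall>i. finite (B i)) \<and> B 0 = {z} \<and> s 0 z = 0 \<and>
    (\<forall>i. \<forall>l\<in>B i. \<forall>k\<in>B (Suc i). (\<forall>m\<in>keys (D i l k). mdeg m + s i l = s (Suc i) k) \<and> const_coeff (D i l k) = 0) \<and>
    (\<forall>p. p \<in> I \<longleftrightarrow> (\<exists>w. p = (\<Sum>k\<in>B 1. D 0 z k * w k))) \<and>
    (\<forall>i. \<forall>l\<in>B i. \<forall>k\<in>B (Suc (Suc i)). (\<Sum>j\<in>B (Suc i). D i l j * D (Suc i) j k) = 0) \<and>
    (\<forall>i u. (\<forall>l\<in>B i. (\<Sum>k\<in>B (Suc i). D i l k * u k) = 0) \<longrightarrow>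
      (\<exists>w. \<forall>k\<in>B (Suc i). u k = (\<Sum>j\<in>B (Suc (Suc i)). D (Suc i) k j * w j)))"

section \<open>Submodules of free modules of finite rank are finitely generated\<close>

text \<open>Beyond every index there is one whose value is minimal among all later ones. A sequence
  of such indices has nondecreasing values.\<close>

lemma mono_subseq_nat:
  fixes s :: "nat \<Rightarrow> nat"
  shows "\<exists>\<phi>::nat \<Rightarrow> nat. strict_mono \<phi> \<and> mono (s \<circ> \<phi>)"
proof -
  have ex: "\<exists>x>y. \<forall>n\<ge>x. s x \<le> s n" for y
  proof -
    define x where "x = arg_min s (\<lambda>n. n > y)"
    have "x > y" "\<forall>n>y. s x \<le> s n"
      using arg_min_nat_lemma[of "\<lambda>n. n > y" "Suc y" s] by (auto simp: x_def)
    then show ?thesis by (metis less_le_trans)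
  qed
  have "\<exists>\<phi>. \<forall>n. (\<forall>k\<ge>\<phi> n. s (\<phi> n) \<le> s k) \<and> \<phi> n < \<phi> (Suc n)"
    by (rule dependent_nat_choice) (use ex in \<open>blast+\<close>)
  then obtain \<phi> where \<phi>: "\<And>n. \<forall>k\<ge>\<phi> n. s (\<phi> n) \<le> s k" "\<And>n. \<phi> n < \<phi> (Suc n)"
    by blast
  have sm: "strict_mono \<phi>"
    using \<phi>(2) by (simp add: strict_mono_Suc_iff)
  moreover have "mono (s \<circ> \<phi>)"
    using \<phi>(1) sm by (auto simp: mono_def strict_mono_less_eq)
  ultimately show ?thesis by blast
qed

text \<open>Monotone subsequences are extracted for one coordinate after another; coordinates
  treated earlier stay monotone on a further subsequence.\<close>

lemma dickson:
  fixes s :: "nat \<Rightarrow> 'a \<Rightarrow> nat"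
  assumes "finite A"
  shows "\<exists>\<phi>::nat \<Rightarrow> nat. strict_mono \<phi> \<and> (\<forall>a\<in>A. mono (\<lambda>n. s (\<phi> n) a))"
  using assms
proof (induction A)
  case empty
  show ?case by (auto intro!: exI[of _ id] simp: strict_mono_def)
next
  case (insert x A)
  then obtain \<phi> :: "nat \<Rightarrow> nat" where \<phi>: "strict_mono \<phi>" "\<forall>a\<in>A. mono (\<lambda>n. s (\<phi> n) a)" by blast
  obtain \<psi> :: "nat \<Rightarrow> nat" where \<psi>: "strict_mono \<psi>" "mono ((\<lambda>n. s (\<phi> n) x) \<circ> \<psi>)"
    using mono_subseq_nat by blast
  have "strict_mono (\<phi> \<circ> \<psi>)"
    using \<phi>(1) \<psi>(1) by (simp add: strict_mono_o)
  moreover have "mono (\<lambda>n. s ((\<phi> \<circ> \<psi>) n) a)" if "a \<in> insert x A" for a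
    using that \<phi>(2) \<psi> by (auto simp: mono_def strict_mono_less_eq)
  ultimately show ?case by blast
qed

text \<open>A multiplicative well-order on monomials, as an embedding into the natural numbers: send
  the variables to distinct primes.\<close>

lemma monomial_order_exists:
  "\<exists>\<omega> :: ('w::finite \<Rightarrow>\<^sub>0 nat) \<Rightarrow> nat. inj \<omega> \<and> (\<forall>m. \<omega> m > 0) \<and> (\<forall>m n. \<omega> (m + n) = \<omega> m * \<omega> n)"
proof -
  obtain pr :: "'w \<Rightarrow> nat" where pr: "inj pr" "range pr \<subseteq> {p. prime p}"
  proof -
    obtain g :: "nat \<Rightarrow> nat" where g: "inj g" "range g \<subseteq> {p. prime p}"
      using infinite_countable_subset[OF primes_infinite] by blast
    obtain e :: "'w \<Rightarrow> nat" where "inj e"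
      using finite_imp_inj_to_nat_seg[of "UNIV :: 'w set"] by auto
    then show ?thesis
      using that[of "g \<circ> e"] g by (auto simp: inj_compose)
  qed
  define \<omega> where "\<omega> m = (\<Prod>w\<in>UNIV. pr w ^ lookup m w)" for m :: "'w \<Rightarrow>\<^sub>0 nat"
  have eq: "\<omega> m = (\<Prod>p\<in>range pr. p ^ lookup m (inv pr p))" for m
    unfolding \<omega>_def by (subst prod.reindex) (use pr(1) in auto)
  have mult: "multiplicity (pr w) (\<omega> m) = lookup m w" for m w
    unfolding eq by (subst multiplicity_prod_prime_powers) (use pr in auto)
  have "inj \<omega>"
    by (metis injI mult poly_mapping_eqI)
  moreover have "\<omega> m > 0" for m
    unfolding \<omega>_def using pr(2) by (intro prod_pos ballI zero_less_power prime_gt_0_nat) auto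
  moreover have "\<omega> (m + n) = \<omega> m * \<omega> n" for m n
    by (simp add: \<omega>_def lookup_add power_add prod.distrib)
  ultimately show ?thesis by blast
qed

text \<open>A leading term argument. Otherwise one chooses forever an element of \<open>M\<close>
  outside the span of its predecessors with least possible leading term. By Dickson's lemma some
  leading term divides a later one in the same component, and subtracting a multiple produces a
  smaller leading term outside the same span.\<close>

lemma free_mod_submodule_finitely_generated:
  fixes M :: "(nat \<Rightarrow> ('w::finite, 'k::field) mpoly) set"
  assumes sub: "fmod.subspace M" and M: "M \<subseteq> free_mod r"
  shows "\<exists>A\<subseteq>M. finite A \<and> fmod.span A = M"
proof (rule ccontr)
  assume "\<not> ?thesis"
  then have notgen: "\<exists>f\<in>M. f \<notin> fmod.span A" if "finite A" "A \<subseteq> M" for A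
    using that fmod.span_minimal[OF _ sub] by blast
  obtain \<omega> :: "('w \<Rightarrow>\<^sub>0 nat) \<Rightarrow> nat" where \<omega>: "inj \<omega>" "\<And>m. \<omega> m > 0" "\<And>m n. \<omega> (m + n) = \<omega> m * \<omega> n"
    using monomial_order_exists by blast
  \<comment> \<open>The term order encoded in the natural numbers: as \<open>l < r\<close>,
    comparing these numbers compares monomials first and components second.\<close>
  define \<rho> where "\<rho> l m = \<omega> m * r + l" for l m
  have \<rho>_inj: "l = l' \<and> m = m'" if "\<rho> l m = \<rho> l' m'" "l < r" "l' < r" for l m l' m'
  proof -
    have "(\<omega> m * r + l) div r = (\<omega> m' * r + l') div r" using that by (simp add: \<rho>_def)
    then have "\<omega> m = \<omega> m'" using that by simp
    then show ?thesis using that \<omega>(1) by (simp add: \<rho>_def inj_eq)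
  qed
  \<comment> \<open>The order respects multiplication by the monomial \<open>q\<close>:
    \<open>\<omega>\<close> is multiplicative and positive, so a strict gap between the monomials
    persists and still outweighs the components.\<close>
  have \<rho>_add: "\<rho> l (m + q) < \<rho> l' (m' + q)" if lt: "\<rho> l m < \<rho> l' m'" and "l < r" "l' < r" for l m l' m' q
  proof (cases "\<omega> m = \<omega> m'")
    case True
    then show ?thesis using lt by (simp add: \<rho>_def \<omega>(3))
  next
    case False
    have "\<not> \<omega> m' < \<omega> m"
    proof
      assume "\<omega> m' < \<omega> m"
      then have "(\<omega> m' + 1) * r \<le> \<omega> m * r" by (intro mult_right_mono) auto
      then show False using lt that(3) by (simp add: \<rho>_def algebra_simps)
    qed
    with False have "\<omega> m * \<omega> q + 1 \<le> \<omega> m' * \<omega> q" using \<omega>(2)[of q] by (simp add: Suc_leI)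
    then have "(\<omega> m * \<omega> q + 1) * r \<le> \<omega> m' * \<omega> q * r" by (rule mult_right_mono) simp
    then show ?thesis using that(2) by (simp add: \<rho>_def \<omega>(3) algebra_simps)
  qed
  define terms where "terms f = {(l, m). l < r \<and> m \<in> keys (f l)}" for f :: "nat \<Rightarrow> ('w, 'k) mpoly"
  have terms_fin: "finite (terms f)" for f
  proof -
    have "terms f = (SIGMA l:{..<r}. keys (f l))" by (auto simp: terms_def)
    then show ?thesis by simp
  qed
  have terms_ne: "terms f \<noteq> {}" if "f \<in> M" "f \<noteq> 0" for f
  proof -
    obtain l where l: "f l \<noteq> 0" using \<open>f \<noteq> 0\<close> by (auto simp: fun_eq_iff)
    then have "l < r" using that(1) M by (force simp: free_mod_def not_le[symmetric])
    moreover obtain m where "m \<in> keys (f l)" using l by fastforce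
    ultimately show ?thesis by (auto simp: terms_def)
  qed
  \<comment> \<open>\<open>Max\<close> of an empty set is unspecified; \<open>lt\<close> is used
    only at nonzero vectors, in particular at vectors outside a span.\<close>
  define lt where "lt f = Max ((\<lambda>(l, m). \<rho> l m) ` terms f)" for f
  have lt_ge: "\<rho> l m \<le> lt f" if "(l, m) \<in> terms f" for l m f
    unfolding lt_def using that terms_fin by (intro Max_ge) (auto intro!: image_eqI[of _ _ "(l,m)"])
  have lt_ex: "\<exists>l m. (l, m) \<in> terms f \<and> lt f = \<rho> l m" if "f \<in> M" "f \<noteq> 0" for f
  proof -
    have "lt f \<in> (\<lambda>(l, m). \<rho> l m) ` terms f"
      unfolding lt_def using terms_fin terms_ne[OF that] by (intro Max_in) auto
    then show ?thesis by auto
  qed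
  have ex: "\<exists>f\<in>M. f \<notin> fmod.span A \<and> (\<forall>h\<in>M. h \<notin> fmod.span A \<longrightarrow> lt f \<le> lt h)"
    if A: "finite A" "A \<subseteq> M" for A
  proof -
    obtain g where "g \<in> M \<and> g \<notin> fmod.span A" using notgen[OF A] by blast
    from arg_min_nat_lemma[of "\<lambda>f. f \<in> M \<and> f \<notin> fmod.span A", OF this, of lt] show ?thesis by blast
  qed
  have "\<forall>A. \<exists>f. finite A \<and> A \<subseteq> M \<longrightarrow>
      f \<in> M \<and> f \<notin> fmod.span A \<and> (\<forall>h\<in>M. h \<notin> fmod.span A \<longrightarrow> lt f \<le> lt h)"
    using ex by blast
  from choice[OF this] obtain ch where ch: "\<forall>A. finite A \<and> A \<subseteq> M \<longrightarrow>
      ch A \<in> M \<and> ch A \<notin> fmod.span A \<and> (\<forall>h\<in>M. h \<notin> fmod.span A \<longrightarrow> lt (ch A) \<le> lt h)"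
    by (rule exE)
  \<comment> \<open>\<open>F n\<close> lists the first \<open>n\<close> chosen elements, so that
    each choice can refer to the span of its predecessors.\<close>
  define F where "F = rec_nat [] (\<lambda>_ xs. xs @ [ch (set xs)])"
  define f where "f n = ch (set (F n))" for n
  have FS: "F (Suc n) = F n @ [f n]" for n
    by (simp add: F_def f_def)
  have FM: "set (F n) \<subseteq> M" for n
  proof (induction n)
    case 0
    then show ?case by (simp add: F_def)
  next
    case (Suc n)
    then show ?case using ch by (simp add: FS f_def)
  qed
  have f: "f n \<in> M \<and> f n \<notin> fmod.span (set (F n)) \<and> (\<forall>h\<in>M. h \<notin> fmod.span (set (F n)) \<longrightarrow> lt (f n) \<le> lt h)" for n
    unfolding f_def using ch FM by simp
  have Fset: "f i \<in> set (F j)" if "i < j" for i j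
    using that
  proof (induction j)
    case (Suc j)
    then show ?case by (cases "i = j") (auto simp: FS)
  qed simp
  have f0: "f n \<noteq> 0" for n using f fmod.span_zero by metis
  obtain L Q where LQ: "\<And>n. (L n, Q n) \<in> terms (f n)" "\<And>n. lt (f n) = \<rho> (L n) (Q n)"
    using lt_ex[OF conjunct1[OF f] f0] by metis
  have Lr: "L n < r" for n using LQ(1)[of n] by (simp add: terms_def)
  \<comment> \<open>Besides the exponents of the leading monomial, the component enters as
    \<open>L n\<close> and as \<open>r - L n\<close>. Monotonicity of both forces the two components
    to agree.\<close>
  define c where "c n a = (case a of Inl w \<Rightarrow> lookup (Q n) w | Inr b \<Rightarrow> if b then L n else r - L n)" for n and a :: "'w + bool"
  obtain \<phi> :: "nat \<Rightarrow> nat" where \<phi>: "strict_mono \<phi>" "\<forall>a\<in>UNIV. mono (\<lambda>n. c (\<phi> n) a)"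
    using dickson[of UNIV c] by auto
  define i j where "i = \<phi> 0" and "j = \<phi> 1"
  have "i < j" using \<phi>(1) by (simp add: i_def j_def strict_mono_less)
  have cle: "c i a \<le> c j a" for a using \<phi>(2) by (simp add: i_def j_def mono_def)
  have Leq: "L i = L j"
    using cle[of "Inr True"] cle[of "Inr False"] Lr[of i] Lr[of j] by (simp add: c_def)
  define q where "q = Q j - Q i"
  have Qj: "Q j = q + Q i"
    by (rule poly_mapping_eqI) (use cle[of "Inl _"] in \<open>simp add: q_def c_def lookup_add lookup_minus\<close>)
  define a where "a = lookup (f j (L j)) (Q j) / lookup (f i (L i)) (Q i)"
  define h where "h = f j - fscale (single q a) (f i)"
  have li: "lookup (f i (L i)) (Q i) \<noteq> 0" using LQ(1)[of i] by (simp add: terms_def in_keys_iff)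
  have hM: "h \<in> M"
    unfolding h_def using f sub by (simp add: fmod.subspace_diff fmod.subspace_scale)
  have hn: "h \<notin> fmod.span (set (F j))"
  proof
    assume "h \<in> fmod.span (set (F j))"
    moreover have "fscale (single q a) (f i) \<in> fmod.span (set (F j))"
      by (intro fmod.span_scale fmod.span_base Fset) fact
    ultimately have "h + fscale (single q a) (f i) \<in> fmod.span (set (F j))" by (rule fmod.span_add)
    then show False using f[of j] by (simp add: h_def)
  qed
  have h0: "h \<noteq> 0" using hn fmod.span_zero by metis
  obtain l m where lm: "(l, m) \<in> terms h" "lt h = \<rho> l m" using lt_ex[OF hM h0] by blast
  have le: "\<rho> (L j) (Q j) \<le> \<rho> l m"
    using f[of j] hM hn LQ(2) lm(2) by metis
  have lr: "l < r" "lookup (h l) m \<noteq> 0" using lm(1) by (auto simp: terms_def in_keys_iff)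
  have hl: "lookup (h l) m = lookup (f j l) m - lookup (single q a * f i l) m"
    by (simp add: h_def fscale_def lookup_minus)
  consider "(l, m) \<in> terms (f j)" | "m \<in> keys (single q a * f i l)"
    using lr hl by (cases "lookup (f j l) m = 0") (auto simp: terms_def in_keys_iff)
  then have ge: "\<rho> l m \<le> \<rho> (L j) (Q j)"
  proof cases
    case 1
    then show ?thesis using lt_ge LQ(2) by metis
  next
    case 2
    have "keys (single q a * f i l) \<subseteq> {x + y |x y. x \<in> keys (single q a) \<and> y \<in> keys (f i l)}"
      by (rule keys_mult)
    then obtain y where y: "m = q + y" "y \<in> keys (f i l)" using 2 by (auto split: if_splits)
    have "\<rho> l y \<le> \<rho> (L i) (Q i)" using lt_ge[of l y "f i"] y(2) lr(1) LQ(2) by (simp add: terms_def)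
    then show ?thesis
      using \<rho>_add[of l y "L i" "Q i" q] \<rho>_inj[of l y "L i" "Q i"] lr(1) Lr[of i]
      unfolding y(1) Qj Leq[symmetric] by (cases "\<rho> l y = \<rho> (L i) (Q i)") (auto simp: add.commute)
  qed
  \<comment> \<open>The leading term of \<open>h\<close> would have to sit exactly where the leading
    term of \<open>f j\<close> was, but \<open>a\<close> was chosen to cancel that term.\<close>
  have "l = L j" "m = Q j" using \<rho>_inj[of l m "L j" "Q j"] ge le lr(1) Lr by auto
  moreover have "lookup (single q a * f i (L j)) (Q j) = a * lookup (f i (L i)) (Q i)"
    by (simp add: Qj Leq lookup_single_mult_add)
  ultimately have "lookup (h l) m = 0"
    using hl li by (simp add: a_def)
  then show False using lr(2) by simp
qed

section \<open>Existence of minimal graded free resolutions\<close>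

text \<open>Homogeneous of degree \<open>e\<close> in the shifted free module and with entries in
  the subring on \<open>W\<close>. Both properties are demanded of generators, so that the matrices
  formed from them inherit both.\<close>

definition good :: "'w set \<Rightarrow> nat \<Rightarrow> (nat \<Rightarrow> nat) \<Rightarrow> nat \<Rightarrow> (nat \<Rightarrow> ('w, 'k::field) mpoly) \<Rightarrow> bool" where
  "good W r s e f \<longleftrightarrow> f \<in> free_mod r \<and> (\<forall>l<r. f l \<in> polys_in W \<and> (\<forall>m\<in>keys (f l). mdeg m + s l = e))"

text \<open>The invariant carried through the construction of a resolution. The last condition
  places \<open>M\<close> in the maximal ideal times the free module, so any matrix whose columns
  lie in \<open>M\<close> is minimal.\<close>

definition good_mod :: "'w set \<Rightarrow> nat \<Rightarrow> (nat \<Rightarrow> nat) \<Rightarrow> (nat \<Rightarrow> ('w, 'k::field) mpoly) set \<Rightarrow> bool" where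
  "good_mod W r s M \<longleftrightarrow> fmod.subspace M \<and> M \<subseteq> free_mod r \<and> M \<subseteq> fmod.span {f \<in> M. \<exists>e. good W r s e f} \<and>
     (\<forall>f\<in>M. \<forall>l. const_coeff (f l) = 0)"

definition mat_kernel :: "nat \<Rightarrow> nat \<Rightarrow> (nat \<Rightarrow> nat \<Rightarrow> 'a::comm_ring_1) \<Rightarrow> (nat \<Rightarrow> 'a) set" where
  "mat_kernel r c A = {w \<in> free_mod c. \<forall>l<r. (\<Sum>k<c. A l k * w k) = 0}"

definition covers :: "'w set \<Rightarrow> nat \<Rightarrow> (nat \<Rightarrow> nat) \<Rightarrow> (nat \<Rightarrow> ('w, 'k::field) mpoly) set \<Rightarrow>
    nat \<Rightarrow> (nat \<Rightarrow> nat) \<Rightarrow> (nat \<Rightarrow> nat \<Rightarrow> ('w, 'k) mpoly) \<Rightarrow> bool" where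
  "covers W r s M r' s' A \<longleftrightarrow> (\<forall>k<r'. good W r s (s' k) (\<lambda>l. A l k)) \<and>
     M = {f. \<exists>w. f = (\<lambda>l. \<Sum>k<r'. A l k * w k)}"

lemma sum_fscale_apply: "(\<Sum>x\<in>A. fscale (u x) (g x)) l = (\<Sum>x\<in>A. u x * g x l)"
  by (induction A rule: infinite_finite_induct) (auto simp: fscale_def)

lemma finite_subset_span:
  assumes "finite A" "A \<subseteq> fmod.span G"
  shows "\<exists>T\<subseteq>G. finite T \<and> A \<subseteq> fmod.span T"
  using assms
proof (induction A)
  case (insert a A)
  then obtain T where T: "T \<subseteq> G" "finite T" "A \<subseteq> fmod.span T" by auto
  obtain t u where t: "finite t" "t \<subseteq> G" "a = (\<Sum>x\<in>t. fscale (u x) x)"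
    using insert.prems unfolding fmod.span_explicit by auto
  have "a \<in> fmod.span t"
    unfolding t(3) by (intro fmod.span_sum fmod.span_scale fmod.span_base)
  then have "insert a A \<subseteq> fmod.span (T \<union> t)"
    using T(3) fmod.span_mono[of T "T \<union> t"] fmod.span_mono[of t "T \<union> t"] by auto
  then show ?case using T t by (intro exI[of _ "T \<union> t"]) auto
qed auto

lemma mat_kernel_subspace: "fmod.subspace (mat_kernel r c A)"
  by (rule fmod.subspaceI)
    (auto simp: mat_kernel_def free_mod_def fscale_def algebra_simps sum.distrib simp flip: sum_distrib_left)

text \<open>Decomposing a vector by degree and by the monomials in the variables outside \<open>W\<close>.\<close>

lemma kernel_spanned_by_good:
  fixes A :: "nat \<Rightarrow> nat \<Rightarrow> ('w::finite, 'k::field) mpoly"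
  assumes A: "\<And>k. k < r' \<Longrightarrow> good W r s (s' k) (\<lambda>l. A l k)"
  shows "mat_kernel r r' A \<subseteq> fmod.span {w \<in> mat_kernel r r' A. \<exists>e. good W r' s' e w}"
proof
  fix w assume w: "w \<in> mat_kernel r r' A"
  \<comment> \<open>Entries of \<open>A\<close> involve only variables in \<open>W\<close> and are
    homogeneous. Multiplying by them keeps the part of a monomial outside \<open>W\<close> and moves
    the degree of the part inside \<open>W\<close> by exactly the shift, so each label component of
    a kernel vector is again in the kernel.\<close>
  define lab where "lab k m = (restr (- W) m, mdeg (restr W m) + s' k)" for k and m :: "'w \<Rightarrow>\<^sub>0 nat"
  define comp where "comp x k = push (\<lambda>m. lab k m = x) (restr W) (w k)" for x k
  define E where "E = (\<Union>k<r'. lab k ` keys (w k))"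
  have "w k = (\<Sum>x\<in>E. single (fst x) 1 * comp x k)" for k
  proof (cases "k < r'")
    case True
    then show ?thesis
      unfolding comp_def by (intro push_decompose) (auto simp: E_def lab_def restr_split)
  next
    case False
    then have "w k = 0" using w by (simp add: mat_kernel_def free_mod_def)
    then show ?thesis by (simp add: comp_def)
  qed
  then have weq: "w = (\<Sum>x\<in>E. fscale (single (fst x) 1) (comp x))"
    by (simp add: fun_eq_iff sum_fscale_apply)
  have "comp x \<in> {w \<in> mat_kernel r r' A. \<exists>e. good W r' s' e w}" for x
  proof -
    have "comp x \<in> free_mod r'"
      using w by (simp add: comp_def mat_kernel_def free_mod_def)
    moreover have "(\<Sum>k<r'. A l k * comp x k) = 0" if "l < r" for l
    proof -
      have "(\<Sum>k<r'. A l k * comp x k) =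
          (\<Sum>k<r'. push (\<lambda>m. (restr (- W) m, mdeg (restr W m) + s l) = x) (restr W) (A l k * w k))"
      proof (rule sum.cong[OF refl])
        fix k assume "k \<in> {..<r'}"
        then have k: "\<And>m. m \<in> keys (A l k) \<Longrightarrow> mdeg m + s l = s' k \<and> keys m \<subseteq> W"
          using A[of k] that by (auto simp: good_def polys_in_def)
        show "A l k * comp x k = push (\<lambda>m. (restr (- W) m, mdeg (restr W m) + s l) = x) (restr W) (A l k * w k)"
          unfolding comp_def
          by (rule push_mult[symmetric])
            (use k in \<open>auto simp: lab_def restr_add restr_id restr_compl_0 mdeg_add algebra_simps\<close>)
      qed
      also have "\<dots> = push (\<lambda>m. (restr (- W) m, mdeg (restr W m) + s l) = x) (restr W) (\<Sum>k<r'. A l k * w k)"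
        by (simp add: push_sum)
      finally show ?thesis
        using w that by (simp add: mat_kernel_def)
    qed
    moreover have "comp x k \<in> polys_in W \<and> (\<forall>m\<in>keys (comp x k). mdeg m + s' k = snd x)" for k
      using keys_push[of "\<lambda>m. lab k m = x" "restr W" "w k"]
      by (fastforce simp: comp_def lab_def polys_in_def dest: subsetD[OF keys_restr])
    ultimately show ?thesis
      by (auto simp: mat_kernel_def good_def)
  qed
  then show "w \<in> fmod.span {w \<in> mat_kernel r r' A. \<exists>e. good W r' s' e w}"
    by (subst weq) (intro fmod.span_sum fmod.span_scale fmod.span_base)
qed

text \<open>The columns are a homogeneous generating set of least cardinality. A homogeneous
  relation with a nonzero constant coefficient would express one generator by the others; this is
  the graded Nakayama lemma in elementary form.\<close>

lemma good_mod_cover: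
  fixes M :: "(nat \<Rightarrow> ('w::finite, 'k::field) mpoly) set"
  assumes M: "good_mod W r s M"
  shows "\<exists>r' s' A. covers W r s M r' s' A \<and> good_mod W r' s' (mat_kernel r r' A)"
proof -
  define G where "G = {f \<in> M. \<exists>e. good W r s e f}"
  have sub: "fmod.subspace M" and MG: "M \<subseteq> fmod.span G" and Mr: "M \<subseteq> free_mod r"
    using M by (auto simp: good_mod_def G_def)
  have GM: "fmod.span T \<subseteq> M" if "T \<subseteq> G" for T
    using that fmod.span_minimal[OF _ sub] by (auto simp: G_def)
  obtain A0 where A0: "A0 \<subseteq> M" "finite A0" "fmod.span A0 = M"
    using free_mod_submodule_finitely_generated[OF sub Mr] by blast
  \<comment> \<open>The finite generating set from the Noetherian property need not be homogeneous;
    each member is replaced by the finitely many good vectors that occur in it.\<close>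
  obtain T0 where T0: "T0 \<subseteq> G" "finite T0" "A0 \<subseteq> fmod.span T0"
    using finite_subset_span[OF A0(2) order_trans[OF A0(1) MG]] by (elim exE conjE)
  have "fmod.span T0 = M"
    using GM[OF T0(1)] A0(3) fmod.span_minimal[OF T0(3) fmod.subspace_span] by (simp add: subset_antisym)
  with T0 have "T0 \<subseteq> G \<and> finite T0 \<and> fmod.span T0 = M" by blast
  from arg_min_nat_lemma[of "\<lambda>T. T \<subseteq> G \<and> finite T \<and> fmod.span T = M", OF this, of card]
  obtain T where T': "(T \<subseteq> G \<and> finite T \<and> fmod.span T = M) \<and>
      (\<forall>T'. T' \<subseteq> G \<and> finite T' \<and> fmod.span T' = M \<longrightarrow> card T \<le> card T')"
    by (rule that)
  then have T: "T \<subseteq> G" "finite T" "fmod.span T = M"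
    and Tmin: "\<And>T'. T' \<subseteq> G \<Longrightarrow> finite T' \<Longrightarrow> fmod.span T' = M \<Longrightarrow> card T \<le> card T'"
    by simp_all
  define r' where "r' = card T"
  obtain g where g: "bij_betw g {..<r'} T"
    unfolding r'_def using ex_bij_betw_nat_finite[OF T(2)] by (auto simp: atLeast0LessThan)
  have gG: "g k \<in> G" if "k < r'" for k using g that T(1) by (auto simp: bij_betw_def)
  have "\<forall>k. \<exists>e. k < r' \<longrightarrow> good W r s e (g k)"
    using gG unfolding G_def by blast
  from choice[OF this] obtain s' where s': "\<And>k. k < r' \<Longrightarrow> good W r s (s' k) (g k)" by blast
  define A where "A l k = g k l" for l k
  have goodA: "good W r s (s' k) (\<lambda>l. A l k)" if "k < r'" for k
    using s'[OF that] by (simp add: A_def)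
  have "fmod.span T = {f. \<exists>w. f = (\<lambda>l. \<Sum>k<r'. A l k * w k)}"
  proof -
    have "(\<exists>u. f = (\<Sum>x\<in>T. fscale (u x) x)) \<longleftrightarrow> (\<exists>w. f = (\<lambda>l. \<Sum>k<r'. A l k * w k))" for f
    proof
      assume "\<exists>u. f = (\<Sum>x\<in>T. fscale (u x) x)"
      then obtain u where "f = (\<Sum>x\<in>T. fscale (u x) x)" by blast
      then have "f = (\<lambda>l. \<Sum>k<r'. A l k * u (g k))"
        by (auto simp: fun_eq_iff sum_fscale_apply A_def mult.commute intro!: sum.reindex_bij_betw[OF g, symmetric, THEN trans])
      then show "\<exists>w. f = (\<lambda>l. \<Sum>k<r'. A l k * w k)" by (rule exI[of _ "\<lambda>k. u (g k)"])
    next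
      assume "\<exists>w. f = (\<lambda>l. \<Sum>k<r'. A l k * w k)"
      then obtain w where w: "f = (\<lambda>l. \<Sum>k<r'. A l k * w k)" by blast
      have "(\<Sum>x\<in>T. w (inv_into {..<r'} g x) * x l) = (\<Sum>k<r'. A l k * w k)" for l
        by (subst sum.reindex_bij_betw[OF g, symmetric])
          (auto simp: A_def mult.commute bij_betw_inv_into_left[OF g] intro!: sum.cong)
      then have "f = (\<Sum>x\<in>T. fscale (w (inv_into {..<r'} g x)) x)"
        unfolding w by (simp add: fun_eq_iff sum_fscale_apply)
      then show "\<exists>u. f = (\<Sum>x\<in>T. fscale (u x) x)" by (rule exI[of _ "\<lambda>x. w (inv_into {..<r'} g x)"])
    qed
    then show ?thesis unfolding fmod.span_finite[OF T(2)] by auto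
  qed
  then have cov: "covers W r s M r' s' A"
    using goodA by (simp add: covers_def T(3))
  have c0: "const_coeff (w k) = 0" if w: "w \<in> mat_kernel r r' A" "good W r' s' e w" for w e k
  proof (rule ccontr)
    assume c: "const_coeff (w k) \<noteq> 0"
    have k: "k < r'" using w(1) c by (force simp: mat_kernel_def free_mod_def not_le[symmetric])
    have "0 \<in> keys (w k)" using c by (simp add: const_coeff_def in_keys_iff)
    moreover have kk: "\<forall>m\<in>keys (w k). mdeg m + s' k = e"
      using w(2) k by (simp add: good_def)
    \<comment> \<open>In a homogeneous relation an entry with a constant term has degree zero, hence
      is a nonzero constant and so a unit.\<close>
    ultimately have "e = s' k" by fastforce
    then have "keys (w k) \<subseteq> {0}" using kk by (auto simp: mdeg_eq_0_iff)
    then have "w k = single 0 (const_coeff (w k))"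
      using poly_mapping_sum_single[of "{0}" "w k"] by (simp add: const_coeff_def)
    then obtain c where wk: "w k = single 0 c" and "c \<noteq> 0"
      using c by metis
    \<comment> \<open>Scaling the relation so that \<open>g k\<close> has coefficient -1 solves it
      for \<open>g k\<close>.\<close>
    have inv: "single 0 (- inverse c) * w k = -1"
      unfolding wk using \<open>c \<noteq> 0\<close> by (simp add: mult_single single_uminus)
    have "g k = (\<Sum>j\<in>{..<r'} - {k}. fscale (single 0 (- inverse c) * w j) (g j))"
    proof
      fix l
      have 0: "(\<Sum>j<r'. w j * g j l) = 0"
      proof (cases "l < r")
        case True
        then show ?thesis using w(1) by (simp add: mat_kernel_def A_def mult.commute)
      next
        case False
        then have "g j l = 0" if "j < r'" for j
          using gG[OF that] Mr by (auto simp: G_def free_mod_def)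
        then show ?thesis by simp
      qed
      have "0 = single 0 (- inverse c) * (\<Sum>j<r'. w j * g j l)" using 0 by simp
      also have "\<dots> = (\<Sum>j<r'. single 0 (- inverse c) * w j * g j l)"
        by (simp add: sum_distrib_left mult.assoc)
      also have "\<dots> = single 0 (- inverse c) * w k * g k l + (\<Sum>j\<in>{..<r'} - {k}. single 0 (- inverse c) * w j * g j l)"
        using k by (intro sum.remove) auto
      finally show "g k l = (\<Sum>j\<in>{..<r'} - {k}. fscale (single 0 (- inverse c) * w j) (g j)) l"
        by (simp add: inv sum_fscale_apply)
    qed
    moreover have "g j \<in> T - {g k}" if "j \<in> {..<r'} - {k}" for j
      using that g k by (auto simp: bij_betw_def inj_on_def)
    then have "(\<Sum>j\<in>{..<r'} - {k}. fscale (single 0 (- inverse c) * w j) (g j)) \<in> fmod.span (T - {g k})"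
      by (intro fmod.span_sum fmod.span_scale fmod.span_base)
    ultimately have gk: "g k \<in> fmod.span (T - {g k})" by simp
    have "T \<subseteq> fmod.span (T - {g k})"
    proof
      fix x assume "x \<in> T"
      then show "x \<in> fmod.span (T - {g k})"
        using gk fmod.span_base[of x "T - {g k}"] by (cases "x = g k") auto
    qed
    from fmod.span_minimal[OF this fmod.subspace_span] have "fmod.span (T - {g k}) = M"
      using T(3) fmod.span_mono[of "T - {g k}" T] by auto
    then have "card T \<le> card (T - {g k})" using T by (intro Tmin) auto
    moreover have "g k \<in> T" using g k by (auto simp: bij_betw_def)
    ultimately show False using T(2) by (metis card_Diff1_less not_le)
  qed
  have kg: "mat_kernel r r' A \<subseteq> fmod.span {w \<in> mat_kernel r r' A. \<exists>e. good W r' s' e w}"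
    by (rule kernel_spanned_by_good) (rule goodA)
  \<comment> \<open>Vanishing of constant coefficients passes from the homogeneous relations to
    their span, which is the whole kernel.\<close>
  have "const_coeff (w k) = 0" if "w \<in> mat_kernel r r' A" for w k
  proof -
    have "w \<in> fmod.span {w \<in> mat_kernel r r' A. \<exists>e. good W r' s' e w}"
      using that kg by (rule subsetD[rotated])
    then show ?thesis
    proof (induction arbitrary: k rule: fmod.span_induct_alt)
      case base
      then show ?case by simp
    next
      case (step c x y)
      then show ?case using c0 by (auto simp: const_coeff_add fscale_def const_coeff_mult)
    qed
  qed
  then have "good_mod W r' s' (mat_kernel r r' A)"
    using kg mat_kernel_subspace[of r r' A] by (simp add: good_mod_def) (simp add: mat_kernel_def)
  then show ?thesis using cov by blast
qed

text \<open>Covers of successive kernels are iterated, starting from the ideal as a submodule of the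
  free module of rank one. Generators of positive degree put the ideal inside the maximal ideal,
  which makes even the first matrix minimal; the subring on \<open>W\<close> is preserved at every
  step.\<close>

theorem minimal_resolution_exists:
  fixes Gs :: "('w::finite, 'k::field) mpoly set"
  assumes Gs: "\<forall>p\<in>Gs. p \<in> polys_in W \<and> (\<exists>e>0. homog e p)"
  shows "\<exists>r s D. free_res (\<lambda>i. {..<r i}) s D (0::nat) (ideal_gen Gs) \<and>
    (\<forall>i. \<forall>l<r i. \<forall>k<r (Suc i). D i l k \<in> polys_in W)"
proof -
  define M0 where "M0 = {f \<in> free_mod 1. f 0 \<in> ideal_gen Gs}"
  have "good_mod W 1 (\<lambda>_. 0) M0"
    unfolding good_mod_def
  proof (intro conjI)
    show "fmod.subspace M0"
      by (rule fmod.subspaceI)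
        (auto simp: M0_def free_mod_def fscale_def ideal_gen_def ringmod.span_zero ringmod.span_add ringmod.span_scale)
    show "M0 \<subseteq> free_mod 1" by (auto simp: M0_def)
    have inc: "(\<lambda>l. if l = 0 then p else 0) \<in> fmod.span {f \<in> M0. \<exists>e. good W 1 (\<lambda>_. 0) e f} \<and> const_coeff p = 0"
      if "p \<in> ideal_gen Gs" for p
      using that unfolding ideal_gen_def
    proof (induction rule: ringmod.span_induct_alt)
      case base
      show ?case using fmod.span_zero[of "{f \<in> M0. \<exists>e. good W 1 (\<lambda>_. 0) e f}"] by (simp add: zero_fun_def)
    next
      case (step c x y)
      obtain e where e: "e > 0" "homog e x" "x \<in> polys_in W" using Gs step(1) by blast
      define f where "f = (\<lambda>l::nat. if l = 0 then x else 0)"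
      have "f \<in> {f \<in> M0. \<exists>e. good W 1 (\<lambda>_. 0) e f}"
        using e step(1) by (auto simp: f_def M0_def good_def free_mod_def homog_def ideal_gen_def ringmod.span_base)
      moreover have "(\<lambda>l::nat. if l = 0 then c * x + y else 0) = fscale c f + (\<lambda>l. if l = 0 then y else 0)"
        by (auto simp: f_def fscale_def)
      moreover have "const_coeff x = 0"
        using e by (force simp: homog_def const_coeff_def in_keys_iff)
      ultimately show ?case
        using step(2) by (simp only: const_coeff_add const_coeff_mult) (simp add: fmod.span_add fmod.span_scale fmod.span_base)
    qed
    have feq: "f = (\<lambda>l. if l = 0 then f 0 else 0)" if "f \<in> M0" for f
      using that by (auto simp: M0_def free_mod_def)
    show "M0 \<subseteq> fmod.span {f \<in> M0. \<exists>e. good W 1 (\<lambda>_. 0) e f}"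
    proof
      fix f assume "f \<in> M0"
      then show "f \<in> fmod.span {f \<in> M0. \<exists>e. good W 1 (\<lambda>_. 0) e f}"
        using inc[of "f 0"] feq[of f] by (simp add: M0_def)
    qed
    show "\<forall>f\<in>M0. \<forall>l. const_coeff (f l) = 0"
    proof (intro ballI allI)
      fix f l assume "f \<in> M0"
      then show "const_coeff (f l) = 0"
        using inc[of "f 0"] fun_cong[OF feq[of f], of l] by (auto simp: M0_def split: if_splits)
    qed
  qed
  \<comment> \<open>The state of the recursion is (rank, shifts, submodule to be covered); the
    matrices exist between consecutive states and are chosen afterwards.\<close>
  then have "\<exists>X. \<forall>n. (case X n of (r, s, M) \<Rightarrow> good_mod W r s M \<and> (n = 0 \<longrightarrow> r = 1 \<and> s = (\<lambda>_. 0) \<and> M = M0)) \<and>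
      (case X n of (r, s, M) \<Rightarrow> case X (Suc n) of (r', s', M') \<Rightarrow>
        \<exists>A. covers W r s M r' s' A \<and> M' = mat_kernel r r' A)"
    (is "\<exists>X. \<forall>n. ?P n (X n) \<and> ?Q (X n) (X (Suc n))")
  proof (intro dependent_nat_choice)
    assume "good_mod W 1 (\<lambda>_. 0) M0"
    then show "\<exists>x. ?P 0 x" by (intro exI[of _ "(1, \<lambda>_. 0, M0)"]) simp
  next
    fix x n assume "?P n x"
    then obtain r s M where x: "x = (r, s, M)" "good_mod W r s M" by (cases x) auto
    from good_mod_cover[OF x(2)] obtain r' s' A where A: "covers W r s M r' s' A" "good_mod W r' s' (mat_kernel r r' A)"
      by blast
    then show "\<exists>y. ?P (Suc n) y \<and> ?Q x y"
      by (intro exI[of _ "(r', s', mat_kernel r r' A)"]) (auto simp: x(1))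
  qed
  then obtain X where X0: "\<forall>n. ?P n (X n) \<and> ?Q (X n) (X (Suc n))" by (rule exE)
  note X = conjunct1[OF spec[OF X0]] conjunct2[OF spec[OF X0]]
  define r s M where "r n = fst (X n)" and "s n = fst (snd (X n))" and "M n = snd (snd (X n))" for n
  have Xeq: "X n = (r n, s n, M n)" for n by (simp add: r_def s_def M_def)
  have gm: "good_mod W (r n) (s n) (M n)" for n using X(1)[of n] by (simp add: Xeq)
  have i0: "r 0 = 1" "s 0 = (\<lambda>_. 0)" "M 0 = M0" using X(1)[of 0] by (auto simp: Xeq)
  have "\<forall>n. \<exists>A. covers W (r n) (s n) (M n) (r (Suc n)) (s (Suc n)) A \<and> M (Suc n) = mat_kernel (r n) (r (Suc n)) A"
    using X(2) by (simp add: Xeq)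
  from choice[OF this] obtain D where D: "\<And>n. covers W (r n) (s n) (M n) (r (Suc n)) (s (Suc n)) (D n)"
      "\<And>n. M (Suc n) = mat_kernel (r n) (r (Suc n)) (D n)" by auto
  have Dg: "good W (r i) (s i) (s (Suc i) k) (\<lambda>l. D i l k)" if "k < r (Suc i)" for i k
    using D(1)[of i] that by (simp add: covers_def)
  have MD: "f \<in> M i \<longleftrightarrow> (\<exists>w. f = (\<lambda>l. \<Sum>k<r (Suc i). D i l k * w k))" for i f
    using D(1)[of i] by (auto simp: covers_def)
  have col: "(\<lambda>l. D i l k) \<in> M i" if "k < r (Suc i)" for i k
  proof -
    have "D i l k = (\<Sum>j<r (Suc i). D i l j * (if j = k then 1 else 0))" for l
      using that by (simp add: if_distrib cong: if_cong)
    then show ?thesis unfolding MD by (intro exI[of _ "\<lambda>j. if j = k then 1 else 0"]) auto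
  qed
  have "free_res (\<lambda>i. {..<r i}) s D (0::nat) (ideal_gen Gs)"
    unfolding free_res_def
  proof (intro conjI allI ballI)
    show "{..<r 0} = {0}" "s 0 0 = 0" using i0 by auto
  next
    fix i l k m assume "l \<in> {..<r i}" "k \<in> {..<r (Suc i)}" "m \<in> keys (D i l k)"
    then show "mdeg m + s i l = s (Suc i) k" using Dg[of k i] by (auto simp: good_def)
  next
    fix i l k assume "l \<in> {..<r i}" "k \<in> {..<r (Suc i)}"
    then show "const_coeff (D i l k) = 0" using col[of k i] gm[of i] by (auto simp: good_mod_def)
  next
    fix p
    have "p \<in> ideal_gen Gs \<longleftrightarrow> (\<lambda>l. if l = 0 then p else 0) \<in> M 0"
      by (auto simp: i0 M0_def free_mod_def)
    also have "\<dots> \<longleftrightarrow> (\<exists>w. p = (\<Sum>k<r 1. D 0 0 k * w k))"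
    proof
      assume "(\<lambda>l. if l = 0 then p else 0) \<in> M 0"
      then obtain w where "(\<lambda>l. if l = 0 then p else 0) = (\<lambda>l. \<Sum>k<r 1. D 0 l k * w k)"
        by (auto simp: MD)
      from fun_cong[OF this, of 0] show "\<exists>w. p = (\<Sum>k<r 1. D 0 0 k * w k)" by auto
    next
      assume "\<exists>w. p = (\<Sum>k<r 1. D 0 0 k * w k)"
      then obtain w where w: "p = (\<Sum>k<r 1. D 0 0 k * w k)" by blast
      have "D 0 l k = 0" if "l \<noteq> 0" "k < r (Suc 0)" for l k
        using Dg[OF that(2)] that(1) by (auto simp: good_def free_mod_def i0)
      then have "(\<lambda>l. if l = 0 then p else 0) = (\<lambda>l. \<Sum>k<r (Suc 0). D 0 l k * w k)"
        by (auto simp: w)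
      then show "(\<lambda>l. if l = 0 then p else 0) \<in> M 0" unfolding MD by blast
    qed
    finally show "p \<in> ideal_gen Gs \<longleftrightarrow> (\<exists>w. p = (\<Sum>k<r 1. D 0 0 k * w k))" .
  next
    fix i l k assume "l \<in> {..<r i}" "k \<in> {..<r (Suc (Suc i))}"
    then show "(\<Sum>j<r (Suc i). D i l j * D (Suc i) j k) = 0"
      using col[of k "Suc i"] D(2)[of i] by (auto simp: mat_kernel_def)
  next
    fix i u
    show "(\<forall>l\<in>{..<r i}. (\<Sum>k<r (Suc i). D i l k * u k) = 0) \<longrightarrow>
      (\<exists>w. \<forall>k\<in>{..<r (Suc i)}. u k = (\<Sum>j<r (Suc (Suc i)). D (Suc i) k j * w j))"
    proof
      assume u: "\<forall>l\<in>{..<r i}. (\<Sum>k<r (Suc i). D i l k * u k) = 0"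
      define u' where "u' k = (if k < r (Suc i) then u k else 0)" for k
      have "u' \<in> M (Suc i)"
        using u by (auto simp: D(2) mat_kernel_def free_mod_def u'_def)
      then obtain w where "u' = (\<lambda>l. \<Sum>k<r (Suc (Suc i)). D (Suc i) l k * w k)" by (auto simp: MD)
      then have "\<forall>k<r (Suc i). u k = (\<Sum>j<r (Suc (Suc i)). D (Suc i) k j * w j)"
        by (metis u'_def)
      then show "\<exists>w. \<forall>k\<in>{..<r (Suc i)}. u k = (\<Sum>j<r (Suc (Suc i)). D (Suc i) k j * w j)" by blast
    qed
  qed auto
  moreover have "\<forall>i. \<forall>l<r i. \<forall>k<r (Suc i). D i l k \<in> polys_in W"
    using Dg by (auto simp: good_def)
  ultimately show ?thesis by blast
qed

section \<open>Independence of the graded Betti numbers of the resolution\<close>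

text \<open>Extend a basis of \<open>B\<close> to one of \<open>Z\<close>. The images of the added
  vectors are independent modulo \<open>B'\<close>, since a combination of them mapped into
  \<open>B'\<close> already lies in \<open>B\<close>. Counting vectors in \<open>Z'\<close> gives
  the inequality without forming quotient spaces.\<close>

lemma (in vector_space) quotient_dim_le:
  assumes fin: "finite E" "Z \<subseteq> span E" "finite E'" "Z' \<subseteq> span E'"
    and sub: "subspace B" "subspace Z" "subspace B'" "subspace Z'" "B \<subseteq> Z" "B' \<subseteq> Z'"
    and add: "\<And>x y. f (x + y) = f x + f y" and scale: "\<And>c x. f (c *s x) = c *s f x"
    and fZ: "\<And>x. x \<in> Z \<Longrightarrow> f x \<in> Z'" and inj: "\<And>x. x \<in> Z \<Longrightarrow> f x \<in> B' \<Longrightarrow> x \<in> B"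
  shows "dim Z - dim B \<le> dim Z' - dim B'"
proof -
  interpret f: module_hom scale scale f by unfold_locales (rule add, rule scale)
  obtain b where b: "b \<subseteq> B" "independent b" "B \<subseteq> span b" "card b = dim B"
    by (rule basis_exists)
  have "b \<subseteq> Z" using b sub by blast
  then obtain C where C: "b \<subseteq> C" "C \<subseteq> Z" "independent C" "Z \<subseteq> span C"
    using maximal_independent_subset_extend b(2) by blast
  have spb: "span b = B" using b sub(1) by (meson span_minimal subset_antisym)
  have finC: "finite C" using independent_span_bound[OF fin(1) C(3)] C(2) fin(2) by blast
  have dZ: "dim Z = card C" using dim_unique[OF C(2,4,3)] by simp
  obtain b' where b': "b' \<subseteq> B'" "independent b'" "B' \<subseteq> span b'" "card b' = dim B'"
    by (rule basis_exists)
  have spb': "span b' = B'" using b' sub(3) by (meson span_minimal subset_antisym)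
  have finb': "finite b'" using independent_span_bound[OF fin(3) b'(2)] b'(1) sub(6) fin(4) by blast
  have main: "independent (b' \<union> f ` A) \<and> card (b' \<union> f ` A) = card b' + card A" if "finite A" "A \<subseteq> C - b" for A
    using that
  proof (induction A)
    case empty
    then show ?case using b' by simp
  next
    \<comment> \<open>If \<open>f a\<close> were dependent on the rest, then \<open>a\<close> minus
      a combination of \<open>A\<close> would map into \<open>B'\<close>, hence lie in the span of
      \<open>b\<close>, against the independence of \<open>C\<close>.\<close>
    case (insert a A)
    have notin: "f a \<notin> span (b' \<union> f ` A)"
    proof
      assume "f a \<in> span (b' \<union> f ` A)"
      then obtain x y where xy: "f a = x + y" "x \<in> B'" "y \<in> span (f ` A)"
        unfolding span_Un spb' by blast
      then obtain y0 where y0: "y = f y0" "y0 \<in> span A"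
        using f.span_image[of A] by blast
      have "y0 \<in> Z" using y0(2) insert.prems C(2) span_minimal[OF _ sub(2)] by blast
      moreover have "a \<in> Z" using insert.prems C(2) by blast
      moreover have "f (a - y0) = x" using xy(1) y0(1) by (simp add: f.diff)
      ultimately have "a - y0 \<in> span b"
        using inj[of "a - y0"] xy(2) sub(2) spb by (simp add: subspace_diff)
      then have "(a - y0) + y0 \<in> span (C - {a})"
      proof (intro span_add)
        assume "a - y0 \<in> span b"
        moreover have "b \<subseteq> C - {a}" using C(1) insert.prems by blast
        ultimately show "a - y0 \<in> span (C - {a})" using span_mono by blast
        have "A \<subseteq> C - {a}" using insert by blast
        then show "y0 \<in> span (C - {a})" using y0(2) span_mono by blast
      qed
      then show False using C(3) insert.prems by (auto simp: dependent_def)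
    qed
    have IH: "independent (b' \<union> f ` A)" "card (b' \<union> f ` A) = card b' + card A" using insert by auto
    have eq: "b' \<union> f ` insert a A = insert (f a) (b' \<union> f ` A)" by blast
    have "f a \<notin> b' \<union> f ` A" using notin span_base[of "f a" "b' \<union> f ` A"] by metis
    then have "card (b' \<union> f ` insert a A) = card b' + card (insert a A)"
      unfolding eq using insert.hyps finb' IH(2) by simp
    moreover have "independent (b' \<union> f ` insert a A)"
      unfolding eq using notin IH(1) by (rule independent_insertI)
    ultimately show ?case by blast
  qed
  have T: "independent (b' \<union> f ` (C - b))" "card (b' \<union> f ` (C - b)) = card b' + card (C - b)"
    using main[of "C - b"] finC by auto
  obtain c where c: "c \<subseteq> Z'" "independent c" "Z' \<subseteq> span c" "card c = dim Z'"
    by (rule basis_exists)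
  have finc: "finite c" using independent_span_bound[OF fin(3) c(2)] c(1) fin(4) by blast
  have "b' \<union> f ` (C - b) \<subseteq> Z'" using b'(1) sub(6) fZ C(2) by blast
  then have "card (b' \<union> f ` (C - b)) \<le> card c"
    using independent_span_bound[OF finc T(1)] c(3) by blast
  then have "dim B' + card (C - b) \<le> dim Z'" using T(2) c(4) b'(4) by simp
  moreover have "card (C - b) = dim Z - dim B"
    using dZ b(4) C(1) finC by (simp add: card_Diff_subset finite_subset)
  ultimately show ?thesis by linarith
qed

interpretation kv: vector_space "\<lambda>(c::'k::field) (f::nat \<Rightarrow> 'k) k. c * f k"
  by (rule vector_space_fun)

subsection \<open>Matrices\<close>

definition mm :: "nat \<Rightarrow> (nat \<Rightarrow> nat \<Rightarrow> 'a::comm_ring_1) \<Rightarrow> (nat \<Rightarrow> nat \<Rightarrow> 'a) \<Rightarrow> nat \<Rightarrow> nat \<Rightarrow> 'a" where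
  "mm n A B l k = (\<Sum>j<n. A l j * B j k)"

definition idm :: "nat \<Rightarrow> nat \<Rightarrow> 'a::comm_ring_1" where
  "idm l k = (if l = k then 1 else 0)"

lemma mm_assoc: "mm n (mm m A B) C l k = mm m A (mm n B C) l k"
  unfolding mm_def sum_distrib_left sum_distrib_right by (subst sum.swap) (simp add: mult.assoc)

lemma mm_idm_left: "l < n \<Longrightarrow> mm n idm A l k = A l k"
  unfolding mm_def idm_def by (simp add: if_distrib[where f = "\<lambda>x. x * _"] cong: if_cong)

lemma mm_idm_right: "k < n \<Longrightarrow> mm n A idm l k = A l k"
  unfolding mm_def idm_def by (simp add: if_distrib cong: if_cong)

lemma mm_cong: "(\<And>j. j < n \<Longrightarrow> A l j = A' l j) \<Longrightarrow> (\<And>j. j < n \<Longrightarrow> C j k = C' j k) \<Longrightarrow> mm n A C l k = mm n A' C' l k"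
  unfolding mm_def by (intro sum.cong) auto

lemma mm_diff_left: "mm n (\<lambda>l k. A l k - A' l k) C l k = mm n A C l k - mm n A' C l k"
  by (simp add: mm_def left_diff_distrib sum_subtractf)

lemma mm_diff_right: "mm n A (\<lambda>l k. C l k - C' l k) l k = mm n A C l k - mm n A C' l k"
  by (simp add: mm_def right_diff_distrib sum_subtractf)

lemma mm_zero_left: "(\<And>j. j < n \<Longrightarrow> A l j = 0) \<Longrightarrow> mm n A C l k = 0"
  by (simp add: mm_def)

lemma mm_zero_right: "(\<And>j. j < n \<Longrightarrow> C j k = 0) \<Longrightarrow> mm n A C l k = 0"
  by (simp add: mm_def)

lemma const_coeff_mm:
  fixes A C :: "nat \<Rightarrow> nat \<Rightarrow> ('w, 'k::comm_ring_1) mpoly"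
  shows "const_coeff (mm n A C l k) = mm n (\<lambda>l k. const_coeff (A l k)) (\<lambda>l k. const_coeff (C l k)) l k"
  by (simp add: mm_def const_coeff_sum const_coeff_mult)

lemma mat_app_mat_app: "mat_app a b A (mat_app b c C f) = mat_app a c (mm b A C) f"
proof
  fix l
  have "(\<Sum>k<b. A l k * (\<Sum>j<c. C k j * f j)) = (\<Sum>j<c. (\<Sum>k<b. A l k * C k j) * f j)"
    unfolding sum_distrib_left sum_distrib_right by (subst sum.swap) (simp add: mult.assoc)
  then show "mat_app a b A (mat_app b c C f) l = mat_app a c (mm b A C) f l"
    by (simp add: mat_app_def mm_def)
qed

lemma mat_app_cong: "(\<And>l k. l < a \<Longrightarrow> k < c \<Longrightarrow> A l k = A' l k) \<Longrightarrow> mat_app a c A f = mat_app a c A' f"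
  unfolding mat_app_def by (auto intro!: sum.cong)

lemma mat_app_add: "mat_app a c A (f + g) = mat_app a c A f + mat_app a c A g"
  by (auto simp: mat_app_def fun_eq_iff distrib_left sum.distrib)

lemma mat_app_scale: "mat_app a c A (\<lambda>k. x * f k) = (\<lambda>k. x * mat_app a c A f k)"
  by (auto simp: mat_app_def fun_eq_iff sum_distrib_left mult_ac)

lemma mat_app_diff: "mat_app a c A (f - g) = mat_app a c A f - mat_app a c A g"
  by (auto simp: mat_app_def fun_eq_iff right_diff_distrib sum_subtractf)

lemma mat_app_zero [simp]: "mat_app a c A 0 = 0"
  by (auto simp: mat_app_def fun_eq_iff)

lemma mat_app_in_free_mod [simp]: "mat_app a c A f \<in> free_mod a"
  by (simp add: mat_app_def free_mod_def)

subsection \<open>Comparison of resolutions\<close>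

text \<open>Elementwise form of \<open>graded_free_resolution\<close>: the equalities of image and
  kernel are split into complex and exactness, and vectors may take any values beyond the rank,
  which avoids truncating them in every step.\<close>

locale graded_res =
  fixes r :: "nat \<Rightarrow> nat" and s :: "nat \<Rightarrow> nat \<Rightarrow> nat" and d :: "nat \<Rightarrow> nat \<Rightarrow> nat \<Rightarrow> ('w::finite, 'k::field) mpoly"
    and g :: "nat \<Rightarrow> ('w, 'k) mpoly" and I :: "('w, 'k) mpoly set"
  assumes hom_g: "\<And>k m. k < r 0 \<Longrightarrow> m \<in> keys (g k) \<Longrightarrow> mdeg m = s 0 k"
    and hom_d: "\<And>i l k m. l < r i \<Longrightarrow> k < r (Suc i) \<Longrightarrow> m \<in> keys (d i l k) \<Longrightarrow> mdeg m + s i l = s (Suc i) k"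
    and surj: "\<And>p. \<exists>f. p - (\<Sum>k<r 0. f k * g k) \<in> I"
    and aug: "\<And>k. k < r 1 \<Longrightarrow> (\<Sum>j<r 0. d 0 j k * g j) \<in> I"
    and exact0: "\<And>u. (\<Sum>k<r 0. u k * g k) \<in> I \<Longrightarrow> \<exists>w. \<forall>k<r 0. u k = (\<Sum>j<r 1. d 0 k j * w j)"
    and complex: "\<And>i l k. l < r i \<Longrightarrow> k < r (Suc (Suc i)) \<Longrightarrow> mm (r (Suc i)) (d i) (d (Suc i)) l k = 0"
    and exact: "\<And>i u. (\<And>l. l < r i \<Longrightarrow> (\<Sum>k<r (Suc i). d i l k * u k) = 0) \<Longrightarrow>
        \<exists>w. \<forall>k<r (Suc i). u k = (\<Sum>j<r (Suc (Suc i)). d (Suc i) k j * w j)"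

definition homog_ideal :: "('w::finite, 'k::field) mpoly set \<Rightarrow> bool" where
  "homog_ideal I \<longleftrightarrow> 0 \<in> I \<and> (\<forall>p\<in>I. \<forall>q\<in>I. p + q \<in> I) \<and> (\<forall>a. \<forall>p\<in>I. a * p \<in> I) \<and> (\<forall>p\<in>I. \<forall>e. hpart_shift e 0 p \<in> I)"

lemma homog_ideal_diff: "homog_ideal I \<Longrightarrow> p \<in> I \<Longrightarrow> q \<in> I \<Longrightarrow> p - q \<in> I"
  unfolding homog_ideal_def by (metis diff_conv_add_uminus mult_minus1)

lemma homog_ideal_sum: "homog_ideal I \<Longrightarrow> (\<And>x. x \<in> A \<Longrightarrow> f x \<in> I) \<Longrightarrow> sum f A \<in> I"
  by (induction A rule: infinite_finite_induct) (auto simp: homog_ideal_def)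

text \<open>That images lie in kernels is tested on unit vectors; for exactness a vector is first
  cut off beyond the rank.\<close>

lemma graded_free_resolution_imp_graded_res:
  fixes F :: "('w::finite, 'k::field) mpoly graded_free_seq"
  assumes F: "graded_free_resolution F I" and I: "homog_ideal I"
  shows "\<exists>g. graded_res (rnk F) (shift F) (diff F) g I"
proof -
  obtain g where g: "\<forall>k<rnk F 0. \<forall>m\<in>keys (g k). mdeg m = shift F 0 k"
    and hom: "\<forall>i. \<forall>l<rnk F i. \<forall>k<rnk F (Suc i). \<forall>m\<in>keys (diff F i l k). mdeg m + shift F i l = shift F (Suc i) k"
    and sur: "\<forall>p. \<exists>f\<in>free_mod (rnk F 0). p - (\<Sum>k<rnk F 0. f k * g k) \<in> I"
    and e0: "{f \<in> free_mod (rnk F 0). (\<Sum>k<rnk F 0. f k * g k) \<in> I} =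
       mat_app (rnk F 0) (rnk F 1) (diff F 0) ` free_mod (rnk F 1)"
    and ei: "\<forall>i. {f \<in> free_mod (rnk F (Suc i)). mat_app (rnk F i) (rnk F (Suc i)) (diff F i) f = 0} =
       mat_app (rnk F (Suc i)) (rnk F (Suc (Suc i))) (diff F (Suc i)) ` free_mod (rnk F (Suc (Suc i)))"
    using F unfolding graded_free_resolution_def by (elim exE conjE) (rule that)
  define unit where "unit k = (\<lambda>j. if j = k then (1 :: ('w, 'k) mpoly) else 0)" for k :: nat
  have unit: "unit k \<in> free_mod n" "mat_app a n A (unit k) = (\<lambda>l. if l < a then A l k else 0)" if "k < n" for a n k A
    using that by (auto simp: unit_def free_mod_def mat_app_def fun_eq_iff if_distrib cong: if_cong)
  have "graded_res (rnk F) (shift F) (diff F) g I"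
  proof
    show "\<And>k m. k < rnk F 0 \<Longrightarrow> m \<in> keys (g k) \<Longrightarrow> mdeg m = shift F 0 k" using g by blast
    show "\<And>i l k m. l < rnk F i \<Longrightarrow> k < rnk F (Suc i) \<Longrightarrow> m \<in> keys (diff F i l k) \<Longrightarrow> mdeg m + shift F i l = shift F (Suc i) k"
      using hom by blast
    show "\<exists>f. p - (\<Sum>k<rnk F 0. f k * g k) \<in> I" for p using sur by blast
  next
    fix k assume k: "k < rnk F 1"
    have "mat_app (rnk F 0) (rnk F 1) (diff F 0) (unit k) \<in> {f \<in> free_mod (rnk F 0). (\<Sum>k<rnk F 0. f k * g k) \<in> I}"
      unfolding e0 using unit(1)[OF k] by blast
    then show "(\<Sum>j<rnk F 0. diff F 0 j k * g j) \<in> I" unfolding unit(2)[OF k] by simp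
  next
    fix u assume u: "(\<Sum>k<rnk F 0. u k * g k) \<in> I"
    define u' where "u' k = (if k < rnk F 0 then u k else 0)" for k
    have "u' \<in> {f \<in> free_mod (rnk F 0). (\<Sum>k<rnk F 0. f k * g k) \<in> I}"
      using u by (simp add: u'_def free_mod_def)
    then obtain w where "u' = mat_app (rnk F 0) (rnk F 1) (diff F 0) w" unfolding e0 by blast
    then have "u' k = mat_app (rnk F 0) (rnk F 1) (diff F 0) w k" for k by simp
    then have "\<forall>k<rnk F 0. u k = (\<Sum>j<rnk F 1. diff F 0 k j * w j)"
      unfolding u'_def mat_app_def by metis
    then show "\<exists>w. \<forall>k<rnk F 0. u k = (\<Sum>j<rnk F 1. diff F 0 k j * w j)" by blast
  next
    fix i l k assume lk: "l < rnk F i" "k < rnk F (Suc (Suc i))"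
    have "mat_app (rnk F (Suc i)) (rnk F (Suc (Suc i))) (diff F (Suc i)) (unit k) \<in>
        {f \<in> free_mod (rnk F (Suc i)). mat_app (rnk F i) (rnk F (Suc i)) (diff F i) f = 0}"
      using ei unit(1)[OF lk(2)] by blast
    then have "mat_app (rnk F i) (rnk F (Suc i)) (diff F i) (\<lambda>j. if j < rnk F (Suc i) then diff F (Suc i) j k else 0) l = 0"
      unfolding unit(2)[OF lk(2)] by simp
    then show "mm (rnk F (Suc i)) (diff F i) (diff F (Suc i)) l k = 0"
      using lk by (simp add: mat_app_def mm_def)
  next
    fix i u assume u: "\<And>l. l < rnk F i \<Longrightarrow> (\<Sum>k<rnk F (Suc i). diff F i l k * u k) = 0"
    define u' where "u' k = (if k < rnk F (Suc i) then u k else 0)" for k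
    have "u' \<in> {f \<in> free_mod (rnk F (Suc i)). mat_app (rnk F i) (rnk F (Suc i)) (diff F i) f = 0}"
      using u by (auto simp: u'_def free_mod_def mat_app_def fun_eq_iff)
    then obtain w where "u' = mat_app (rnk F (Suc i)) (rnk F (Suc (Suc i))) (diff F (Suc i)) w" using ei by blast
    then have "u' k = mat_app (rnk F (Suc i)) (rnk F (Suc (Suc i))) (diff F (Suc i)) w k" for k by simp
    then have "\<forall>k<rnk F (Suc i). u k = (\<Sum>j<rnk F (Suc (Suc i)). diff F (Suc i) k j * w j)"
      unfolding u'_def mat_app_def by metis
    then show "\<exists>w. \<forall>k<rnk F (Suc i). u k = (\<Sum>j<rnk F (Suc (Suc i)). diff F (Suc i) k j * w j)" by blast
  qed
  then show ?thesis by blast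
qed

locale two_graded_res = F: graded_res r s d g I + F': graded_res r' s' d' g' I
  for r s and d :: "nat \<Rightarrow> nat \<Rightarrow> nat \<Rightarrow> ('w::finite, 'k::field) mpoly" and g r' s' d' g' I +
  assumes I: "homog_ideal I"
begin

text \<open>The lift of the identity of S/I is built degree by degree. An arbitrary lift exists by
  exactness and is replaced by its homogeneous component of the right degree, which still lifts
  because the differentials and the earlier maps are homogeneous.\<close>

lemma chain_map_exists:
  "\<exists>\<phi>. (\<forall>i. \<forall>l<r' i. \<forall>k<r i. \<forall>m\<in>keys (\<phi> i l k). mdeg m + s' i l = s i k) \<and>
    (\<forall>k<r 0. g k - (\<Sum>l<r' 0. \<phi> 0 l k * g' l) \<in> I) \<and>
    (\<forall>i. \<forall>l<r' i. \<forall>k<r (Suc i). mm (r' (Suc i)) (d' i) (\<phi> (Suc i)) l k = mm (r i) (\<phi> i) (d i) l k)"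
proof -
  define hm where "hm i \<phi> \<longleftrightarrow> (\<forall>l<r' i. \<forall>k<r i. \<forall>m\<in>keys (\<phi> l k). mdeg m + s' i l = s i k)"
    for i and \<phi> :: "nat \<Rightarrow> nat \<Rightarrow> ('w, 'k) mpoly"
  \<comment> \<open>The part of the invariant that makes the next step possible: every column of
    \<open>\<phi>\<close> composed with \<open>d i\<close> is a boundary of the target.\<close>
  define im where "im i \<phi> \<longleftrightarrow> (\<forall>k<r (Suc i). \<exists>w. \<forall>l<r' i. mm (r i) \<phi> (d i) l k = (\<Sum>j<r' (Suc i). d' i l j * w j))"
    for i \<phi>
  define P where "P i \<phi> \<longleftrightarrow> hm i \<phi> \<and> im i \<phi> \<and> (i = 0 \<longrightarrow> (\<forall>k<r 0. g k - (\<Sum>l<r' 0. \<phi> l k * g' l) \<in> I))" for i \<phi>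
  define Q where "Q i \<phi> \<psi> \<longleftrightarrow> (\<forall>l<r' i. \<forall>k<r (Suc i). mm (r' (Suc i)) (d' i) \<psi> l k = mm (r i) \<phi> (d i) l k)" for i \<phi> \<psi>
  have "\<exists>\<phi>. \<forall>i. P i (\<phi> i) \<and> Q i (\<phi> i) (\<phi> (Suc i))"
  proof (rule dependent_nat_choice)
    obtain f where f: "\<And>k. g k - (\<Sum>l<r' 0. f k l * g' l) \<in> I"
      using choice[OF allI[of "\<lambda>k. \<exists>f. g k - (\<Sum>l<r' 0. f l * g' l) \<in> I", OF F'.surj]] by blast
    define \<phi> where "\<phi> l k = hpart_shift (s 0 k) (s' 0 l) (f k l)" for l k
    have c0: "g k - (\<Sum>l<r' 0. \<phi> l k * g' l) \<in> I" if k: "k < r 0" for k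
    proof -
      have "hpart_shift (s 0 k) 0 (g k - (\<Sum>l<r' 0. f k l * g' l)) \<in> I"
        using f I by (simp add: homog_ideal_def)
      moreover have "hpart_shift (s 0 k) 0 (g k) = g k"
        using F.hom_g[OF k] by (intro hpart_shift_id) simp
      moreover have "hpart_shift (s 0 k) 0 (\<Sum>l<r' 0. f k l * g' l) = (\<Sum>l<r' 0. \<phi> l k * g' l)"
        unfolding hpart_shift_sum
      proof (rule sum.cong[OF refl])
        fix l assume "l \<in> {..<r' 0}"
        then show "hpart_shift (s 0 k) 0 (f k l * g' l) = \<phi> l k * g' l"
          using hpart_shift_mult[of "g' l" 0 "s' 0 l" "s 0 k" "f k l"] F'.hom_g[of l]
          by (simp add: \<phi>_def mult.commute)
      qed
      ultimately show ?thesis by (simp add: hpart_shift_def push_diff)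
    qed
    have "im 0 \<phi>"
      unfolding im_def
    proof (intro allI impI)
      fix k assume k: "k < r (Suc 0)"
      have "(\<Sum>l<r' 0. mm (r 0) \<phi> (d 0) l k * g' l) = (\<Sum>j<r 0. d 0 j k * (\<Sum>l<r' 0. \<phi> l j * g' l))"
        unfolding mm_def sum_distrib_left sum_distrib_right by (subst sum.swap) (simp add: mult_ac)
      also have "\<dots> = (\<Sum>j<r 0. d 0 j k * g j) - (\<Sum>j<r 0. d 0 j k * (g j - (\<Sum>l<r' 0. \<phi> l j * g' l)))"
        by (simp add: right_diff_distrib sum_subtractf)
      also have "\<dots> \<in> I"
      proof (rule homog_ideal_diff[OF I])
        show "(\<Sum>j<r 0. d 0 j k * g j) \<in> I" using F.aug[of k] k by simp
        show "(\<Sum>j<r 0. d 0 j k * (g j - (\<Sum>l<r' 0. \<phi> l j * g' l))) \<in> I"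
          using c0 I by (intro homog_ideal_sum) (auto simp: homog_ideal_def)
      qed
      finally show "\<exists>w. \<forall>l<r' 0. mm (r 0) \<phi> (d 0) l k = (\<Sum>j<r' (Suc 0). d' 0 l j * w j)"
        using F'.exact0 by simp
    qed
    moreover have "hm 0 \<phi>" by (auto simp: hm_def \<phi>_def dest: keys_hpart_shift)
    ultimately show "\<exists>\<phi>. P 0 \<phi>" using c0 by (auto simp: P_def)
  next
    fix \<phi> i assume P: "P i \<phi>"
    have "\<forall>k. \<exists>w. k < r (Suc i) \<longrightarrow> (\<forall>l<r' i. mm (r i) \<phi> (d i) l k = (\<Sum>j<r' (Suc i). d' i l j * w j))"
      using P unfolding P_def im_def by blast
    from choice[OF this] obtain w where w: "\<And>k l. k < r (Suc i) \<Longrightarrow> l < r' i \<Longrightarrow>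
        mm (r i) \<phi> (d i) l k = (\<Sum>j<r' (Suc i). d' i l j * w k j)" by blast
    define \<psi> where "\<psi> l k = hpart_shift (s (Suc i) k) (s' (Suc i) l) (w k l)" for l k
    have Q: "Q i \<phi> \<psi>"
      unfolding Q_def
    proof (intro allI impI)
      fix l k assume lk: "l < r' i" "k < r (Suc i)"
      have "mm (r' (Suc i)) (d' i) \<psi> l k = hpart_shift (s (Suc i) k) (s' i l) (\<Sum>j<r' (Suc i). d' i l j * w k j)"
        unfolding mm_def hpart_shift_sum \<psi>_def
        using F'.hom_d lk by (intro sum.cong refl hpart_shift_mult[symmetric]) auto
      also have "\<dots> = hpart_shift (s (Suc i) k) (s' i l) (mm (r i) \<phi> (d i) l k)" using w lk by simp
      also have "\<dots> = mm (r i) \<phi> (d i) l k"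
        unfolding mm_def hpart_shift_sum
      proof (rule sum.cong[OF refl])
        fix j assume j: "j \<in> {..<r i}"
        have "hpart_shift (s (Suc i) k) (s' i l) (\<phi> l j * d i j k) = \<phi> l j * hpart_shift (s (Suc i) k) (s i j) (d i j k)"
          using P j lk by (intro hpart_shift_mult) (auto simp: P_def hm_def)
        also have "hpart_shift (s (Suc i) k) (s i j) (d i j k) = d i j k"
          using F.hom_d j lk by (intro hpart_shift_id) auto
        finally show "hpart_shift (s (Suc i) k) (s' i l) (\<phi> l j * d i j k) = \<phi> l j * d i j k" .
      qed
      finally show "mm (r' (Suc i)) (d' i) \<psi> l k = mm (r i) \<phi> (d i) l k" .
    qed
    have "im (Suc i) \<psi>"
      unfolding im_def
    proof (intro allI impI)
      fix k assume k: "k < r (Suc (Suc i))"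
      have "mm (r' (Suc i)) (d' i) (mm (r (Suc i)) \<psi> (d (Suc i))) l k = 0" if l: "l < r' i" for l
      proof -
        have "mm (r' (Suc i)) (d' i) (mm (r (Suc i)) \<psi> (d (Suc i))) l k = mm (r (Suc i)) (mm (r' (Suc i)) (d' i) \<psi>) (d (Suc i)) l k"
          by (rule mm_assoc[symmetric])
        also have "\<dots> = mm (r (Suc i)) (mm (r i) \<phi> (d i)) (d (Suc i)) l k"
          using Q l by (intro mm_cong) (auto simp: Q_def)
        also have "\<dots> = mm (r i) \<phi> (mm (r (Suc i)) (d i) (d (Suc i))) l k" by (rule mm_assoc)
        also have "\<dots> = 0" by (rule mm_zero_right) (use F.complex k in auto)
        finally show ?thesis .
      qed
      then show "\<exists>w. \<forall>l<r' (Suc i). mm (r (Suc i)) \<psi> (d (Suc i)) l k = (\<Sum>j<r' (Suc (Suc i)). d' (Suc i) l j * w j)"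
        using F'.exact[of i "\<lambda>l. mm (r (Suc i)) \<psi> (d (Suc i)) l k"] by (simp add: mm_def[of "r' (Suc i)"])
    qed
    moreover have "hm (Suc i) \<psi>" by (auto simp: hm_def \<psi>_def dest: keys_hpart_shift)
    ultimately show "\<exists>\<psi>. P (Suc i) \<psi> \<and> Q i \<phi> \<psi>" using Q by (auto simp: P_def)
  qed
  then obtain \<phi> where "\<And>i. P i (\<phi> i)" "\<And>i. Q i (\<phi> i) (\<phi> (Suc i))" by blast
  then show ?thesis by (intro exI[of _ \<phi>]) (auto simp: P_def Q_def hm_def)
qed

end

context graded_res
begin

text \<open>The difference of \<open>\<theta>\<close> and the identity induces zero on S/I, so it is
  null-homotopic. The homotopy carries no degree condition here; degrees are restored where it is
  applied, by truncating to one strand.\<close>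

lemma homotopy_exists:
  fixes \<theta> :: "nat \<Rightarrow> nat \<Rightarrow> nat \<Rightarrow> ('w, 'k) mpoly"
  assumes aug\<theta>: "\<And>k. k < r 0 \<Longrightarrow> (\<Sum>l<r 0. \<theta> 0 l k * g l) - g k \<in> I"
    and comm: "\<And>i l k. l < r i \<Longrightarrow> k < r (Suc i) \<Longrightarrow> mm (r (Suc i)) (d i) (\<theta> (Suc i)) l k = mm (r i) (\<theta> i) (d i) l k"
  shows "\<exists>h. (\<forall>l<r 0. \<forall>k<r 0. \<theta> 0 l k - idm l k = mm (r 1) (d 0) (h 0) l k) \<and>
    (\<forall>i. \<forall>l<r (Suc i). \<forall>k<r (Suc i). \<theta> (Suc i) l k - idm l k =
      mm (r (Suc (Suc i))) (d (Suc i)) (h (Suc i)) l k + mm (r i) (h i) (d i) l k)"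
proof -
  \<comment> \<open>The error that the next homotopy has to bound: \<open>P\<close> says that it is
    a cycle, \<open>Q\<close> that \<open>h'\<close> bounds it.\<close>
  define E where "E i h = (\<lambda>l k. (\<theta> (Suc i) l k - idm l k) - mm (r i) h (d i) l k)" for i h
  define P where "P i h \<longleftrightarrow> (\<forall>l<r i. \<forall>k<r (Suc i). mm (r (Suc i)) (d i) (E i h) l k = 0) \<and>
      (i = 0 \<longrightarrow> (\<forall>l<r 0. \<forall>k<r 0. \<theta> 0 l k - idm l k = mm (r 1) (d 0) h l k))" for i h
  define Q where "Q i h h' \<longleftrightarrow> (\<forall>l<r (Suc i). \<forall>k<r (Suc i). E i h l k = mm (r (Suc (Suc i))) (d (Suc i)) h' l k)" for i h h'
  have dE: "mm (r (Suc i)) (d i) (E i h) l k =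
      mm (r i) (\<lambda>l k. (\<theta> i l k - idm l k) - mm (r (Suc i)) (d i) h l k) (d i) l k" if "l < r i" "k < r (Suc i)" for i h l k
    unfolding E_def mm_diff_left mm_diff_right using that
    by (simp add: mm_assoc comm mm_idm_left mm_idm_right)
  have "\<exists>h. \<forall>i. P i (h i) \<and> Q i (h i) (h (Suc i))"
  proof (rule dependent_nat_choice)
    have "\<forall>k. \<exists>w. k < r 0 \<longrightarrow> (\<forall>l<r 0. \<theta> 0 l k - idm l k = (\<Sum>j<r 1. d 0 l j * w j))"
    proof (rule allI, cases)
      fix k assume k: "k < r 0"
      have "(\<Sum>l<r 0. (\<theta> 0 l k - idm l k) * g l) = (\<Sum>l<r 0. \<theta> 0 l k * g l) - g k"
        using k by (simp add: left_diff_distrib sum_subtractf idm_def if_distrib[where f = "\<lambda>x. x * _"] cong: if_cong)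
      then have "(\<Sum>l<r 0. (\<theta> 0 l k - idm l k) * g l) \<in> I" using aug\<theta>[OF k] by simp
      from exact0[OF this] show "\<exists>w. k < r 0 \<longrightarrow> (\<forall>l<r 0. \<theta> 0 l k - idm l k = (\<Sum>j<r 1. d 0 l j * w j))" by blast
    qed simp
    from choice[OF this] obtain w where w: "\<forall>k. k < r 0 \<longrightarrow> (\<forall>l<r 0. \<theta> 0 l k - idm l k = (\<Sum>j<r 1. d 0 l j * w k j))" ..
    define h where "h j k = w k j" for j k
    have h: "\<theta> 0 l k - idm l k = mm (r (Suc 0)) (d 0) h l k" if "l < r 0" "k < r 0" for l k
      using w that by (simp add: mm_def h_def)
    have "mm (r (Suc 0)) (d 0) (E 0 h) l k = 0" if "l < r 0" "k < r (Suc 0)" for l k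
      unfolding dE[OF that] using h that by (intro mm_zero_left) simp
    then show "\<exists>h. P 0 h" using h by (auto simp: P_def)
  next
    fix h i assume P: "P i h"
    have "\<forall>k. \<exists>w. k < r (Suc i) \<longrightarrow> (\<forall>l<r (Suc i). E i h l k = (\<Sum>j<r (Suc (Suc i)). d (Suc i) l j * w j))"
    proof (rule allI, cases)
      fix k assume "k < r (Suc i)"
      then have "(\<Sum>j<r (Suc i). d i l j * E i h j k) = 0" if "l < r i" for l
        using P that by (auto simp: P_def mm_def)
      from exact[OF this] show "\<exists>w. k < r (Suc i) \<longrightarrow> (\<forall>l<r (Suc i). E i h l k = (\<Sum>j<r (Suc (Suc i)). d (Suc i) l j * w j))"
        by blast
    qed simp
    from choice[OF this] obtain w where w: "\<forall>k. k < r (Suc i) \<longrightarrow> (\<forall>l<r (Suc i). E i h l k = (\<Sum>j<r (Suc (Suc i)). d (Suc i) l j * w k j))" ..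
    define h' where "h' j k = w k j" for j k
    have h': "E i h l k = mm (r (Suc (Suc i))) (d (Suc i)) h' l k" if "l < r (Suc i)" "k < r (Suc i)" for l k
      using w that by (simp add: mm_def h'_def)
    have "mm (r (Suc (Suc i))) (d (Suc i)) (E (Suc i) h') l k = 0" if lk: "l < r (Suc i)" "k < r (Suc (Suc i))" for l k
    proof -
      have "mm (r (Suc (Suc i))) (d (Suc i)) (E (Suc i) h') l k = mm (r (Suc i)) (mm (r i) h (d i)) (d (Suc i)) l k"
        unfolding dE[OF lk]
      proof (rule mm_cong)
        fix j assume "j < r (Suc i)"
        then show "\<theta> (Suc i) l j - idm l j - mm (r (Suc (Suc i))) (d (Suc i)) h' l j = mm (r i) h (d i) l j"
          using h'[OF lk(1), of j] by (auto simp: E_def algebra_simps)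
      qed simp
      also have "\<dots> = mm (r i) h (mm (r (Suc i)) (d i) (d (Suc i))) l k" by (rule mm_assoc)
      also have "\<dots> = 0" by (rule mm_zero_right) (use complex lk in auto)
      finally show ?thesis .
    qed
    then show "\<exists>h'. P (Suc i) h' \<and> Q i h h'" using h' by (auto simp: P_def Q_def)
  qed
  then obtain h where PQ: "\<And>i. P i (h i)" "\<And>i. Q i (h i) (h (Suc i))" by blast
  have "\<theta> (Suc i) l k - idm l k = mm (r (Suc (Suc i))) (d (Suc i)) (h (Suc i)) l k + mm (r i) (h i) (d i) l k"
    if "l < r (Suc i)" "k < r (Suc i)" for i l k
  proof -
    have "E i (h i) l k = mm (r (Suc (Suc i))) (d (Suc i)) (h (Suc i)) l k"
      using PQ(2)[of i] that by (simp add: Q_def)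
    then show ?thesis by (simp add: E_def diff_eq_eq)
  qed
  moreover have "\<forall>l<r 0. \<forall>k<r 0. \<theta> 0 l k - idm l k = mm (r 1) (d 0) (h 0) l k"
    using PQ(1)[of 0] by (simp add: P_def)
  ultimately show ?thesis by blast
qed

end

section \<open>Tor as cycles modulo boundaries in one degree\<close>

lemma strand_subspace: "kv.subspace (strand F i j)"
  by (rule kv.subspaceI) (auto simp: strand_def free_mod_def)

lemma strand_map_add: "strand_map F i (f + g) = strand_map F i f + strand_map F i g"
  by (simp add: strand_map_def mat_app_add)

lemma strand_map_scale: "strand_map F i (\<lambda>k. x * f k) = (\<lambda>k. x * strand_map F i f k)"
  by (simp add: strand_map_def mat_app_scale)

lemma strand_map_zero: "strand_map F i 0 = 0"
  by (simp add: strand_map_def)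

lemma tor_cycles_subspace: "kv.subspace (tor_cycles F i j)"
proof (cases i)
  case (Suc i')
  show ?thesis
    unfolding tor_cycles_def Suc nat.case
    by (rule kv.subspaceI)
      (use strand_subspace[of F "Suc i'" j] in \<open>auto simp: strand_map_add strand_map_scale strand_map_zero kv.subspace_0 kv.subspace_add kv.subspace_scale fun_eq_iff\<close>)
qed (simp add: tor_cycles_def strand_subspace)

lemma tor_boundaries_subspace: "kv.subspace (tor_boundaries F i j)"
  unfolding tor_boundaries_def
proof (rule kv.subspaceI)
  note S = strand_subspace[of F "Suc i" j]
  show "0 \<in> strand_map F i ` strand F (Suc i) j"
    using kv.subspace_0[OF S] strand_map_zero[of F i] by (metis imageI)
  show "x + y \<in> strand_map F i ` strand F (Suc i) j"
    if "x \<in> strand_map F i ` strand F (Suc i) j" "y \<in> strand_map F i ` strand F (Suc i) j" for x y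
    using that kv.subspace_add[OF S] by (auto simp: strand_map_add[symmetric])
  show "(\<lambda>k. c * x k) \<in> strand_map F i ` strand F (Suc i) j" if "x \<in> strand_map F i ` strand F (Suc i) j" for x c
    using that kv.subspace_scale[OF S] by (auto simp: strand_map_scale[symmetric])
qed

definition unitv :: "nat \<Rightarrow> nat \<Rightarrow> 'k::field" where
  "unitv k = (\<lambda>j. if j = k then 1 else 0)"

lemma sum_kscale_apply: "(\<Sum>k\<in>A. (\<lambda>j. c k * f k j)) x = (\<Sum>k\<in>A. c k * f k x)"
  for c :: "'a \<Rightarrow> 'k::field" and f :: "'a \<Rightarrow> nat \<Rightarrow> 'k"
  by (induction A rule: infinite_finite_induct) auto

lemma in_span_unitv:
  fixes f :: "nat \<Rightarrow> 'k::field"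
  assumes "finite K" "\<And>k. k \<notin> K \<Longrightarrow> f k = 0"
  shows "f \<in> kv.span (unitv ` K)"
proof -
  have "f = (\<Sum>k\<in>K. (\<lambda>j. f k * unitv k j))"
  proof
    fix x show "f x = (\<Sum>k\<in>K. (\<lambda>j. f k * unitv k j)) x"
      unfolding sum_kscale_apply using assms by (simp add: unitv_def if_distrib cong: if_cong)
  qed
  also have "\<dots> \<in> kv.span (unitv ` K)"
    by (intro kv.span_sum kv.span_scale kv.span_base) auto
  finally show ?thesis .
qed

lemma strand_finite_dimensional: "strand F i j \<subseteq> kv.span (unitv ` {..<rnk F i})"
proof
  fix f assume "f \<in> strand F i j"
  then show "f \<in> kv.span (unitv ` {..<rnk F i})"
    by (intro in_span_unitv) (auto simp: strand_def free_mod_def)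
qed

lemma const_coeff_zero_if_degrees_differ:
  assumes "\<forall>m\<in>keys a. mdeg m + x = y" "x \<noteq> y"
  shows "const_coeff a = 0"
proof (rule ccontr)
  assume "const_coeff a \<noteq> 0"
  then have "0 \<in> keys a" by (simp add: const_coeff_def in_keys_iff)
  then show False using assms by fastforce
qed

text \<open>A homogeneous entry with nonzero constant coefficient forces the degrees of its row and
  its column to agree. Hence a homogeneous matrix reduced modulo the variables respects the
  grading.\<close>

lemma mat_app_supported:
  assumes "\<And>l k. l < a \<Longrightarrow> k < c \<Longrightarrow> \<forall>m\<in>keys (A l k). mdeg m + s l = t k"
    and "\<And>k. k < c \<Longrightarrow> t k \<noteq> j \<Longrightarrow> f k = 0" and l: "l < a" "s l \<noteq> j"
  shows "mat_app a c (\<lambda>l k. const_coeff (A l k)) f l = 0"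
proof -
  have "const_coeff (A l k) * f k = 0" if "k < c" for k
    using const_coeff_zero_if_degrees_differ[of "A l k" "s l" "t k"] assms that by (cases "t k = j") auto
  then show ?thesis using l by (simp add: mat_app_def)
qed

lemma mat_app_idm: "f \<in> free_mod n \<Longrightarrow> mat_app n n idm f = f"
  by (auto simp: mat_app_def idm_def free_mod_def fun_eq_iff if_distrib[where f = "\<lambda>x. x * _"] cong: if_cong)

lemma mat_app_mat_add: "mat_app a c (\<lambda>l k. A l k + A' l k) f = mat_app a c A f + mat_app a c A' f"
  by (auto simp: mat_app_def fun_eq_iff distrib_right sum.distrib)

text \<open>Reducing the comparison map modulo the variables gives a map on Tor. It is injective
  because the comparison back composes with it to a map homotopic to the identity. One inequality
  suffices, the situation being symmetric.\<close>

theorem tor_dim_le: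
  fixes F F' :: "('w::finite, 'k::field) mpoly graded_free_seq"
  assumes F: "graded_free_resolution F I" and F': "graded_free_resolution F' I" and I: "homog_ideal I"
  shows "tor_dim F i j \<le> tor_dim F' i j"
proof -
  obtain g where g: "graded_res (rnk F) (shift F) (diff F) g I"
    using graded_free_resolution_imp_graded_res[OF F I] by blast
  obtain g' where g': "graded_res (rnk F') (shift F') (diff F') g' I"
    using graded_free_resolution_imp_graded_res[OF F' I] by blast
  interpret R: graded_res "rnk F" "shift F" "diff F" g I by (rule g)
  interpret R': graded_res "rnk F'" "shift F'" "diff F'" g' I by (rule g')
  interpret A: two_graded_res "rnk F" "shift F" "diff F" g "rnk F'" "shift F'" "diff F'" g' I
    by unfold_locales (rule I)
  interpret A': two_graded_res "rnk F'" "shift F'" "diff F'" g' "rnk F" "shift F" "diff F" g I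
    by unfold_locales (rule I)
  obtain \<phi> where \<phi>: "\<forall>i. \<forall>l<rnk F' i. \<forall>k<rnk F i. \<forall>m\<in>keys (\<phi> i l k). mdeg m + shift F' i l = shift F i k"
      "\<forall>k<rnk F 0. g k - (\<Sum>l<rnk F' 0. \<phi> 0 l k * g' l) \<in> I"
      "\<forall>i. \<forall>l<rnk F' i. \<forall>k<rnk F (Suc i). mm (rnk F' (Suc i)) (diff F' i) (\<phi> (Suc i)) l k = mm (rnk F i) (\<phi> i) (diff F i) l k"
    using A.chain_map_exists by (elim exE conjE) (rule that)
  obtain \<psi> where \<psi>: "\<forall>k<rnk F' 0. g' k - (\<Sum>l<rnk F 0. \<psi> 0 l k * g l) \<in> I"
      "\<forall>i. \<forall>l<rnk F i. \<forall>k<rnk F' (Suc i). mm (rnk F (Suc i)) (diff F i) (\<psi> (Suc i)) l k = mm (rnk F' i) (\<psi> i) (diff F' i) l k"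
    using A'.chain_map_exists by (elim exE conjE) (rule that)
  define \<theta> where "\<theta> i = mm (rnk F' i) (\<psi> i) (\<phi> i)" for i
  have "(\<Sum>l<rnk F 0. \<theta> 0 l k * g l) - g k \<in> I" if k: "k < rnk F 0" for k
  proof -
    have "(\<Sum>l<rnk F 0. \<theta> 0 l k * g l) = (\<Sum>j<rnk F' 0. \<phi> 0 j k * (\<Sum>l<rnk F 0. \<psi> 0 l j * g l))"
      unfolding \<theta>_def mm_def sum_distrib_left sum_distrib_right by (subst sum.swap) (simp add: mult_ac)
    then have "(\<Sum>l<rnk F 0. \<theta> 0 l k * g l) - g k =
        (0 - (g k - (\<Sum>l<rnk F' 0. \<phi> 0 l k * g' l))) - (\<Sum>j<rnk F' 0. \<phi> 0 j k * (g' j - (\<Sum>l<rnk F 0. \<psi> 0 l j * g l)))"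
      by (simp add: right_diff_distrib sum_subtractf)
    also have "\<dots> \<in> I"
    proof (rule homog_ideal_diff[OF I homog_ideal_diff[OF I]])
      show "(\<Sum>j<rnk F' 0. \<phi> 0 j k * (g' j - (\<Sum>l<rnk F 0. \<psi> 0 l j * g l))) \<in> I"
        using \<psi>(1) I by (intro homog_ideal_sum) (auto simp: homog_ideal_def)
    qed (use \<phi>(2) k I in \<open>auto simp: homog_ideal_def\<close>)
    finally show ?thesis .
  qed
  moreover have "mm (rnk F (Suc i)) (diff F i) (\<theta> (Suc i)) l k = mm (rnk F i) (\<theta> i) (diff F i) l k"
    if lk: "l < rnk F i" "k < rnk F (Suc i)" for i l k
  proof -
    have "mm (rnk F (Suc i)) (diff F i) (\<theta> (Suc i)) l k =
        mm (rnk F' (Suc i)) (mm (rnk F (Suc i)) (diff F i) (\<psi> (Suc i))) (\<phi> (Suc i)) l k"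
      unfolding \<theta>_def by (rule mm_assoc[symmetric])
    also have "\<dots> = mm (rnk F' (Suc i)) (mm (rnk F' i) (\<psi> i) (diff F' i)) (\<phi> (Suc i)) l k"
      by (rule mm_cong) (use \<psi>(2) lk in auto)
    also have "\<dots> = mm (rnk F' i) (\<psi> i) (mm (rnk F' (Suc i)) (diff F' i) (\<phi> (Suc i))) l k" by (rule mm_assoc)
    also have "\<dots> = mm (rnk F' i) (\<psi> i) (mm (rnk F i) (\<phi> i) (diff F i)) l k"
      by (rule mm_cong) (use \<phi>(3) lk in auto)
    finally show ?thesis unfolding \<theta>_def by (simp add: mm_assoc)
  qed
  ultimately obtain h where h0: "\<forall>l<rnk F 0. \<forall>k<rnk F 0. \<theta> 0 l k - idm l k = mm (rnk F 1) (diff F 0) (h 0) l k"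
    and h: "\<forall>i. \<forall>l<rnk F (Suc i). \<forall>k<rnk F (Suc i). \<theta> (Suc i) l k - idm l k =
      mm (rnk F (Suc (Suc i))) (diff F (Suc i)) (h (Suc i)) l k + mm (rnk F i) (h i) (diff F i) l k"
    using R.homotopy_exists[of \<theta>] by blast
  define cc where "cc A = (\<lambda>l k. const_coeff (A l k))" for A :: "nat \<Rightarrow> nat \<Rightarrow> ('w, 'k) mpoly"
  have ccmm: "cc (mm n A C) = mm n (cc A) (cc C)" for n A C
    by (simp add: cc_def const_coeff_mm fun_eq_iff)
  have sm: "strand_map F i = mat_app (rnk F i) (rnk F (Suc i)) (cc (diff F i))"
      "strand_map F' i = mat_app (rnk F' i) (rnk F' (Suc i)) (cc (diff F' i))" for i
    by (simp_all add: strand_map_def cc_def)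
  define f where "f i = mat_app (rnk F' i) (rnk F i) (cc (\<phi> i))" for i
  have fcomm: "f i (strand_map F i y) = strand_map F' i (f (Suc i) y)" for i y
    unfolding f_def sm mat_app_mat_app ccmm[symmetric]
    by (rule mat_app_cong) (use \<phi>(3) in \<open>auto simp: cc_def\<close>)
  have fstrand: "f i y \<in> strand F' i j" if "y \<in> strand F i j" for i y
  proof -
    have "f i y l = 0" if "l < rnk F' i" "shift F' i l \<noteq> j" for l
      unfolding f_def cc_def
      by (rule mat_app_supported[where s = "shift F' i" and t = "shift F i" and j = j])
        (use \<phi>(1) that \<open>y \<in> strand F i j\<close> in \<open>auto simp: strand_def\<close>)
    then show ?thesis by (auto simp: strand_def f_def)
  qed
  have bc: "tor_boundaries F i j \<subseteq> tor_cycles F i j"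
    if "graded_res (rnk F) (shift F) (diff F) g I" for F :: "('w, 'k) mpoly graded_free_seq" and g i
  proof
    interpret R: graded_res "rnk F" "shift F" "diff F" g I by (rule that)
    fix x assume "x \<in> tor_boundaries F i j"
    then obtain y where y: "y \<in> strand F (Suc i) j" "x = strand_map F i y" by (auto simp: tor_boundaries_def)
    have "x l = 0" if "l < rnk F i" "shift F i l \<noteq> j" for l
      unfolding y(2) strand_map_def
      by (rule mat_app_supported[where s = "shift F i" and t = "shift F (Suc i)" and j = j])
        (use R.hom_d that y(1) in \<open>auto simp: strand_def\<close>)
    then have xs: "x \<in> strand F i j" using y(2) by (auto simp: strand_def strand_map_def)
    show "x \<in> tor_cycles F i j"
    proof (cases i)
      case (Suc i')
      have "strand_map F i' (strand_map F (Suc i') y) = mat_app (rnk F i') (rnk F (Suc (Suc i'))) (\<lambda>l k. 0) y"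
        unfolding strand_map_def mat_app_mat_app const_coeff_mm[symmetric]
        by (rule mat_app_cong) (use R.complex in auto)
      also have "\<dots> = 0" by (auto simp: mat_app_def fun_eq_iff)
      finally show ?thesis using xs y(2) by (simp add: tor_cycles_def Suc)
    qed (use xs in \<open>simp add: tor_cycles_def\<close>)
  qed
  have cyc_strand: "tor_cycles F i j \<subseteq> strand F i j" for F :: "('w, 'k) mpoly graded_free_seq" and i
    by (cases i) (auto simp: tor_cycles_def)
  have "kv.dim (tor_cycles F i j) - kv.dim (tor_boundaries F i j) \<le> kv.dim (tor_cycles F' i j) - kv.dim (tor_boundaries F' i j)"
  proof (rule kv.quotient_dim_le[where f = "f i" and E = "unitv ` {..<rnk F i}" and E' = "unitv ` {..<rnk F' i}"])
    show "tor_cycles F i j \<subseteq> kv.span (unitv ` {..<rnk F i})" "tor_cycles F' i j \<subseteq> kv.span (unitv ` {..<rnk F' i})"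
      using cyc_strand strand_finite_dimensional by blast+
    show "tor_boundaries F i j \<subseteq> tor_cycles F i j" by (rule bc[OF g])
    show "tor_boundaries F' i j \<subseteq> tor_cycles F' i j" by (rule bc[OF g'])
    show "f i x \<in> tor_cycles F' i j" if "x \<in> tor_cycles F i j" for x
    proof (cases i)
      case 0
      then show ?thesis using that fstrand by (simp add: tor_cycles_def)
    next
      case (Suc i')
      then have x: "x \<in> strand F (Suc i') j" "strand_map F i' x = 0" using that by (auto simp: tor_cycles_def)
      have "strand_map F' i' (f (Suc i') x) = 0"
        unfolding fcomm[symmetric] x(2) by (simp add: f_def)
      then show ?thesis using fstrand[OF x(1)] by (simp add: tor_cycles_def Suc)
    qed
    show "x \<in> tor_boundaries F i j" if x: "x \<in> tor_cycles F i j" and fx: "f i x \<in> tor_boundaries F' i j" for x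
    proof -
      have xs: "x \<in> strand F i j" using x cyc_strand by blast
      obtain y' where y': "f i x = strand_map F' i y'" using fx by (auto simp: tor_boundaries_def)
      define p where "p i = mat_app (rnk F i) (rnk F' i) (cc (\<psi> i))" for i
      have "p i (f i x) = strand_map F i (p (Suc i) y')"
        unfolding y' p_def sm mat_app_mat_app ccmm[symmetric]
        by (rule mat_app_cong) (use \<psi>(2) in \<open>auto simp: cc_def\<close>)
      moreover have "p i (f i x) = mat_app (rnk F i) (rnk F i) (cc (\<theta> i)) x"
        by (simp add: p_def f_def mat_app_mat_app \<theta>_def ccmm)
      \<comment> \<open>On a cycle the homotopy term that begins with the differential vanishes, so
        only a boundary is added to \<open>x\<close>.\<close>
      moreover have "mat_app (rnk F i) (rnk F i) (cc (\<theta> i)) x =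
          x + strand_map F i (mat_app (rnk F (Suc i)) (rnk F i) (cc (h i)) x)"
      proof (cases i)
        case 0
        have "mat_app (rnk F 0) (rnk F 0) (cc (\<theta> 0)) x =
            mat_app (rnk F 0) (rnk F 0) (\<lambda>l k. idm l k + cc (mm (rnk F 1) (diff F 0) (h 0)) l k) x"
        proof (rule mat_app_cong)
          fix l k assume "l < rnk F 0" "k < rnk F 0"
          then have "\<theta> 0 l k = idm l k + mm (rnk F 1) (diff F 0) (h 0) l k" using h0 by (metis add.commute diff_eq_eq)
          then show "cc (\<theta> 0) l k = idm l k + cc (mm (rnk F 1) (diff F 0) (h 0)) l k"
            by (simp add: cc_def const_coeff_add) (simp add: idm_def)
        qed
        then show ?thesis using xs 0
          by (simp add: mat_app_mat_add mat_app_idm strand_def sm mat_app_mat_app ccmm)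
      next
        case (Suc i')
        have x0: "strand_map F i' x = 0" using x Suc by (auto simp: tor_cycles_def)
        have "mat_app (rnk F i) (rnk F i) (cc (\<theta> i)) x =
            mat_app (rnk F i) (rnk F i) (\<lambda>l k. (idm l k + cc (mm (rnk F (Suc i)) (diff F i) (h i)) l k) +
              cc (mm (rnk F i') (h i') (diff F i')) l k) x"
        proof (rule mat_app_cong)
          fix l k assume "l < rnk F i" "k < rnk F i"
          then have "\<theta> i l k - idm l k = mm (rnk F (Suc i)) (diff F i) (h i) l k + mm (rnk F i') (h i') (diff F i') l k"
            using h Suc by simp
          then have "\<theta> i l k = idm l k + mm (rnk F (Suc i)) (diff F i) (h i) l k + mm (rnk F i') (h i') (diff F i') l k"
            by (simp add: diff_eq_eq ac_simps)
          then show "cc (\<theta> i) l k = idm l k + cc (mm (rnk F (Suc i)) (diff F i) (h i)) l k +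
              cc (mm (rnk F i') (h i') (diff F i')) l k"
            by (simp add: cc_def const_coeff_add) (simp add: idm_def)
        qed
        also have "\<dots> = x + strand_map F i (mat_app (rnk F (Suc i)) (rnk F i) (cc (h i)) x) +
            mat_app (rnk F i) (rnk F i') (cc (h i')) (strand_map F i' x)"
          using xs Suc by (simp add: mat_app_mat_add mat_app_idm strand_def sm mat_app_mat_app ccmm)
        finally show ?thesis by (simp add: x0)
      qed
      ultimately have "x = strand_map F i (p (Suc i) y') - strand_map F i (mat_app (rnk F (Suc i)) (rnk F i) (cc (h i)) x)"
        by (simp add: eq_diff_eq)
      then have "x = strand_map F i (p (Suc i) y' - mat_app (rnk F (Suc i)) (rnk F i) (cc (h i)) x)"
        by (simp add: strand_map_def mat_app_diff)
      then obtain y where y: "x = strand_map F i y" by (rule that)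
      \<comment> \<open>The preimage \<open>y\<close> may have components outside degree
        \<open>j\<close>, since the homotopy is not graded. Dropping them leaves the image
        unchanged: the reduced matrix preserves degrees and \<open>x\<close> lies in the
        strand.\<close>
      define y1 where "y1 k = (if k < rnk F (Suc i) \<and> shift F (Suc i) k = j then y k else 0)" for k
      have y1: "y1 \<in> strand F (Suc i) j" by (auto simp: y1_def strand_def free_mod_def)
      have "strand_map F i y1 = x"
      proof
        fix l
        show "strand_map F i y1 l = x l"
        proof (cases "l < rnk F i \<and> shift F i l = j")
          case True
          have "const_coeff (diff F i l k) * y1 k = const_coeff (diff F i l k) * y k" if "k < rnk F (Suc i)" for k
            using const_coeff_zero_if_degrees_differ[of "diff F i l k" "shift F i l" "shift F (Suc i) k"] R.hom_d[of l i k] True that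
            by (auto simp: y1_def)
          then show ?thesis unfolding y strand_map_def mat_app_def by (auto intro!: sum.cong)
        next
          case False
          then have "x l = 0" using xs by (cases "l < rnk F i") (auto simp: strand_def free_mod_def)
          moreover have "strand_map F i y1 l = 0"
          proof (cases "l < rnk F i")
            case True
            then show ?thesis unfolding strand_map_def
              by (intro mat_app_supported[where s = "shift F i" and t = "shift F (Suc i)" and j = j])
                (use R.hom_d False in \<open>auto simp: y1_def\<close>)
          qed (simp add: strand_map_def mat_app_def)
          ultimately show ?thesis by simp
        qed
      qed
      then show ?thesis using y1 unfolding tor_boundaries_def by blast
    qed
  qed (auto simp: tor_cycles_subspace tor_boundaries_subspace f_def mat_app_add mat_app_scale)
  then show ?thesis by (simp add: tor_dim_def kdim_def)
qed

corollary tor_dim_unique: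
  fixes F F' :: "('w::finite, 'k::field) mpoly graded_free_seq"
  assumes "graded_free_resolution F I" "graded_free_resolution F' I" "homog_ideal I"
  shows "tor_dim F = tor_dim F'"
  by (intro ext antisym tor_dim_le[where I = I] assms)

text \<open>The given \<open>F\<close> guarantees that the choice in \<open>betti\<close> yields a
  resolution, and independence of the resolution transfers the value to \<open>F\<close>.\<close>

lemma betti_eq_tor_dim:
  fixes F :: "('w::finite, 'k::field) mpoly graded_free_seq"
  assumes "graded_free_resolution F I" "homog_ideal I"
  shows "betti I = tor_dim F"
  unfolding betti_def by (rule tor_dim_unique[OF someI[of "\<lambda>F. graded_free_resolution F I"]]) (use assms in auto)

section \<open>Free vertices\<close>

lemma clique_extends:
  assumes "finite (verts G)" "clique G D"
  shows "\<exists>C. maximal_clique G C \<and> D \<subseteq> C"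
proof -
  have "{C. clique G C} \<subseteq> Pow (verts G)" by (auto simp: clique_def)
  then have "finite {C. clique G C}" using assms(1) by (meson finite_Pow_iff finite_subset)
  from finite_has_maximal2[OF this, of D] assms(2) show ?thesis
    by (auto simp: maximal_clique_def)
qed

text \<open>The edges from \<open>v\<close> to \<open>a\<close> and to \<open>b\<close> extend to
  maximal cliques containing \<open>v\<close>. These coincide because the clique degree is 1, so
  \<open>a\<close> and \<open>b\<close> lie in a common clique.\<close>

lemma free_vertex_neighbours_adjacent:
  assumes G: "simple_graph G" and v: "free_vertex G v"
    and "{v, a} \<in> edges G" "{v, b} \<in> edges G" "a \<noteq> b"
  shows "{a, b} \<in> edges G"
proof -
  have fin: "finite (verts G)" using G by (simp add: simple_graph_def)
  have e: "u \<in> verts G \<and> w \<in> verts G" if "{u, w} \<in> edges G" for u w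
    using G that unfolding simple_graph_def by (metis doubleton_eq_iff)
  have cl: "clique G {v, c}" if "{v, c} \<in> edges G" for c
    using that e[OF that] by (auto simp: clique_def insert_commute)
  obtain C where C: "maximal_clique G C" "{v, a} \<subseteq> C" using clique_extends[OF fin cl] assms by blast
  obtain D where D: "maximal_clique G D" "{v, b} \<subseteq> D" using clique_extends[OF fin cl] assms by blast
  have "card {C. maximal_clique G C \<and> v \<in> C} = 1"
    using v by (simp add: free_vertex_def clique_degree_def)
  then obtain E where "{C. maximal_clique G C \<and> v \<in> C} = {E}" by (rule card_1_singletonE)
  moreover have "C \<in> {C. maximal_clique G C \<and> v \<in> C}" "D \<in> {C. maximal_clique G C \<and> v \<in> C}"
    using C D by auto
  ultimately have "C = D" by (metis singletonD)
  then show ?thesis using C D assms by (auto simp: maximal_clique_def clique_def)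
qed

section \<open>Monomials modulo a binomial edge ideal\<close>

definition xm :: "'v \<Rightarrow> 'v + 'v \<Rightarrow>\<^sub>0 nat" where "xm i = single (Inl i) 1"
definition ym :: "'v \<Rightarrow> 'v + 'v \<Rightarrow>\<^sub>0 nat" where "ym i = single (Inr i) 1"

lemma lookup_xm: "lookup (xm i) w = (if w = Inl i then 1 else 0)"
  and lookup_ym: "lookup (ym i) w = (if w = Inr i then 1 else 0)"
  by (auto simp: lookup_single xm_def ym_def)

locale graph_with_free_vertex =
  fixes H :: "'v::{finite,linorder} sgraph" and v :: 'v
  assumes simple: "simple_graph H" and free: "free_vertex H v"
begin

lemma edgeD: "{i, j} \<in> edges H \<Longrightarrow> i \<in> verts H \<and> j \<in> verts H \<and> i \<noteq> j"
  using simple unfolding simple_graph_def by (metis doubleton_eq_iff)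

definition U where "U = verts H - {v}"

definition W :: "('v + 'v) set" where "W = - (Inl ` U \<union> Inr ` U)"

definition adeg :: "('v + 'v \<Rightarrow>\<^sub>0 nat) \<Rightarrow> 'v \<Rightarrow> nat" where
  "adeg m i = (if i \<in> U then lookup m (Inl i) + lookup m (Inr i) else 0)"

definition supp :: "('v \<Rightarrow> nat) \<Rightarrow> 'v set" where "supp a = {i. a i > 0}"

text \<open>The closure is reflexive everywhere, so a vertex outside \<open>A\<close> is related
  exactly to itself; components of \<open>A\<close> are the classes of its elements.\<close>

definition conn :: "'v set \<Rightarrow> ('v \<times> 'v) set" where
  "conn A = {(i, j). i \<in> A \<and> j \<in> A \<and> {i, j} \<in> edges H}\<^sup>*"

definition near :: "'v set \<Rightarrow> 'v set" where
  "near A = {j \<in> A. \<exists>a\<in>A. {v, a} \<in> edges H \<and> (a, j) \<in> conn A}"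

text \<open>The \<open>x\<close>-degree of a monomial on each connected component of the subgraph induced by its
  support is an invariant modulo the ideal. The component containing the neighbours of \<open>v\<close>
  merges with \<open>v\<close>, so its variables are sent to \<open>x\<^sub>v\<close> and \<open>y\<^sub>v\<close> by \<open>phi\<close>.\<close>

definition kap :: "('v + 'v \<Rightarrow>\<^sub>0 nat) \<Rightarrow> ('v \<Rightarrow> nat) \<times> ('v \<Rightarrow> nat)" where
  "kap m = (adeg m, \<lambda>i. if i \<in> supp (adeg m) - near (supp (adeg m))
     then \<Sum>j | (i, j) \<in> conn (supp (adeg m)). lookup m (Inl j) else 0)"

definition phi :: "('v + 'v \<Rightarrow>\<^sub>0 nat) \<Rightarrow> 'v + 'v \<Rightarrow>\<^sub>0 nat" where
  "phi m = restr W m + single (Inl v) (\<Sum>j\<in>near (supp (adeg m)). lookup m (Inl j)) +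
     single (Inr v) (\<Sum>j\<in>near (supp (adeg m)). lookup m (Inr j))"

text \<open>The exponent of the power of (x_v, y_v) that belongs to the label: the total degree of
  the component touching \<open>v\<close>. It depends on the multidegree only.\<close>

definition cap :: "('v \<Rightarrow> nat) \<times> ('v \<Rightarrow> nat) \<Rightarrow> nat" where
  "cap \<kappa> = (\<Sum>j\<in>near (supp (fst \<kappa>)). fst \<kappa> j)"

lemma conn_refl: "(i, i) \<in> conn A"
  by (simp add: conn_def)

lemma conn_trans: "(i, j) \<in> conn A \<Longrightarrow> (j, k) \<in> conn A \<Longrightarrow> (i, k) \<in> conn A"
  by (simp add: conn_def)

lemma conn_sym: "(i, j) \<in> conn A \<Longrightarrow> (j, i) \<in> conn A"
proof -
  have "sym {(i, j). i \<in> A \<and> j \<in> A \<and> {i, j} \<in> edges H}"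
    by (auto simp: sym_def insert_commute)
  then show "(i, j) \<in> conn A \<Longrightarrow> (j, i) \<in> conn A"
    unfolding conn_def by (meson symD sym_rtrancl)
qed

lemma conn_edge: "i \<in> A \<Longrightarrow> j \<in> A \<Longrightarrow> {i, j} \<in> edges H \<Longrightarrow> (i, j) \<in> conn A"
  unfolding conn_def by auto

lemma conn_in: "(i, j) \<in> conn A \<Longrightarrow> i \<in> A \<Longrightarrow> j \<in> A"
  unfolding conn_def by (induction rule: rtrancl_induct) auto

lemma near_conn: "i \<in> near A \<Longrightarrow> (i, j) \<in> conn A \<Longrightarrow> j \<in> near A"
  unfolding near_def using conn_in conn_trans by blast

text \<open>Two neighbours of the free vertex \<open>v\<close> are equal or adjacent, so the
  components of \<open>A\<close> touching \<open>v\<close> form a single one.\<close>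

lemma near_connected: "i \<in> near A \<Longrightarrow> j \<in> near A \<Longrightarrow> (i, j) \<in> conn A"
proof -
  assume "i \<in> near A" "j \<in> near A"
  then obtain a b where ab: "a \<in> A" "{v, a} \<in> edges H" "(a, i) \<in> conn A"
      "b \<in> A" "{v, b} \<in> edges H" "(b, j) \<in> conn A" by (auto simp: near_def)
  have "(a, b) \<in> conn A"
    using free_vertex_neighbours_adjacent[OF simple free ab(2,5)] ab conn_refl conn_edge by metis
  then show ?thesis using ab conn_sym conn_trans by metis
qed

lemma near_subset: "near A \<subseteq> A" by (auto simp: near_def)

lemma supp_adeg_subset: "supp (adeg m) \<subseteq> U"
  by (auto simp: supp_def adeg_def)

lemma sum_xm: "(\<Sum>k\<in>T. lookup (m + xm i + ym j) (Inl k)) = (\<Sum>k\<in>T. lookup m (Inl k)) + (if i \<in> T then 1 else 0)"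
  for T :: "'v set"
  by (simp add: lookup_add lookup_xm lookup_ym sum.distrib)

lemma sum_ym: "(\<Sum>k\<in>T. lookup (m + xm i + ym j) (Inr k)) = (\<Sum>k\<in>T. lookup m (Inr k)) + (if j \<in> T then 1 else 0)"
  for T :: "'v set"
  by (simp add: lookup_add lookup_xm lookup_ym sum.distrib)

lemma adeg_swap: "adeg (m + xm i + ym j) = adeg (m + xm j + ym i)"
  by (auto simp: adeg_def lookup_add lookup_xm lookup_ym fun_eq_iff)

lemma restr_W_xm: "restr W (xm i) = (if i \<in> U then 0 else xm i)"
  and restr_W_ym: "restr W (ym i) = (if i \<in> U then 0 else ym i)"
  by (auto intro!: poly_mapping_eqI simp: lookup_restr lookup_xm lookup_ym W_def)

lemma single_Inl_Suc: "single (Inl i) (n + 1) = single (Inl i) n + xm i"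
  and single_Inr_Suc: "single (Inr i) (n + 1) = single (Inr i) n + ym i"
  by (simp_all add: single_add xm_def ym_def del: One_nat_def)

text \<open>The vertex \<open>j\<close> lies in the component touching \<open>v\<close>, which
  \<open>kap\<close> ignores and \<open>phi\<close> merges with \<open>v\<close>. On both sides the
  two exchanged variables contribute x_v y_v.\<close>

lemma kap_phi_swap_v:
  assumes e: "{v, j} \<in> edges H"
  shows "kap (m + xm v + ym j) = kap (m + xm j + ym v) \<and> phi (m + xm v + ym j) = phi (m + xm j + ym v)"
proof -
  define A where "A = supp (adeg (m + xm v + ym j))"
  have A': "supp (adeg (m + xm j + ym v)) = A" unfolding A_def by (subst adeg_swap) simp
  have jU: "j \<in> U" "v \<notin> U" using edgeD[OF e] by (auto simp: U_def)
  have vA: "v \<notin> A" using supp_adeg_subset jU(2) unfolding A_def by blast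
  have jA: "j \<in> A" using jU(1) by (auto simp: A_def supp_def adeg_def lookup_add lookup_xm lookup_ym)
  have jn: "j \<in> near A" using jA e conn_refl by (auto simp: near_def)
  have vn: "v \<notin> near A" using vA near_subset by blast
  have "(\<Sum>k | (i, k) \<in> conn A. lookup (m + xm v + ym j) (Inl k)) = (\<Sum>k | (i, k) \<in> conn A. lookup (m + xm j + ym v) (Inl k))"
    if "i \<in> A - near A" for i
  proof -
    have "(i, v) \<notin> conn A" using conn_in vA that by blast
    moreover have "(i, j) \<notin> conn A" using near_conn[OF jn conn_sym] that by blast
    ultimately show ?thesis by (simp only: sum_xm) simp
  qed
  then have "kap (m + xm v + ym j) = kap (m + xm j + ym v)"
    unfolding kap_def A_def[symmetric] A' by (simp add: adeg_swap fun_eq_iff cong: if_cong)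
  moreover have "phi (m + xm v + ym j) = phi (m + xm j + ym v)"
    unfolding phi_def A_def[symmetric] A' sum_xm sum_ym
    using jn vn jU by (simp add: restr_add restr_W_xm restr_W_ym single_Inl_Suc single_Inr_Suc del: One_nat_def) (simp add: ac_simps)
  ultimately show ?thesis by blast
qed

text \<open>Both ends of an edge inside \<open>U\<close> lie in one component of the support, so no
  component total can tell which end carries the \<open>x\<close>.\<close>

lemma kap_phi_swap:
  assumes e: "{i, j} \<in> edges H"
  shows "kap (m + xm i + ym j) = kap (m + xm j + ym i) \<and> phi (m + xm i + ym j) = phi (m + xm j + ym i)"
proof -
  consider "i = v" | "j = v" | "i \<in> U" "j \<in> U" using edgeD[OF e] by (auto simp: U_def)
  then show ?thesis
  proof cases
    case 1
    then show ?thesis using kap_phi_swap_v e by simp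
  next
    case 2
    then show ?thesis using kap_phi_swap_v[of i m] e by (simp add: insert_commute)
  next
    case 3
    define A where "A = supp (adeg (m + xm i + ym j))"
    have A': "supp (adeg (m + xm j + ym i)) = A" unfolding A_def by (subst adeg_swap) simp
    have ij: "i \<in> A" "j \<in> A" using 3 by (auto simp: A_def supp_def adeg_def lookup_add lookup_xm lookup_ym)
    have c: "(i, j) \<in> conn A" using ij e by (rule conn_edge)
    have n: "i \<in> near A \<longleftrightarrow> j \<in> near A" using c near_conn conn_sym by blast
    have "(k, i) \<in> conn A \<longleftrightarrow> (k, j) \<in> conn A" for k using c conn_sym conn_trans by blast
    then have "(\<Sum>l | (k, l) \<in> conn A. lookup (m + xm i + ym j) (Inl l)) = (\<Sum>l | (k, l) \<in> conn A. lookup (m + xm j + ym i) (Inl l))" for k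
      by (simp only: sum_xm) simp
    then have "kap (m + xm i + ym j) = kap (m + xm j + ym i)"
      unfolding kap_def A_def[symmetric] A' by (simp add: adeg_swap fun_eq_iff cong: if_cong)
    moreover have "phi (m + xm i + ym j) = phi (m + xm j + ym i)"
      unfolding phi_def A_def[symmetric] A' sum_xm sum_ym
      using n 3 by (simp add: restr_add restr_W_xm restr_W_ym)
    ultimately show ?thesis by blast
  qed
qed

lemma lookup_W: "keys w \<subseteq> W \<Longrightarrow> i \<in> U \<Longrightarrow> lookup w (Inl i) = 0 \<and> lookup w (Inr i) = 0"
  by (auto simp: W_def in_keys_iff)

lemma adeg_add_W: "keys w \<subseteq> W \<Longrightarrow> adeg (w + m) = adeg m"
  by (auto simp: adeg_def lookup_add lookup_W)

lemma kap_add_W: assumes w: "keys w \<subseteq> W" shows "kap (w + m) = kap m"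
proof -
  have "(\<Sum>j | (i, j) \<in> conn (supp (adeg m)). lookup (w + m) (Inl j)) = (\<Sum>j | (i, j) \<in> conn (supp (adeg m)). lookup m (Inl j))"
    if "i \<in> supp (adeg m)" for i
    using conn_in[OF _ that] supp_adeg_subset[of m] lookup_W[OF w]
    by (intro sum.cong) (auto simp: lookup_add)
  then show ?thesis by (auto simp: kap_def adeg_add_W[OF w] fun_eq_iff)
qed

text \<open>Monomials of \<open>T\<close> leave the label alone and factor out of
  \<open>phi\<close>; this is the source of the \<open>T\<close>-linearity of
  \<open>Phi\<close>.\<close>

lemma phi_add_W: assumes w: "keys w \<subseteq> W" shows "phi (w + m) = w + phi m"
proof -
  have n: "near (supp (adeg m)) \<subseteq> U" using near_subset supp_adeg_subset by blast
  have "(\<Sum>j\<in>near (supp (adeg m)). lookup (w + m) (Inl j)) = (\<Sum>j\<in>near (supp (adeg m)). lookup m (Inl j))"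
     "(\<Sum>j\<in>near (supp (adeg m)). lookup (w + m) (Inr j)) = (\<Sum>j\<in>near (supp (adeg m)). lookup m (Inr j))"
    using n lookup_W[OF w] by (auto intro!: sum.cong simp: lookup_add)
  then show ?thesis
    by (simp add: phi_def adeg_add_W[OF w] restr_add restr_id[OF w] add.assoc)
qed

text \<open>One inclusion of the description by powers: every value of \<open>phi\<close> is a
  monomial of \<open>T\<close> times one of the generators of (x_v, y_v)^c, where c is
  \<open>cap\<close> of the label.\<close>

lemma phi_form: "\<exists>t\<le>cap (kap m). phi m = restr W m + single (Inl v) t + single (Inr v) (cap (kap m) - t)"
proof -
  have n: "near (supp (adeg m)) \<subseteq> U" using near_subset supp_adeg_subset by blast
  have "cap (kap m) = (\<Sum>j\<in>near (supp (adeg m)). lookup m (Inl j)) + (\<Sum>j\<in>near (supp (adeg m)). lookup m (Inr j))"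
    using n unfolding cap_def by (simp add: kap_def sum.distrib[symmetric]) (auto intro!: sum.cong simp: adeg_def)
  then show ?thesis by (intro exI[of _ "\<Sum>j\<in>near (supp (adeg m)). lookup m (Inl j)"]) (simp add: phi_def)
qed

text \<open>Greedy distribution: the inserted index takes as much of \<open>t\<close> as its
  capacity allows, and the remainder is distributed over the others.\<close>

lemma split_sum:
  assumes "finite T" "t \<le> (\<Sum>j\<in>T. a j)"
  shows "\<exists>b. (\<forall>j. b j \<le> a j) \<and> (\<Sum>j\<in>T. b j) = (t::nat)"
  using assms
proof (induction T arbitrary: t)
  case empty
  then show ?case by (intro exI[of _ "\<lambda>_. 0"]) simp
next
  case (insert x T)
  define t' where "t' = t - min t (a x)"
  have "t' \<le> (\<Sum>j\<in>T. a j)" using insert by (simp add: t'_def)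
  then obtain b where b: "\<forall>j. b j \<le> a j" "(\<Sum>j\<in>T. b j) = t'" using insert.IH by blast
  have "(\<Sum>j\<in>T. (b(x := min t (a x))) j) = t'"
    using b(2) insert.hyps by (metis (no_types, lifting) fun_upd_other sum.cong)
  then show ?case using b insert.hyps
    by (intro exI[of _ "b(x := min t (a x))"]) (auto simp: t'_def)
qed

text \<open>The other inclusion: every generator of the power is attained with the given label, by
  choosing freely how the degree on the component touching \<open>v\<close> splits into
  \<open>x\<close> and \<open>y\<close>.\<close>

lemma phi_attained:
  assumes "t \<le> cap (kap m)"
  shows "\<exists>n. kap n = kap m \<and> phi n = single (Inl v) t + single (Inr v) (cap (kap m) - t)"
proof -
  define N where "N = near (supp (adeg m))"
  have NU: "N \<subseteq> U" using near_subset supp_adeg_subset by (auto simp: N_def)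
  have c: "cap (kap m) = (\<Sum>j\<in>N. adeg m j)" by (simp add: cap_def kap_def N_def)
  obtain b where b: "\<And>j. b j \<le> adeg m j" "(\<Sum>j\<in>N. b j) = t"
    using split_sum[of N t "adeg m"] assms c by auto
  \<comment> \<open>On \<open>N\<close> the degree is redistributed by \<open>b\<close>, on the rest
    of \<open>U\<close> the exponents of \<open>m\<close> are kept, and the variables of
    \<open>W\<close> are removed so that only the wanted generator remains.\<close>
  define n where "n = Abs_poly_mapping (\<lambda>w. case w of
      Inl i \<Rightarrow> if i \<in> N then b i else if i \<in> U then lookup m (Inl i) else 0
    | Inr i \<Rightarrow> if i \<in> N then adeg m i - b i else if i \<in> U then lookup m (Inr i) else 0)"
  have n: "lookup n (Inl i) = (if i \<in> N then b i else if i \<in> U then lookup m (Inl i) else 0)"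
      "lookup n (Inr i) = (if i \<in> N then adeg m i - b i else if i \<in> U then lookup m (Inr i) else 0)" for i
    by (simp_all add: n_def)
  have ad: "adeg n = adeg m"
  proof
    fix i show "adeg n i = adeg m i"
      using NU b(1)[of i] by (cases "i \<in> N") (auto simp: adeg_def[of n] n, auto simp: adeg_def)
  qed
  have "(\<Sum>j | (i, j) \<in> conn (supp (adeg m)). lookup n (Inl j)) = (\<Sum>j | (i, j) \<in> conn (supp (adeg m)). lookup m (Inl j))"
    if "i \<in> supp (adeg m) - N" for i
  proof (rule sum.cong[OF refl])
    fix j assume "j \<in> {j. (i, j) \<in> conn (supp (adeg m))}"
    then have ij: "(i, j) \<in> conn (supp (adeg m))" by simp
    then have "j \<in> U" using conn_in that supp_adeg_subset by blast
    moreover have "j \<notin> N" using near_conn[OF _ conn_sym[OF ij]] that by (auto simp: N_def)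
    ultimately show "lookup n (Inl j) = lookup m (Inl j)" by (simp add: n)
  qed
  then have k: "kap n = kap m" by (auto simp: kap_def ad N_def fun_eq_iff)
  have "restr W n = 0"
  proof (rule poly_mapping_eqI)
    fix w show "lookup (restr W n) w = lookup 0 w"
      using NU by (cases w) (auto simp: lookup_restr W_def n)
  qed
  moreover have "(\<Sum>j\<in>N. lookup n (Inl j)) = t" using b(2) by (simp add: n)
  moreover have "(\<Sum>j\<in>N. lookup n (Inr j)) = cap (kap m) - t"
    using b by (simp add: n c sum_subtractf_nat)
  ultimately have "phi n = single (Inl v) t + single (Inr v) (cap (kap m) - t)"
    by (simp add: phi_def ad N_def)
  then show ?thesis using k by blast
qed

section \<open>Congruence of monomials modulo the binomial edge ideal\<close>

definition mdeg_at :: "('v + 'v \<Rightarrow>\<^sub>0 nat) \<Rightarrow> 'v \<Rightarrow> nat" where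
  "mdeg_at m k = lookup m (Inl k) + lookup m (Inr k)"

lemma mdeg_at_swap: "mdeg_at (q + xm i + ym j) = mdeg_at (q + xm j + ym i)"
  by (auto simp: mdeg_at_def lookup_add lookup_xm lookup_ym fun_eq_iff)

text \<open>The \<open>itself\<close> argument fixes the coefficient field, which does not occur in
  the types of the monomials.\<close>

definition mcong :: "'k::field itself \<Rightarrow> ('v + 'v \<Rightarrow>\<^sub>0 nat) \<Rightarrow> ('v + 'v \<Rightarrow>\<^sub>0 nat) \<Rightarrow> bool" where
  "mcong _ m n \<longleftrightarrow> single m (1::'k) - single n 1 \<in> binomial_edge_ideal H"

lemma mcong_refl: "mcong K m m"
  by (simp add: mcong_def binomial_edge_ideal_def ideal_gen_def ringmod.span_zero)

lemma mcong_sym: "mcong K m n \<Longrightarrow> mcong K n m"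
  unfolding mcong_def binomial_edge_ideal_def ideal_gen_def using ringmod.span_neg by fastforce

lemma mcong_trans: "mcong K m n \<Longrightarrow> mcong K n q \<Longrightarrow> mcong K m q"
  unfolding mcong_def binomial_edge_ideal_def ideal_gen_def using ringmod.span_add by fastforce

lemma binomial_eq:
  "single m c * (Var (Inl i) * Var (Inr j) - Var (Inl j) * Var (Inr i)) =
    single (m + xm i + ym j) c - single (m + xm j + ym i) (c::'k::comm_ring_1)"
  by (simp add: Var_def mult_single algebra_simps xm_def ym_def)

lemma mcong_edge:
  assumes e: "{i, j} \<in> edges H"
  shows "mcong K (m + xm i + ym j) (m + xm j + ym i)"
proof -
  have *: "mcong K (m + xm i + ym j) (m + xm j + ym i)" if "{i, j} \<in> edges H" "i < j" for i j
    unfolding mcong_def binomial_eq[symmetric] binomial_edge_ideal_def ideal_gen_def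
    using that by (intro ringmod.span_scale ringmod.span_base) blast
  show ?thesis
  proof (cases "i < j")
    case True
    then show ?thesis using * e by blast
  next
    case False
    then have "j < i" using edgeD[OF e] by auto
    then show ?thesis using *[of j i] e by (auto simp: insert_commute intro: mcong_sym)
  qed
qed

lemma monomial_split_x: "lookup q (Inl k) > 0 \<Longrightarrow> \<exists>q'. q = q' + xm k"
  by (rule exI[of _ "q - xm k"], rule poly_mapping_eqI) (auto simp: lookup_add lookup_minus lookup_xm)

lemma monomial_split_y: "lookup q (Inr k) > 0 \<Longrightarrow> \<exists>q'. q = q' + ym k"
  by (rule exI[of _ "q - ym k"], rule poly_mapping_eqI) (auto simp: lookup_add lookup_minus lookup_ym)

text \<open>Exchange \<open>x\<close> and \<open>y\<close> between the ends of a path. The last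
  intermediate vertex \<open>k\<close> has positive degree, so x_k or y_k is available as a
  catalyst. With y_k one exchanges along the shorter path and then along the last edge; with x_k the
  order is reversed.\<close>

lemma mcong_path:
  assumes "(i, j) \<in> conn A" "\<And>k. k \<in> A \<Longrightarrow> mdeg_at (q + xm i + ym j) k > 0"
  shows "mcong K (q + xm i + ym j) (q + xm j + ym i)"
  using assms unfolding conn_def
proof (induction arbitrary: q rule: rtrancl_induct)
  case base
  then show ?case by (simp add: mcong_refl)
next
  case (step k j)
  have k: "k \<in> A" and e: "{k, j} \<in> edges H" using step by auto
  have kj: "k \<noteq> j" using edgeD[OF e] by simp
  have IH: "mcong K (q' + xm i + ym k) (q' + xm k + ym i)" if "mdeg_at (q' + xm i + ym k) = mdeg_at (q + xm i + ym j)" for q'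
    using step.IH[of q'] step.prems that by auto
  have "lookup q (Inr k) > 0 \<or> lookup q (Inl k) > 0 \<or> k = i"
    using step.prems[OF k] kj by (auto simp: mdeg_at_def lookup_add lookup_xm lookup_ym split: if_splits)
  then consider "k = i" | q' where "q = q' + ym k" | q' where "q = q' + xm k"
    using monomial_split_x[of q k] monomial_split_y[of q k] by auto
  then show ?case
  proof cases
    case 1
    then show ?thesis using mcong_edge e by simp
  next
    case 2
    have "mcong K ((q' + ym j) + xm i + ym k) ((q' + ym j) + xm k + ym i)"
      by (rule IH) (auto simp: 2 ac_simps)
    moreover have "mcong K ((q' + ym i) + xm k + ym j) ((q' + ym i) + xm j + ym k)"
      by (rule mcong_edge[OF e])
    ultimately show ?thesis
      unfolding 2 by (auto simp: ac_simps intro: mcong_trans)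
  next
    case 3
    have "mcong K ((q' + xm i) + xm k + ym j) ((q' + xm i) + xm j + ym k)"
      by (rule mcong_edge[OF e])
    moreover have "mcong K ((q' + xm j) + xm i + ym k) ((q' + xm j) + xm k + ym i)"
    proof (rule IH)
      have "mdeg_at (q' + xm j + xm i + ym k) = mdeg_at ((q' + xm i) + xm j + ym k)" by (simp add: ac_simps)
      also have "\<dots> = mdeg_at ((q' + xm i) + xm k + ym j)" by (rule mdeg_at_swap)
      finally show "mdeg_at (q' + xm j + xm i + ym k) = mdeg_at (q + xm i + ym j)" by (simp add: 3 ac_simps)
    qed
    ultimately show ?thesis
      unfolding 3 by (auto simp: ac_simps intro: mcong_trans)
  qed
qed

text \<open>If \<open>m\<close> has more \<open>x\<close> at a vertex than \<open>n\<close>, it has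
  less at another vertex of the same component, because the totals agree. An exchange along a path
  between them brings \<open>m\<close> closer to \<open>n\<close>. The induction measure uses
  truncated subtraction and so counts only the excess.\<close>

lemma mcong_if_totals_eq:
  assumes "mdeg_at m = mdeg_at n" and "A = supp (mdeg_at m)"
    and "\<And>k. k \<in> A \<Longrightarrow> (\<Sum>j | (k, j) \<in> conn A. lookup m (Inl j)) = (\<Sum>j | (k, j) \<in> conn A. lookup n (Inl j))"
  shows "mcong K m n"
  using assms
proof (induction "\<Sum>k\<in>UNIV. lookup m (Inl k) - lookup n (Inl k)" arbitrary: m rule: less_induct)
  case less
  note deg = less.prems(1) and A = less.prems(2) and tot = less.prems(3)
  have degk: "lookup m (Inl k) + lookup m (Inr k) = lookup n (Inl k) + lookup n (Inr k)" for k
    using fun_cong[OF deg, of k] by (simp add: mdeg_at_def)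
  have notA: "lookup m (Inl k) = 0 \<and> lookup n (Inl k) = 0" if "k \<notin> A" for k
    using that degk[of k] by (simp add: A supp_def mdeg_at_def)
  show ?case
  proof (cases "\<exists>i. lookup m (Inl i) > lookup n (Inl i)")
    case False
    then have le: "lookup m (Inl i) \<le> lookup n (Inl i)" for i by (simp add: not_less)
    have eq: "lookup m (Inl i) = lookup n (Inl i)" for i
    proof (cases "i \<in> A")
      case True
      show ?thesis using sum_mono_inv[OF tot[OF True], of i] le conn_refl by auto
    qed (use notA in auto)
    moreover have "lookup m (Inr i) = lookup n (Inr i)" for i using eq[of i] degk[of i] by simp
    ultimately have "lookup m w = lookup n w" for w by (cases w) auto
    then have "m = n" by (intro poly_mapping_eqI)
    then show ?thesis by (simp add: mcong_refl)
  next
    case True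
    then obtain i where i: "lookup m (Inl i) > lookup n (Inl i)" by blast
    then have iA: "i \<in> A" using notA by fastforce
    have "\<exists>j. (i, j) \<in> conn A \<and> lookup m (Inl j) < lookup n (Inl j)"
    proof (rule ccontr)
      assume "\<not> ?thesis"
      then have "(\<Sum>j | (i, j) \<in> conn A. lookup n (Inl j)) < (\<Sum>j | (i, j) \<in> conn A. lookup m (Inl j))"
        using i conn_refl by (intro sum_strict_mono_ex1) (auto simp: not_less)
      then show False using tot[OF iA] by simp
    qed
    then obtain j where j: "(i, j) \<in> conn A" "lookup m (Inl j) < lookup n (Inl j)" by blast
    have ij: "i \<noteq> j" using i j by auto
    have "lookup m (Inr j) > 0" using degk[of j] j by simp
    from monomial_split_y[OF this] obtain q' where q': "m = q' + ym j" by (rule exE)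
    then have "lookup q' (Inl i) > 0" using i by (simp add: lookup_add lookup_ym)
    from monomial_split_x[OF this] obtain q where "q' = q + xm i" by (rule exE)
    then have m: "m = q + xm i + ym j" using q' by simp
    define m1 where "m1 = q + xm j + ym i"
    have d1: "mdeg_at m1 = mdeg_at m" by (simp add: m m1_def mdeg_at_swap)
    have c1: "mcong K m m1"
      unfolding m m1_def by (rule mcong_path[OF j(1)]) (simp add: A supp_def m)
    have iff: "(k, i) \<in> conn A \<longleftrightarrow> (k, j) \<in> conn A" for k using j(1) conn_sym conn_trans by blast
    have "mcong K m1 n"
    proof (rule less.hyps)
      have "lookup m1 (Inl k) - lookup n (Inl k) \<le> lookup m (Inl k) - lookup n (Inl k)" for k
        using j(2) ij by (auto simp: m m1_def lookup_add lookup_xm lookup_ym)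
      moreover have "lookup m1 (Inl i) - lookup n (Inl i) < lookup m (Inl i) - lookup n (Inl i)"
        using i ij by (auto simp: m m1_def lookup_add lookup_xm lookup_ym)
      ultimately show "(\<Sum>k\<in>UNIV. lookup m1 (Inl k) - lookup n (Inl k)) < (\<Sum>k\<in>UNIV. lookup m (Inl k) - lookup n (Inl k))"
        by (intro sum_strict_mono_ex1) auto
      show "mdeg_at m1 = mdeg_at n" "A = supp (mdeg_at m1)" using d1 deg A by auto
      show "(\<Sum>l | (k, l) \<in> conn A. lookup m1 (Inl l)) = (\<Sum>l | (k, l) \<in> conn A. lookup n (Inl l))" if "k \<in> A" for k
      proof -
        have "(\<Sum>l | (k, l) \<in> conn A. lookup m1 (Inl l)) = (\<Sum>l | (k, l) \<in> conn A. lookup m (Inl l))"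
          unfolding m m1_def sum_xm using iff by simp
        then show ?thesis using tot[OF that] by simp
      qed
    qed
    with c1 show ?thesis by (rule mcong_trans)
  qed
qed

text \<open>The labels describe components of the support inside \<open>U\<close>, while congruence
  needs those of the full support \<open>A\<close>. These are single vertices outside
  \<open>H\<close>, components not touching \<open>v\<close>, whose totals are recorded by
  \<open>kap\<close>, and the one touching or containing \<open>v\<close>, whose total is controlled
  by the x_v-exponent of \<open>phi\<close>.\<close>

lemma mcong_if_kap_phi_eq:
  assumes k: "kap m = kap n" and p: "phi m = phi n"
  shows "mcong K m n"
proof (rule mcong_if_totals_eq[OF _ refl])
  define A0 where "A0 = supp (adeg m)"
  define A where "A = supp (mdeg_at m)"
  have ad: "adeg m = adeg n" using k by (simp add: kap_def)
  have A0n: "supp (adeg n) = A0" by (simp add: A0_def ad)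
  have vU: "v \<notin> U" by (simp add: U_def)
  have NU: "near A0 \<subseteq> U" using near_subset supp_adeg_subset by (auto simp: A0_def)
  have lp: "lookup (phi q) (Inl v) = lookup q (Inl v) + (\<Sum>j\<in>near (supp (adeg q)). lookup q (Inl j))"
      "lookup (phi q) (Inr v) = lookup q (Inr v) + (\<Sum>j\<in>near (supp (adeg q)). lookup q (Inr j))"
      "i \<noteq> v \<Longrightarrow> i \<notin> U \<Longrightarrow> lookup (phi q) (Inl i) = lookup q (Inl i)"
      "i \<noteq> v \<Longrightarrow> i \<notin> U \<Longrightarrow> lookup (phi q) (Inr i) = lookup q (Inr i)" for q i
    using vU by (auto simp: phi_def lookup_add lookup_restr W_def lookup_single)
  have X: "lookup m (Inl v) + (\<Sum>j\<in>near A0. lookup m (Inl j)) = lookup n (Inl v) + (\<Sum>j\<in>near A0. lookup n (Inl j))"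
    using lp(1)[of m] lp(1)[of n] p by (simp add: A0n A0_def[symmetric])
  have Y: "lookup m (Inr v) + (\<Sum>j\<in>near A0. lookup m (Inr j)) = lookup n (Inr v) + (\<Sum>j\<in>near A0. lookup n (Inr j))"
    using lp(2)[of m] lp(2)[of n] p by (simp add: A0n A0_def[symmetric])
  have degU: "lookup m (Inl i) + lookup m (Inr i) = lookup n (Inl i) + lookup n (Inr i)" if "i \<in> U" for i
    using fun_cong[OF ad, of i] that by (simp add: adeg_def)
  have out: "lookup m (Inl i) = lookup n (Inl i)" "lookup m (Inr i) = lookup n (Inr i)" if "i \<noteq> v" "i \<notin> U" for i
    using lp(3,4)[OF that] p by metis+
  have "(\<Sum>j\<in>near A0. lookup m (Inl j)) + (\<Sum>j\<in>near A0. lookup m (Inr j)) =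
      (\<Sum>j\<in>near A0. lookup n (Inl j)) + (\<Sum>j\<in>near A0. lookup n (Inr j))"
    unfolding sum.distrib[symmetric] using degU NU by (intro sum.cong) auto
  \<comment> \<open>The degree of \<open>phi\<close> in x_v and y_v is the degree of
    \<open>v\<close> plus that of the component touching it; the latter is known from
    \<open>adeg\<close>.\<close>
  then have degv: "lookup m (Inl v) + lookup m (Inr v) = lookup n (Inl v) + lookup n (Inr v)"
    using X Y by linarith
  show "mdeg_at m = mdeg_at n"
  proof
    fix i show "mdeg_at m i = mdeg_at n i"
      using degv degU[of i] out[of i] by (cases "i = v"; cases "i \<in> U") (auto simp: mdeg_at_def)
  qed
  have A0A: "A0 \<subseteq> A" by (auto simp: A0_def A_def supp_def adeg_def mdeg_at_def split: if_splits)
  have AU: "A \<inter> U \<subseteq> A0" by (auto simp: A0_def A_def supp_def adeg_def mdeg_at_def)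
  have mono: "(i, j) \<in> conn A0 \<Longrightarrow> (i, j) \<in> conn A" for i j
    unfolding conn_def using A0A by (elim rtrancl_mono[THEN subsetD, rotated]) auto
  \<comment> \<open>A path leaving a component that does not touch \<open>v\<close> cannot reach
    \<open>v\<close>, for its previous vertex would be a neighbour of \<open>v\<close>; hence it
    stays inside \<open>A0\<close>.\<close>
  have far: "(i, j) \<in> conn A \<longleftrightarrow> (i, j) \<in> conn A0" if i: "i \<in> A0 - near A0" for i j
  proof
    assume "(i, j) \<in> conn A"
    then have "(i, j) \<in> conn A0 \<and> j \<in> A0 - near A0"
      unfolding conn_def[of A]
    proof (induction rule: rtrancl_induct)
      case base
      then show ?case using i conn_refl by simp
    next
      case (step j l)
      then have e: "{j, l} \<in> edges H" "l \<in> A" by auto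
      have "l \<noteq> v"
        using e(1) step.IH conn_refl by (auto simp: near_def insert_commute)
      then have l: "l \<in> A0" using edgeD[OF e(1)] e(2) AU by (auto simp: U_def)
      then have jl: "(j, l) \<in> conn A0" using e step.IH by (auto intro: conn_edge)
      then have "l \<notin> near A0" using step.IH near_conn[OF _ conn_sym] by blast
      then show ?case using l jl step.IH conn_trans by blast
    qed
    then show "(i, j) \<in> conn A0" by blast
  qed (rule mono)
  show "(\<Sum>j | (i, j) \<in> conn (supp (mdeg_at m)). lookup m (Inl j)) = (\<Sum>j | (i, j) \<in> conn (supp (mdeg_at m)). lookup n (Inl j))"
    if "i \<in> supp (mdeg_at m)" for i
    unfolding A_def[symmetric]
  proof -
    have iA: "i \<in> A" using that by (simp add: A_def)
    consider "i \<notin> verts H" | "i \<in> A0 - near A0" | "i \<in> near A0 \<union> {v}" "v \<in> A" | "i \<in> near A0" "v \<notin> A"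
      using iA AU by (auto simp: U_def)
    then show "(\<Sum>j | (i, j) \<in> conn A. lookup m (Inl j)) = (\<Sum>j | (i, j) \<in> conn A. lookup n (Inl j))"
    proof cases
      case 1
      have "j = i" if "(i, j) \<in> conn A" for j
        using that unfolding conn_def by (induction rule: rtrancl_induct) (use 1 edgeD in blast)+
      then have "{j. (i, j) \<in> conn A} = {i}" using conn_refl by blast
      moreover have "i \<noteq> v" "i \<notin> U" using 1 free by (auto simp: U_def free_vertex_def)
      ultimately show ?thesis using out(1) by simp
    next
      case 2
      have "snd (kap m) i = snd (kap n) i" using k by simp
      then show ?thesis using 2 far[OF 2] by (simp add: kap_def A0n A0_def[symmetric])
    next
      case 3
      have nv: "(v, j) \<in> conn A" if j: "j \<in> near A0" for j
      proof -
        obtain a where a: "a \<in> A0" "{v, a} \<in> edges H" "(a, j) \<in> conn A0" using j by (auto simp: near_def)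
        then have "(v, a) \<in> conn A" using 3(2) A0A by (auto intro: conn_edge)
        then show ?thesis using a(3) mono conn_trans by blast
      qed
      have "j \<in> insert v (near A0)" if "(v, j) \<in> conn A" for j
        using that unfolding conn_def[of A]
      proof (induction rule: rtrancl_induct)
        case (step j l)
        then have e: "{j, l} \<in> edges H" "l \<in> A" by auto
        show ?case
        proof (cases "l = v")
          case False
          then have l: "l \<in> A0" using edgeD[OF e(1)] e(2) AU by (auto simp: U_def)
          show ?thesis
          proof (cases "j = v")
            case True
            then show ?thesis using l e(1) conn_refl by (auto simp: near_def)
          next
            case False
            then have j: "j \<in> near A0" using step.IH by simp
            then show ?thesis using near_conn[OF j] conn_edge[OF _ l e(1)] near_subset by blast
          qed
        qed simp
      qed simp
      then have vc: "{j. (v, j) \<in> conn A} = insert v (near A0)" using nv conn_refl by blast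
      have "(v, i) \<in> conn A" using 3(1) vc by blast
      then have "{j. (i, j) \<in> conn A} = {j. (v, j) \<in> conn A}" using conn_sym conn_trans by blast
      moreover have "v \<notin> near A0" using NU vU by blast
      ultimately show ?thesis using X by (simp add: vc)
    next
      case 4
      have "conn A = conn A0"
      proof -
        have "i \<in> A0 \<and> j \<in> A0" if "i \<in> A" "j \<in> A" "{i, j} \<in> edges H" for i j
          using that edgeD[OF that(3)] 4(2) AU by (auto simp: U_def)
        then have "{(i, j). i \<in> A \<and> j \<in> A \<and> {i, j} \<in> edges H} = {(i, j). i \<in> A0 \<and> j \<in> A0 \<and> {i, j} \<in> edges H}"
          using A0A by auto
        then show ?thesis by (simp add: conn_def)
      qed
      then have "{j. (i, j) \<in> conn A} = near A0" using near_conn[OF 4(1)] near_connected[OF 4(1)] by blast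
      moreover have "lookup m (Inl v) = 0" "lookup n (Inl v) = 0"
        using 4(2) degv by (auto simp: A_def supp_def mdeg_at_def)
      ultimately show ?thesis using X by simp
    qed
  qed
qed

text \<open>The component at the label \<open>\<kappa>\<close> of the \<open>T\<close>-linear map
  from S to a direct sum of copies of \<open>T\<close>. Together these components have the kernel
  J_H.\<close>

definition Phi :: "('v \<Rightarrow> nat) \<times> ('v \<Rightarrow> nat) \<Rightarrow> ('v, 'k::field) xy_poly \<Rightarrow> ('v, 'k) xy_poly" where
  "Phi \<kappa> = push (\<lambda>m. kap m = \<kappa>) phi"

lemma Phi_sum: "Phi \<kappa> (sum f A) = (\<Sum>a\<in>A. Phi \<kappa> (f a))"
  by (simp add: Phi_def push_sum)

lemma Phi_mult: "a \<in> polys_in W \<Longrightarrow> Phi \<kappa> (a * p) = a * Phi \<kappa> p"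
  unfolding Phi_def by (rule push_mult) (auto simp: polys_in_def kap_add_W phi_add_W)

text \<open>Multiples of generators are killed because an exchange along an edge preserves label and
  image. Conversely, each monomial is replaced by a representative depending only on its label and
  image, which changes \<open>p\<close> only by an element of the ideal; the result is determined by
  the vanishing components and so is zero.\<close>

theorem binomial_edge_ideal_iff_Phi: "p \<in> binomial_edge_ideal H \<longleftrightarrow> (\<forall>\<kappa>. Phi \<kappa> p = 0)"
  for p :: "('v, 'k::field) xy_poly"
proof
  assume "p \<in> binomial_edge_ideal H"
  then show "\<forall>\<kappa>. Phi \<kappa> p = 0"
    unfolding binomial_edge_ideal_def ideal_gen_def
  proof (induction rule: ringmod.span_induct_alt)
    case base
    then show ?case by (simp add: Phi_def)
  next
    case (step c x y)
    then obtain i j where x: "x = Var (Inl i) * Var (Inr j) - Var (Inl j) * Var (Inr i)" and e: "{i, j} \<in> edges H"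
      by blast
    have "Phi \<kappa> (c * x) = 0" for \<kappa>
    proof (induction c rule: mpoly_induct)
      case (single m c)
      show ?case
        unfolding x binomial_eq Phi_def using kap_phi_swap[OF e, of m] by (simp add: push_diff push_single)
    next
      case (add p q)
      then show ?case by (simp add: Phi_def push_add distrib_right)
    qed
    then show ?case using step by (simp add: Phi_def push_add)
  qed
next
  assume 0: "\<forall>\<kappa>. Phi \<kappa> p = 0"
  define rep where "rep \<kappa> \<mu> = (SOME m. kap m = \<kappa> \<and> phi m = \<mu>)" for \<kappa> \<mu>
  have rep: "kap (rep (kap m) (phi m)) = kap m \<and> phi (rep (kap m) (phi m)) = phi m" for m
    unfolding rep_def by (rule someI_ex) blast
  \<comment> \<open>Grouping by labels writes the sum of representatives as a sum of linear images
    of the \<open>Phi \<kappa> p\<close>.\<close>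
  have "(\<Sum>m\<in>keys p. single (rep (kap m) (phi m)) (lookup p m)) =
      (\<Sum>m\<in>keys p. \<Sum>\<kappa>\<in>kap ` keys p. (single (rep \<kappa> (phi m)) (lookup p m) when kap m = \<kappa>))"
    by (rule sum.cong) (auto simp: when_def)
  also have "\<dots> = (\<Sum>\<kappa>\<in>kap ` keys p. push (\<lambda>m. kap m = \<kappa>) (\<lambda>m. rep \<kappa> (phi m)) p)"
    by (subst sum.swap) (simp add: push_superset[OF finite_keys order_refl])
  also have "\<dots> = (\<Sum>\<kappa>\<in>kap ` keys p. push (\<lambda>_. True) (rep \<kappa>) (Phi \<kappa> p))"
    by (simp add: Phi_def push_push)
  also have "\<dots> = 0" using 0 by (simp del: split_paired_All)
  finally have z: "(\<Sum>m\<in>keys p. single (rep (kap m) (phi m)) (lookup p m)) = 0" .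
  have "p = (\<Sum>m\<in>keys p. single m (lookup p m)) - (\<Sum>m\<in>keys p. single (rep (kap m) (phi m)) (lookup p m))"
    unfolding z using poly_mapping_sum_single[OF finite_keys order_refl, of p] by simp
  also have "\<dots> = (\<Sum>m\<in>keys p. single 0 (lookup p m) * (single m 1 - single (rep (kap m) (phi m)) 1))"
    by (simp add: sum_subtractf right_diff_distrib mult_single)
  also have "\<dots> \<in> binomial_edge_ideal H"
    using mcong_if_kap_phi_eq[OF conjunct1[OF rep, symmetric] conjunct2[OF rep, symmetric], of "TYPE('k)"]
    unfolding mcong_def binomial_edge_ideal_def ideal_gen_def
    by (intro ringmod.span_sum ringmod.span_scale)
  finally show "p \<in> binomial_edge_ideal H" .
qed

lemma Var_v_in_polys_in: "Var (Inl v) \<in> polys_in W" "Var (Inr v) \<in> polys_in W"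
  by (auto simp: Var_def polys_in_def W_def U_def)

text \<open>Each component \<open>Phi\<close> is linear over \<open>T\<close>, which contains y_v,
  and y_v cancels in the polynomial ring.\<close>

lemma Var_v_nonzerodivisor:
  fixes p :: "('v, 'k::field) xy_poly"
  assumes "Var (Inr v) * p \<in> binomial_edge_ideal H"
  shows "p \<in> binomial_edge_ideal H"
proof -
  have "Phi \<kappa> p = 0" for \<kappa>
  proof -
    have "Var (Inr v) * Phi \<kappa> p = Var (Inr v) * 0"
      using assms by (simp add: binomial_edge_ideal_iff_Phi Phi_mult Var_v_in_polys_in del: split_paired_All)
    then show ?thesis unfolding Var_def by (rule single_cancel)
  qed
  then show ?thesis by (simp add: binomial_edge_ideal_iff_Phi)
qed

end

section \<open>Vanishing of the higher Tor modules\<close>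

lemma Var_power: "Var w ^ n = single (single w n) 1"
  by (induction n) (simp_all add: Var_def mult_single single_add[symmetric])

lemma Var_dvd_iff_keys:
  fixes p :: "('w, 'k::comm_ring_1) mpoly"
  assumes "\<And>m. m \<in> keys p \<Longrightarrow> lookup m b > 0"
  shows "Var b dvd p"
proof -
  have m: "single b 1 + (m - single b 1) = m" if "m \<in> keys p" for m
    by (rule poly_mapping_eqI) (use assms[OF that] in \<open>auto simp: lookup_add lookup_minus lookup_single when_def\<close>)
  have "p = (\<Sum>m\<in>keys p. single (single b 1 + (m - single b 1)) (lookup p m))"
    using poly_mapping_sum_single[OF finite_keys order_refl, of p] m by simp
  also have "\<dots> = Var b * (\<Sum>m\<in>keys p. single (m - single b 1) (lookup p m))"
    by (simp add: Var_def sum_distrib_left mult_single)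
  finally show ?thesis by (rule dvdI)
qed

text \<open>A power of another variable leaves the exponent of \<open>b\<close> untouched in every
  monomial. In other terms, distinct variables form a regular sequence.\<close>

lemma Var_dvd_Var_power_mult:
  fixes p q :: "('w, 'k::comm_ring_1) mpoly"
  assumes "a \<noteq> b" and eq: "Var a ^ n * p = Var b * q"
  shows "Var b dvd p"
proof (rule Var_dvd_iff_keys)
  fix m assume "m \<in> keys p"
  then have "lookup (Var a ^ n * p) (single a n + m) \<noteq> 0"
    by (simp add: Var_power lookup_single_mult_add in_keys_iff)
  then have "single a n + m \<in> keys (Var b * q)" by (simp add: eq in_keys_iff)
  then obtain x y where "single a n + m = x + y" "x \<in> keys (Var b :: ('w, 'k) mpoly)"
    using keys_mult by blast
  then have "single a n + m = single b 1 + y" by (auto simp: Var_def split: if_splits)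
  then have "lookup (single a n + m) b = lookup (single b 1 + y) b" by simp
  then show "lookup m b > 0" using \<open>a \<noteq> b\<close> by (simp add: lookup_add lookup_single when_def)
qed

lemma Var_cancel: "Var b * p = Var b * q \<Longrightarrow> p = q" for p q :: "('w, 'k::comm_ring_1) mpoly"
  unfolding Var_def by (rule single_cancel)

locale resolution =
  fixes B :: "nat \<Rightarrow> 'b set" and s D z and I :: "('w, 'k::field) mpoly set"
  assumes res: "free_res B s D z I"
begin

lemma fin: "finite (B i)" and B0: "B 0 = {z}" and s0: "s 0 z = 0"
  using res by (auto simp: free_res_def)

lemma homogeneous: "l \<in> B i \<Longrightarrow> k \<in> B (Suc i) \<Longrightarrow> m \<in> keys (D i l k) \<Longrightarrow> mdeg m + s i l = s (Suc i) k"
  using res unfolding free_res_def by blast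

lemma minimal: "l \<in> B i \<Longrightarrow> k \<in> B (Suc i) \<Longrightarrow> const_coeff (D i l k) = 0"
  using res unfolding free_res_def by blast

lemma image0: "p \<in> I \<longleftrightarrow> (\<exists>w. p = (\<Sum>k\<in>B (Suc 0). D 0 z k * w k))"
  using res by (simp add: free_res_def)

lemma complex: "l \<in> B i \<Longrightarrow> k \<in> B (Suc (Suc i)) \<Longrightarrow> (\<Sum>j\<in>B (Suc i). D i l j * D (Suc i) j k) = 0"
  using res unfolding free_res_def by blast

lemma exact: "(\<And>l. l \<in> B i \<Longrightarrow> (\<Sum>k\<in>B (Suc i). D i l k * u k) = 0) \<Longrightarrow>
    \<exists>w. \<forall>k\<in>B (Suc i). u k = (\<Sum>j\<in>B (Suc (Suc i)). D (Suc i) k j * w j)"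
  using res unfolding free_res_def by blast

lemma complex_apply:
  assumes "l \<in> B i"
  shows "(\<Sum>j\<in>B (Suc i). D i l j * (\<Sum>k\<in>B (Suc (Suc i)). D (Suc i) j k * w k)) = 0"
proof -
  have "(\<Sum>j\<in>B (Suc i). D i l j * (\<Sum>k\<in>B (Suc (Suc i)). D (Suc i) j k * w k)) =
      (\<Sum>k\<in>B (Suc (Suc i)). (\<Sum>j\<in>B (Suc i). D i l j * D (Suc i) j k) * w k)"
    unfolding sum_distrib_left sum_distrib_right by (subst sum.swap) (simp add: mult.assoc)
  also have "\<dots> = 0" using complex[OF assms] by simp
  finally show ?thesis .
qed

text \<open>In degree 0 the image is \<open>I\<close>, and the hypothesis applies. In higher degrees
  the image is the kernel of a map into a free module, where variables cancel.\<close>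

lemma image_saturated:
  assumes nzd: "\<And>p. Var b * p \<in> I \<Longrightarrow> p \<in> I"
    and w: "\<And>l. l \<in> B i \<Longrightarrow> Var b * g l = (\<Sum>k\<in>B (Suc i). D i l k * w k)"
  shows "\<exists>w'. \<forall>l\<in>B i. g l = (\<Sum>k\<in>B (Suc i). D i l k * w' k)"
proof (cases i)
  case 0
  then have "Var b * g z \<in> I" using w[of z] B0 image0 by auto
  then have "g z \<in> I" by (rule nzd)
  then show ?thesis using image0 0 B0 by auto
next
  case (Suc j)
  have "(\<Sum>l\<in>B i. D j l' l * g l) = 0" if "l' \<in> B j" for l'
  proof (rule Var_cancel)
    have "Var b * (\<Sum>l\<in>B i. D j l' l * g l) = (\<Sum>l\<in>B i. D j l' l * (Var b * g l))"
      by (simp add: sum_distrib_left mult_ac)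
    also have "\<dots> = (\<Sum>l\<in>B i. D j l' l * (\<Sum>k\<in>B (Suc i). D i l k * w k))"
      using w by simp
    also have "\<dots> = 0" using complex_apply[OF that] by (simp add: Suc)
    finally show "Var b * (\<Sum>l\<in>B i. D j l' l * g l) = Var b * 0" by simp
  qed
  then show ?thesis using exact[of j g] by (simp add: Suc)
qed

text \<open>The subcomplex \<open>(X, Y)\<^sup>c F\<close> is acyclic in positive degrees.\<close>

lemma power_subcomplex_exact:
  fixes a b :: 'w and f :: "nat \<Rightarrow> 'b \<Rightarrow> ('w, 'k) mpoly"
  assumes nzd: "\<And>p. Var b * p \<in> I \<Longrightarrow> p \<in> I" and ab: "a \<noteq> b"
    and "\<And>k. k \<in> B (Suc i) \<Longrightarrow> u k = (\<Sum>t\<le>c. Var a ^ t * Var b ^ (c - t) * f t k)"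
    and "\<And>l. l \<in> B i \<Longrightarrow> (\<Sum>k\<in>B (Suc i). D i l k * u k) = 0"
  shows "\<exists>h. \<forall>k\<in>B (Suc i). u k =
    (\<Sum>t\<le>c. Var a ^ t * Var b ^ (c - t) * (\<Sum>j\<in>B (Suc (Suc i)). D (Suc i) k j * h t j))"
  using assms(3,4)
proof (induction c arbitrary: u f)
  case 0
  then obtain w where "\<forall>k\<in>B (Suc i). u k = (\<Sum>j\<in>B (Suc (Suc i)). D (Suc i) k j * w j)"
    using exact[of i u] by blast
  then show ?case by (intro exI[of _ "\<lambda>_. w"]) simp
next
  case (Suc c)
  let ?d = "\<lambda>g l. \<Sum>k\<in>B (Suc i). D i l k * g k"
  define v where "v k = (\<Sum>t\<le>c. Var a ^ t * Var b ^ (c - t) * f t k)" for k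
  define f1 where "f1 = f (Suc c)"
  \<comment> \<open>Write X for \<open>Var a\<close> and Y for \<open>Var b\<close>. The summand
    with the highest power of X is split off; all others are divisible by Y and leave an element of
    (X, Y)^c F.\<close>
  have u: "u k = Var b * v k + Var a ^ Suc c * f1 k" if "k \<in> B (Suc i)" for k
  proof -
    have "Var b * v k = (\<Sum>t\<le>c. Var a ^ t * Var b ^ (Suc c - t) * f t k)"
      unfolding v_def sum_distrib_left by (rule sum.cong) (auto simp: Suc_diff_le mult_ac)
    then show ?thesis unfolding Suc.prems(1)[OF that] f1_def by simp
  qed
  have dadd: "?d (\<lambda>k. p * g k + q * g' k) l = p * ?d g l + q * ?d g' l" for p q g g' l
    by (simp add: sum_distrib_left sum.distrib algebra_simps)
  have du: "Var b * ?d v l + Var a ^ Suc c * ?d f1 l = 0" if "l \<in> B i" for l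
  proof -
    have "?d u l = ?d (\<lambda>k. Var b * v k + Var a ^ Suc c * f1 k) l" using u by simp
    then show ?thesis using Suc.prems(2)[OF that] dadd by metis
  qed
  \<comment> \<open>Since Y d(v) + X^(c+1) d(f1) = 0, Y divides d(f1). By saturation the quotient is
    a boundary d(e), so f1 - Y e is a cycle.\<close>
  have "\<exists>g. \<forall>l\<in>B i. ?d f1 l = Var b * g l"
  proof -
    have "\<forall>l\<in>B i. \<exists>q. ?d f1 l = Var b * q"
    proof
      fix l assume l: "l \<in> B i"
      have "Var a ^ Suc c * ?d f1 l = Var b * (- ?d v l)"
        using du[OF l] by (simp add: eq_neg_iff_add_eq_0 add.commute)
      from Var_dvd_Var_power_mult[OF ab this] show "\<exists>q. ?d f1 l = Var b * q" by (rule dvdE) blast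
    qed
    then show ?thesis by (rule bchoice)
  qed
  then obtain g where g: "\<And>l. l \<in> B i \<Longrightarrow> Var b * g l = ?d f1 l" by auto
  from image_saturated[OF nzd g] obtain e where e: "\<And>l. l \<in> B i \<Longrightarrow> g l = ?d e l" by blast
  have "?d (\<lambda>k. f1 k - Var b * e k) l = 0" if "l \<in> B i" for l
    using dadd[where p = 1 and g = f1 and q = "- Var b" and g' = e and l = l] g[OF that] e[OF that] by simp
  from exact[OF this] obtain h1 where h1: "\<And>k. k \<in> B (Suc i) \<Longrightarrow>
      f1 k - Var b * e k = (\<Sum>j\<in>B (Suc (Suc i)). D (Suc i) k j * h1 j)" by blast
  \<comment> \<open>The correction Y X^(c+1) e moves from the second summand to the first: u = Y v'
    + X^(c+1) (f1 - Y e). As X^(c+1) = X^c X, \<open>v'\<close> stays in (X, Y)^c F, only its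
    coefficient at t = c changing, and it is a cycle to which the induction hypothesis
    applies.\<close>
  define v' where "v' k = v k + Var a ^ Suc c * e k" for k
  define f' where "f' = f(c := \<lambda>k. f c k + Var a * e k)"
  have v': "v' k = (\<Sum>t\<le>c. Var a ^ t * Var b ^ (c - t) * f' t k)" for k
  proof -
    have "(\<Sum>t\<le>c. Var a ^ t * Var b ^ (c - t) * f' t k) =
        (\<Sum>t\<le>c. Var a ^ t * Var b ^ (c - t) * f t k + (if t = c then Var a ^ Suc c * e k else 0))"
      by (rule sum.cong) (auto simp: f'_def algebra_simps)
    then show ?thesis by (simp add: v'_def v_def sum.distrib)
  qed
  have dv': "?d v' l = 0" if "l \<in> B i" for l
  proof (rule Var_cancel)
    have "?d v' l = ?d v l + Var a ^ Suc c * g l"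
      using dadd[where p = 1 and g = v and q = "Var a ^ Suc c" and g' = e and l = l] e[OF that] by (simp add: v'_def)
    then have "Var b * ?d v' l = Var b * ?d v l + Var a ^ Suc c * (Var b * g l)"
      by (simp add: algebra_simps)
    then show "Var b * ?d v' l = Var b * 0" using du[OF that] g[OF that] by simp
  qed
  obtain h where h: "\<And>k. k \<in> B (Suc i) \<Longrightarrow> v' k =
      (\<Sum>t\<le>c. Var a ^ t * Var b ^ (c - t) * (\<Sum>j\<in>B (Suc (Suc i)). D (Suc i) k j * h t j))"
    using Suc.IH[OF v' dv'] by blast
  define h' where "h' = h(Suc c := h1)"
  show ?case
  proof (intro exI[of _ h'] ballI)
    fix k assume k: "k \<in> B (Suc i)"
    have "u k = Var b * v' k + Var a ^ Suc c * (f1 k - Var b * e k)"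
      by (simp add: u[OF k] v'_def algebra_simps)
    also have "\<dots> = (\<Sum>t\<le>c. Var a ^ t * Var b ^ (Suc c - t) * (\<Sum>j\<in>B (Suc (Suc i)). D (Suc i) k j * h t j)) +
        Var a ^ Suc c * (\<Sum>j\<in>B (Suc (Suc i)). D (Suc i) k j * h1 j)"
    proof -
      have "Var b * v' k = (\<Sum>t\<le>c. Var a ^ t * Var b ^ (Suc c - t) * (\<Sum>j\<in>B (Suc (Suc i)). D (Suc i) k j * h t j))"
        unfolding h[OF k] sum_distrib_left[where r = "Var b"] by (rule sum.cong) (auto simp: Suc_diff_le mult_ac)
      then show ?thesis unfolding h1[OF k] by simp
    qed
    also have "\<dots> = (\<Sum>t\<le>Suc c. Var a ^ t * Var b ^ (Suc c - t) * (\<Sum>j\<in>B (Suc (Suc i)). D (Suc i) k j * h' t j))"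
      by (simp add: h'_def)
    finally show "u k = (\<Sum>t\<le>Suc c. Var a ^ t * Var b ^ (Suc c - t) * (\<Sum>j\<in>B (Suc (Suc i)). D (Suc i) k j * h' t j))" .
  qed
qed

end

section \<open>Acyclicity of a resolution over \<open>T\<close> after tensoring with S/J_H\<close>

context graph_with_free_vertex
begin

lemma Phi_expansion:
  "\<exists>f. Phi \<kappa> p = (\<Sum>t\<le>cap \<kappa>. Var (Inl v) ^ t * Var (Inr v) ^ (cap \<kappa> - t) * f t)"
proof (induction p rule: mpoly_induct)
  case (single m c)
  show ?case
  proof (cases "kap m = \<kappa>")
    case True
    obtain t where t: "t \<le> cap \<kappa>" "phi m = restr W m + single (Inl v) t + single (Inr v) (cap \<kappa> - t)"
      using phi_form[of m] True by blast
    have "Phi \<kappa> (single m c) = Var (Inl v) ^ t * Var (Inr v) ^ (cap \<kappa> - t) * single (restr W m) c"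
      by (simp add: Phi_def push_single True t(2) Var_power mult_single ac_simps)
    also have "\<dots> = (\<Sum>t'\<le>cap \<kappa>. Var (Inl v) ^ t' * Var (Inr v) ^ (cap \<kappa> - t') * (if t' = t then single (restr W m) c else 0))"
      using t(1) by (simp add: if_distrib cong: if_cong)
    finally show ?thesis by (rule exI[of _ "\<lambda>t'. if t' = t then single (restr W m) c else 0"])
  next
    case False
    then show ?thesis by (intro exI[of _ "\<lambda>_. 0"]) (simp add: Phi_def push_single)
  qed
next
  case (add p q)
  then obtain f g where "Phi \<kappa> p = (\<Sum>t\<le>cap \<kappa>. Var (Inl v) ^ t * Var (Inr v) ^ (cap \<kappa> - t) * f t)"
     "Phi \<kappa> q = (\<Sum>t\<le>cap \<kappa>. Var (Inl v) ^ t * Var (Inr v) ^ (cap \<kappa> - t) * g t)" by blast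
  then show ?case
    by (intro exI[of _ "\<lambda>t. f t + g t"]) (simp add: Phi_def push_add sum.distrib distrib_left)
qed

text \<open>Sets the variables of \<open>U\<close> to zero. This \<open>T\<close>-linear retraction
  carries coefficients found over S back into \<open>T\<close>, where \<open>Phi\<close> is
  linear.\<close>

definition retr :: "('v, 'k::field) xy_poly \<Rightarrow> ('v, 'k) xy_poly" where
  "retr = push (\<lambda>m. keys m \<subseteq> W) (\<lambda>m. m)"

lemma retr_sum: "retr (sum f A) = (\<Sum>a\<in>A. retr (f a))"
  by (simp add: retr_def push_sum)

lemma retr_in: "retr p \<in> polys_in W"
  unfolding retr_def polys_in_def using keys_push by fastforce

lemma keys_add_nat: "keys (m + n) = keys m \<union> keys n" for m n :: "'a \<Rightarrow>\<^sub>0 nat"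
  by (auto simp: in_keys_iff lookup_add)

lemma retr_mult: "a \<in> polys_in W \<Longrightarrow> retr (a * p) = a * retr p"
  unfolding retr_def by (rule push_mult) (auto simp: polys_in_def keys_add_nat)

lemma retr_Phi: "retr (Phi \<kappa> p) = Phi \<kappa> p"
proof -
  have "keys (phi m) \<subseteq> W" for m
  proof -
    have "Inl v \<in> W" "Inr v \<in> W" by (auto simp: W_def U_def)
    then show ?thesis using keys_restr[of W m] by (auto simp: phi_def keys_add_nat split: if_splits)
  qed
  then have "keys m \<subseteq> W" if "m \<in> keys (Phi \<kappa> p)" for m
    using that keys_push unfolding Phi_def by fastforce
  then show ?thesis
    unfolding retr_def by (subst (3) push_True_id[symmetric]) (intro push_cong, auto)
qed

lemma power_Var_in: "Var (Inl v) ^ t * Var (Inr v) ^ t' \<in> polys_in W"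
  by (auto simp: Var_power mult_single polys_in_def keys_add_nat W_def U_def split: if_splits)

text \<open>Over the polynomial ring in the variables \<open>W\<close>, the module \<open>S/J\<^sub>H\<close> is a direct sum of powers of
  the ideal \<open>(x\<^sub>v, y\<^sub>v)\<close>, one for each label \<open>\<kappa>\<close>.\<close>

theorem tensor_exact:
  fixes I :: "('v, 'k::field) xy_poly set"
  assumes res: "free_res B s D z I"
    and DW: "\<And>i l k. l \<in> B i \<Longrightarrow> k \<in> B (Suc i) \<Longrightarrow> D i l k \<in> polys_in W"
    and nzd: "\<And>p. Var (Inr v) * p \<in> I \<Longrightarrow> p \<in> I"
    and u: "\<And>l. l \<in> B i \<Longrightarrow> (\<Sum>k\<in>B (Suc i). D i l k * u k) \<in> binomial_edge_ideal H"
  shows "\<exists>w. \<forall>k\<in>B (Suc i). u k - (\<Sum>j\<in>B (Suc (Suc i)). D (Suc i) k j * w j) \<in> binomial_edge_ideal H"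
proof -
  interpret resolution B s D z I by unfold_locales (rule res)
  \<comment> \<open>Only the finitely many labels occurring in \<open>u\<close> matter; each is
    treated separately and the solutions are added.\<close>
  define K where "K = (\<Union>k\<in>B (Suc i). kap ` keys (u k))"
  have finK: "finite K" using fin by (simp add: K_def)
  have step: "\<exists>w. \<forall>k\<in>B (Suc i). \<forall>\<kappa>'. Phi \<kappa>' (\<Sum>j\<in>B (Suc (Suc i)). D (Suc i) k j * w j) =
      (if \<kappa>' = \<kappa> then Phi \<kappa> (u k) else 0)" if \<kappa>K: "\<kappa> \<in> K" for \<kappa>
  proof -
    \<comment> \<open>The label must come from an actual monomial, since only then are the
      generators of its power attained.\<close>
    obtain m0 where \<kappa>: "\<kappa> = kap m0" using \<kappa>K by (auto simp: K_def)
    define c where "c = cap \<kappa>"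
    have "\<forall>k. \<exists>f. Phi \<kappa> (u k) = (\<Sum>t\<le>c. Var (Inl v) ^ t * Var (Inr v) ^ (c - t) * f t)"
      using Phi_expansion c_def by blast
    from choice[OF this] obtain f where f: "\<And>k. Phi \<kappa> (u k) = (\<Sum>t\<le>c. Var (Inl v) ^ t * Var (Inr v) ^ (c - t) * f k t)"
      by blast
    have cyc: "(\<Sum>k\<in>B (Suc i). D i l k * Phi \<kappa> (u k)) = 0" if l: "l \<in> B i" for l
    proof -
      have "(\<Sum>k\<in>B (Suc i). D i l k * Phi \<kappa> (u k)) = Phi \<kappa> (\<Sum>k\<in>B (Suc i). D i l k * u k)"
        using DW[OF l] by (simp add: Phi_sum Phi_mult)
      then show ?thesis using u[OF l] by (simp add: binomial_edge_ideal_iff_Phi del: split_paired_All)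
    qed
    obtain h where h: "\<And>k. k \<in> B (Suc i) \<Longrightarrow> Phi \<kappa> (u k) =
        (\<Sum>t\<le>c. Var (Inl v) ^ t * Var (Inr v) ^ (c - t) * (\<Sum>j\<in>B (Suc (Suc i)). D (Suc i) k j * h t j))"
      using power_subcomplex_exact[of "Inr v" "Inl v" i "\<lambda>k. Phi \<kappa> (u k)" c "\<lambda>t k. f k t", OF nzd _ f cyc] by auto
    have h': "Phi \<kappa> (u k) =
        (\<Sum>t\<le>c. Var (Inl v) ^ t * Var (Inr v) ^ (c - t) * (\<Sum>j\<in>B (Suc (Suc i)). D (Suc i) k j * retr (h t j)))"
      if k: "k \<in> B (Suc i)" for k
    proof -
      have "Phi \<kappa> (u k) = retr (\<Sum>t\<le>c. Var (Inl v) ^ t * Var (Inr v) ^ (c - t) * (\<Sum>j\<in>B (Suc (Suc i)). D (Suc i) k j * h t j))"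
        unfolding h[OF k, symmetric] retr_Phi ..
      also have "\<dots> = (\<Sum>t\<le>c. Var (Inl v) ^ t * Var (Inr v) ^ (c - t) * retr (\<Sum>j\<in>B (Suc (Suc i)). D (Suc i) k j * h t j))"
        by (simp add: retr_sum retr_mult power_Var_in)
      also have "\<dots> = (\<Sum>t\<le>c. Var (Inl v) ^ t * Var (Inr v) ^ (c - t) * (\<Sum>j\<in>B (Suc (Suc i)). retr (D (Suc i) k j * h t j)))"
        by (simp add: retr_sum)
      finally show ?thesis using DW[OF k] by (simp add: retr_mult)
    qed
    have "\<forall>t. \<exists>n. t \<le> c \<longrightarrow> kap n = \<kappa> \<and> phi n = single (Inl v) t + single (Inr v) (c - t)"
      using phi_attained[of _ m0] by (auto simp: c_def \<kappa>)
    from choice[OF this] obtain n where n: "\<And>t. t \<le> c \<Longrightarrow> kap (n t) = \<kappa> \<and> phi (n t) = single (Inl v) t + single (Inr v) (c - t)"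
      by blast
    \<comment> \<open>The generator x_v^t y_v^(c-t) is lifted to a monomial \<open>n t\<close> with
      label \<open>\<kappa>\<close>. Since the coefficients lie in \<open>T\<close>, all other
      components of \<open>w\<close> vanish.\<close>
    define w where "w j = (\<Sum>t\<le>c. retr (h t j) * single (n t) 1)" for j
    have Pw: "Phi \<kappa>' (w j) = (\<Sum>t\<le>c. if \<kappa>' = \<kappa> then Var (Inl v) ^ t * Var (Inr v) ^ (c - t) * retr (h t j) else 0)" for \<kappa>' j
      unfolding w_def Phi_sum
    proof (rule sum.cong[OF refl])
      fix t assume "t \<in> {..c}"
      then show "Phi \<kappa>' (retr (h t j) * single (n t) 1) =
          (if \<kappa>' = \<kappa> then Var (Inl v) ^ t * Var (Inr v) ^ (c - t) * retr (h t j) else 0)"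
        unfolding Phi_mult[OF retr_in] using n[of t]
        by (auto simp: Phi_def push_single Var_power mult_single ac_simps)
    qed
    show ?thesis
    proof (intro exI[of _ w] ballI allI)
      fix k \<kappa>' assume k: "k \<in> B (Suc i)"
      have "Phi \<kappa>' (\<Sum>j\<in>B (Suc (Suc i)). D (Suc i) k j * w j) = (\<Sum>j\<in>B (Suc (Suc i)). D (Suc i) k j * Phi \<kappa>' (w j))"
        using DW[OF k] by (simp add: Phi_sum Phi_mult)
      also have "\<dots> = (if \<kappa>' = \<kappa> then Phi \<kappa> (u k) else 0)"
      proof (cases "\<kappa>' = \<kappa>")
        case True
        have "(\<Sum>j\<in>B (Suc (Suc i)). D (Suc i) k j * Phi \<kappa>' (w j)) =
            (\<Sum>j\<in>B (Suc (Suc i)). \<Sum>t\<le>c. Var (Inl v) ^ t * Var (Inr v) ^ (c - t) * (D (Suc i) k j * retr (h t j)))"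
          unfolding Pw using True by (simp add: sum_distrib_left mult_ac)
        also have "\<dots> = (\<Sum>t\<le>c. \<Sum>j\<in>B (Suc (Suc i)). Var (Inl v) ^ t * Var (Inr v) ^ (c - t) * (D (Suc i) k j * retr (h t j)))"
          by (rule sum.swap)
        also have "\<dots> = Phi \<kappa> (u k)" unfolding h'[OF k] by (simp add: sum_distrib_left)
        finally show ?thesis using True by simp
      qed (simp add: Pw)
      finally show "Phi \<kappa>' (\<Sum>j\<in>B (Suc (Suc i)). D (Suc i) k j * w j) = (if \<kappa>' = \<kappa> then Phi \<kappa> (u k) else 0)" .
    qed
  qed
  have "\<forall>\<kappa>\<in>K. \<exists>w. \<forall>k\<in>B (Suc i). \<forall>\<kappa>'. Phi \<kappa>' (\<Sum>j\<in>B (Suc (Suc i)). D (Suc i) k j * w j) =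
      (if \<kappa>' = \<kappa> then Phi \<kappa> (u k) else 0)" using step by blast
  from bchoice[OF this] obtain w where w: "\<forall>\<kappa>\<in>K. \<forall>k\<in>B (Suc i). \<forall>\<kappa>'.
      Phi \<kappa>' (\<Sum>j\<in>B (Suc (Suc i)). D (Suc i) k j * w \<kappa> j) = (if \<kappa>' = \<kappa> then Phi \<kappa> (u k) else 0)" by (rule exE)
  show ?thesis
  proof (intro exI[of _ "\<lambda>j. \<Sum>\<kappa>\<in>K. w \<kappa> j"] ballI)
    fix k assume k: "k \<in> B (Suc i)"
    have "Phi \<kappa>' (u k - (\<Sum>j\<in>B (Suc (Suc i)). D (Suc i) k j * (\<Sum>\<kappa>\<in>K. w \<kappa> j))) = 0" for \<kappa>'
    proof -
      have "(\<Sum>j\<in>B (Suc (Suc i)). D (Suc i) k j * (\<Sum>\<kappa>\<in>K. w \<kappa> j)) = (\<Sum>\<kappa>\<in>K. \<Sum>j\<in>B (Suc (Suc i)). D (Suc i) k j * w \<kappa> j)"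
        by (subst sum.swap) (simp add: sum_distrib_left)
      then have "Phi \<kappa>' (\<Sum>j\<in>B (Suc (Suc i)). D (Suc i) k j * (\<Sum>\<kappa>\<in>K. w \<kappa> j)) = (\<Sum>\<kappa>\<in>K. if \<kappa>' = \<kappa> then Phi \<kappa> (u k) else 0)"
        by (simp only: Phi_sum[where A = K]) (intro sum.cong refl w[rule_format] k)
      also have "\<dots> = Phi \<kappa>' (u k)"
      proof (cases "\<kappa>' \<in> K")
        case False
        then have "{m \<in> keys (u k). kap m = \<kappa>'} = {}" using k by (auto simp: K_def)
        then have "Phi \<kappa>' (u k) = 0" unfolding Phi_def push_def by (simp only: sum.empty)
        then show ?thesis using False finK by simp
      qed (simp add: finK)
      finally show ?thesis by (simp add: Phi_def push_diff)
    qed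
    then show "u k - (\<Sum>j\<in>B (Suc (Suc i)). D (Suc i) k j * (\<Sum>\<kappa>\<in>K. w \<kappa> j)) \<in> binomial_edge_ideal H"
      by (simp add: binomial_edge_ideal_iff_Phi)
  qed
qed

end

section \<open>The tensor product of two resolutions\<close>

text \<open>The assumption \<open>tor\<close> says that the first resolution stays exact in positive
  degrees after tensoring with S/I', that is, the higher Tor modules of S/I and S/I' vanish.\<close>

locale tensor_resolution =
  R: resolution B s D z I + R': resolution B' s' D' z' I'
  for B :: "nat \<Rightarrow> 'b set" and s D z and I :: "('w::finite, 'k::field) mpoly set"
    and B' :: "nat \<Rightarrow> 'c set" and s' D' z' I' +
  assumes tor: "\<And>i u. (\<And>l. l \<in> B i \<Longrightarrow> (\<Sum>k\<in>B (Suc i). D i l k * u k) \<in> I') \<Longrightarrow>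
    \<exists>w. \<forall>k\<in>B (Suc i). u k - (\<Sum>j\<in>B (Suc (Suc i)). D (Suc i) k j * w j) \<in> I'"
begin

definition TB :: "nat \<Rightarrow> (nat \<times> 'b \<times> 'c) set" where
  "TB n = (SIGMA p:{..n}. B p \<times> B' (n - p))"

definition Ts :: "nat \<Rightarrow> nat \<times> 'b \<times> 'c \<Rightarrow> nat" where
  "Ts n = (\<lambda>(p, k, l). s p k + s' (n - p) l)"

definition TD :: "nat \<Rightarrow> nat \<times> 'b \<times> 'c \<Rightarrow> nat \<times> 'b \<times> 'c \<Rightarrow> ('w, 'k) mpoly" where
  "TD n = (\<lambda>(p, k, l) (p', k', l'). (if p' = Suc p \<and> l' = l then D p k k' else 0) +
     (if p' = p \<and> k' = k then (-1) ^ p * D' (n - p) l l' else 0))"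

definition Dop :: "nat \<Rightarrow> (nat \<times> 'b \<times> 'c \<Rightarrow> ('w, 'k) mpoly) \<Rightarrow> nat \<times> 'b \<times> 'c \<Rightarrow> ('w, 'k) mpoly" where
  "Dop n u = (\<lambda>(p, k, l). (\<Sum>k'\<in>B (Suc p). D p k k' * u (Suc p, k', l)) +
     (-1) ^ p * (\<Sum>l'\<in>B' (Suc n - p). D' (n - p) l l' * u (p, k, l')))"

lemma in_TB: "(p, k, l) \<in> TB n \<longleftrightarrow> p \<le> n \<and> k \<in> B p \<and> l \<in> B' (n - p)"
  by (auto simp: TB_def)

lemma finite_TB: "finite (TB n)"
  unfolding TB_def using R.fin R'.fin by auto

lemma TD_apply:
  assumes "x \<in> TB n"
  shows "(\<Sum>y\<in>TB (Suc n). TD n x y * u y) = Dop n u x"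
proof -
  obtain p k l where x: "x = (p, k, l)" by (cases x)
  have pkl: "p \<le> n" "k \<in> B p" "l \<in> B' (n - p)" using assms by (auto simp: x in_TB)
  let ?f1 = "\<lambda>(p', k', l'). (if p' = Suc p \<and> l' = l then D p k k' else 0)"
  let ?f2 = "\<lambda>(p', k', l'). (if p' = p \<and> k' = k then (-1) ^ p * D' (n - p) l l' else 0)"
  have "(\<Sum>y\<in>TB (Suc n). TD n x y * u y) = (\<Sum>y\<in>TB (Suc n). ?f1 y * u y) + (\<Sum>y\<in>TB (Suc n). ?f2 y * u y)"
    by (auto simp: TD_def x sum.distrib[symmetric] distrib_right intro!: sum.cong)
  also have "(\<Sum>y\<in>TB (Suc n). ?f1 y * u y) = (\<Sum>y\<in>(\<lambda>k'. (Suc p, k', l)) ` B (Suc p). ?f1 y * u y)"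
    by (rule sum.mono_neutral_right) (use pkl finite_TB in \<open>auto simp: in_TB\<close>)
  also have "\<dots> = (\<Sum>k'\<in>B (Suc p). D p k k' * u (Suc p, k', l))"
    by (subst sum.reindex) (auto simp: inj_on_def)
  also have "(\<Sum>y\<in>TB (Suc n). ?f2 y * u y) = (\<Sum>y\<in>(\<lambda>l'. (p, k, l')) ` B' (Suc n - p). ?f2 y * u y)"
    by (rule sum.mono_neutral_right) (use pkl finite_TB in \<open>auto simp: in_TB\<close>)
  also have "\<dots> = (-1) ^ p * (\<Sum>l'\<in>B' (Suc n - p). D' (n - p) l l' * u (p, k, l'))"
    by (subst sum.reindex) (auto simp: inj_on_def sum_distrib_left mult.assoc)
  finally show ?thesis by (simp add: Dop_def x)
qed

lemma Dop_add: "Dop n (\<lambda>x. u x + w x) x = Dop n u x + Dop n w x"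
  by (cases x) (simp add: Dop_def distrib_left sum.distrib)

lemma Dop_diff: "Dop n (\<lambda>x. u x - w x) x = Dop n u x - Dop n w x"
  by (cases x) (simp add: Dop_def right_diff_distrib sum_subtractf)

text \<open>The pure terms vanish in each factor; the two mixed terms carry opposite signs and
  cancel.\<close>

lemma Dop_Dop:
  assumes "x \<in> TB n"
  shows "Dop n (Dop (Suc n) u) x = 0"
proof -
  obtain p k l where x: "x = (p, k, l)" by (cases x)
  obtain q where n: "n = p + q" using assms by (auto simp: x in_TB le_iff_add)
  have kl: "k \<in> B p" "l \<in> B' q" using assms by (auto simp: x in_TB n)
  have e: "p + q - p = q" "Suc (p + q) - p = Suc q" "Suc (Suc (p + q)) - p = Suc (Suc q)"
     "Suc (p + q) - Suc p = q" "Suc (Suc (p + q)) - Suc p = Suc q" by auto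
  have 1: "(\<Sum>k'\<in>B (Suc p). D p k k' * (\<Sum>k''\<in>B (Suc (Suc p)). D (Suc p) k' k'' * u (Suc (Suc p), k'', l))) = 0"
    by (rule R.complex_apply[OF kl(1)])
  have 2: "(\<Sum>l'\<in>B' (Suc q). D' q l l' * (\<Sum>l''\<in>B' (Suc (Suc q)). D' (Suc q) l' l'' * u (p, k, l''))) = 0"
    by (rule R'.complex_apply[OF kl(2)])
  have 3: "(\<Sum>k'\<in>B (Suc p). D p k k' * (\<Sum>l'\<in>B' (Suc q). D' q l l' * u (Suc p, k', l'))) =
      (\<Sum>l'\<in>B' (Suc q). D' q l l' * (\<Sum>k'\<in>B (Suc p). D p k k' * u (Suc p, k', l')))"
    unfolding sum_distrib_left by (subst sum.swap) (simp add: mult_ac)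
  have "Dop n (Dop (Suc n) u) x =
      (\<Sum>k'\<in>B (Suc p). D p k k' * ((\<Sum>k''\<in>B (Suc (Suc p)). D (Suc p) k' k'' * u (Suc (Suc p), k'', l)) +
         (-1) ^ Suc p * (\<Sum>l'\<in>B' (Suc q). D' q l l' * u (Suc p, k', l')))) +
      (-1) ^ p * (\<Sum>l'\<in>B' (Suc q). D' q l l' * ((\<Sum>k'\<in>B (Suc p). D p k k' * u (Suc p, k', l')) +
         (-1) ^ p * (\<Sum>l''\<in>B' (Suc (Suc q)). D' (Suc q) l' l'' * u (p, k, l''))))"
    unfolding Dop_def x n prod.case e ..
  also have "\<dots> = (-1) ^ Suc p * (\<Sum>k'\<in>B (Suc p). D p k k' * (\<Sum>l'\<in>B' (Suc q). D' q l l' * u (Suc p, k', l'))) +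
      (-1) ^ p * (\<Sum>l'\<in>B' (Suc q). D' q l l' * (\<Sum>k'\<in>B (Suc p). D p k k' * u (Suc p, k', l')))"
  proof -
    have A: "(\<Sum>i\<in>X. a i * (b i + c * f i)) = (\<Sum>i\<in>X. a i * b i) + c * (\<Sum>i\<in>X. a i * f i)"
      for X :: "'x set" and a b f and c :: "('w, 'k) mpoly"
      by (simp add: distrib_left sum.distrib sum_distrib_left mult.left_commute)
    show ?thesis unfolding A 1 2 by simp
  qed
  also have "\<dots> = 0" unfolding 3 by simp
  finally show ?thesis .
qed

text \<open>If \<open>u\<close> vanishes in first degree above \<open>c\<close>, its layer at
  \<open>c\<close> is a cycle for the second differential, in positive second degree. Exactness of
  the second factor makes it a boundary; subtracting this boundary lowers the bound on the first
  degree.\<close>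

lemma exact_if_vanishing:
  assumes "c \<le> Suc n" and "\<And>x. x \<in> TB n \<Longrightarrow> Dop n u x = 0"
    and "\<And>p k l. (p, k, l) \<in> TB (Suc n) \<Longrightarrow> c \<le> p \<Longrightarrow> u (p, k, l) = 0"
  shows "\<exists>w. \<forall>x\<in>TB (Suc n). u x = Dop (Suc n) w x"
  using assms
proof (induction c arbitrary: u)
  case 0
  have "u x = Dop (Suc n) (\<lambda>_. 0) x" if "x \<in> TB (Suc n)" for x
    using that 0(3) by (cases x) (simp add: Dop_def)
  then show ?case by blast
next
  case (Suc c)
  then have cn: "c \<le> n" by simp
  have "\<forall>k. \<exists>w. k \<in> B c \<longrightarrow> (\<forall>l\<in>B' (Suc (n - c)). u (c, k, l) = (\<Sum>j\<in>B' (Suc (Suc (n - c))). D' (Suc (n - c)) l j * w j))"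
  proof (rule allI, cases)
    fix k assume k: "k \<in> B c"
    have "(\<Sum>l'\<in>B' (Suc (n - c)). D' (n - c) l l' * u (c, k, l')) = 0" if l: "l \<in> B' (n - c)" for l
    proof -
      have "Dop n u (c, k, l) = 0" using Suc.prems(2) cn k l by (simp add: in_TB)
      moreover have "u (Suc c, k', l) = 0" if "k' \<in> B (Suc c)" for k'
        using Suc.prems(3)[of "Suc c" k' l] that cn l by (simp add: in_TB)
      ultimately have "(-1) ^ c * (\<Sum>l'\<in>B' (Suc (n - c)). D' (n - c) l l' * u (c, k, l')) = 0"
        using cn by (simp add: Dop_def Suc_diff_le)
      then have "(-1) ^ c * ((-1) ^ c * (\<Sum>l'\<in>B' (Suc (n - c)). D' (n - c) l l' * u (c, k, l'))) = 0" by simp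
      then show ?thesis by (simp add: mult.assoc[symmetric] power_mult_distrib[symmetric])
    qed
    from R'.exact[OF this] show "\<exists>w. k \<in> B c \<longrightarrow> (\<forall>l\<in>B' (Suc (n - c)). u (c, k, l) = (\<Sum>j\<in>B' (Suc (Suc (n - c))). D' (Suc (n - c)) l j * w j))"
      by blast
  qed simp
  from choice[OF this] obtain v where v: "\<forall>k. k \<in> B c \<longrightarrow>
      (\<forall>l\<in>B' (Suc (n - c)). u (c, k, l) = (\<Sum>j\<in>B' (Suc (Suc (n - c))). D' (Suc (n - c)) l j * v k j))" ..
  \<comment> \<open>The sign cancels the one in \<open>Dop\<close>. As \<open>w1\<close> lives in
    first degree \<open>c\<close> only, layers above \<open>c\<close> are not disturbed.\<close>
  define w1 where "w1 = (\<lambda>(p, k, l). if p = c then (-1) ^ c * v k l else 0)"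
  have w1: "u (p, k, l) - Dop (Suc n) w1 (p, k, l) = 0" if x: "(p, k, l) \<in> TB (Suc n)" "c \<le> p" for p k l
  proof (cases "p = c")
    case True
    have "Dop (Suc n) w1 (p, k, l) = (-1) ^ c * (\<Sum>l'\<in>B' (Suc (Suc (n - c))). D' (Suc (n - c)) l l' * ((-1) ^ c * v k l'))"
      using True cn by (simp add: Dop_def w1_def Suc_diff_le)
    also have "\<dots> = (-1) ^ c * (-1) ^ c * (\<Sum>l'\<in>B' (Suc (Suc (n - c))). D' (Suc (n - c)) l l' * v k l')"
      by (simp add: sum_distrib_left mult_ac)
    also have "\<dots> = (\<Sum>l'\<in>B' (Suc (Suc (n - c))). D' (Suc (n - c)) l l' * v k l')"
      by (simp add: power_mult_distrib[symmetric])
    also have "\<dots> = u (p, k, l)" using v x cn by (simp add: in_TB True Suc_diff_le)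
    finally show ?thesis by simp
  next
    case False
    then show ?thesis using Suc.prems(3)[OF x(1)] x(2) by (simp add: Dop_def w1_def)
  qed
  have "\<exists>w. \<forall>x\<in>TB (Suc n). u x - Dop (Suc n) w1 x = Dop (Suc n) w x"
  proof (rule Suc.IH)
    show "c \<le> Suc n" using cn by simp
    show "Dop n (\<lambda>x. u x - Dop (Suc n) w1 x) x = 0" if "x \<in> TB n" for x
      using that Suc.prems(2) by (simp add: Dop_diff Dop_Dop)
  qed (rule w1)
  then obtain w2 where "\<forall>x\<in>TB (Suc n). u x - Dop (Suc n) w1 x = Dop (Suc n) w2 x" ..
  then have "\<forall>x\<in>TB (Suc n). u x = Dop (Suc n) (\<lambda>x. w1 x + w2 x) x"
    by (simp add: Dop_add diff_eq_eq add.commute)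
  then show ?case by blast
qed

text \<open>The top layer has second degree 0, where the second resolution is exact only up to S/I'.
  There \<open>u\<close> is a cycle of the first resolution modulo I', and \<open>tor\<close>
  applies; the remaining layers are handled by exactness of the second factor.\<close>

lemma tensor_exact_at:
  assumes u: "\<And>x. x \<in> TB n \<Longrightarrow> Dop n u x = 0"
  shows "\<exists>w. \<forall>x\<in>TB (Suc n). u x = Dop (Suc n) w x"
proof -
  have z': "z' \<in> B' 0" by (simp add: R'.B0)
  have "(\<Sum>k\<in>B (Suc n). D n l k * u (Suc n, k, z')) \<in> I'" if l: "l \<in> B n" for l
  proof -
    have "Dop n u (n, l, z') = 0" using u l z' by (simp add: in_TB)
    then have "(\<Sum>k\<in>B (Suc n). D n l k * u (Suc n, k, z')) + (-1) ^ n * (\<Sum>l'\<in>B' (Suc 0). D' 0 z' l' * u (n, l, l')) = 0"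
      by (simp add: Dop_def)
    then have "(\<Sum>k\<in>B (Suc n). D n l k * u (Suc n, k, z')) = (\<Sum>l'\<in>B' (Suc 0). D' 0 z' l' * (- ((-1) ^ n) * u (n, l, l')))"
      by (simp add: add_eq_0_iff2 sum_distrib_left sum_negf mult.left_commute)
    then show ?thesis unfolding R'.image0 by (rule exI[of _ "\<lambda>l'. - ((-1) ^ n) * u (n, l, l')"])
  qed
  from tor[OF this] obtain w where "\<forall>k\<in>B (Suc n). u (Suc n, k, z') - (\<Sum>j\<in>B (Suc (Suc n)). D (Suc n) k j * w j) \<in> I'"
    by blast
  then have "\<forall>k. \<exists>v. k \<in> B (Suc n) \<longrightarrow> u (Suc n, k, z') - (\<Sum>j\<in>B (Suc (Suc n)). D (Suc n) k j * w j) = (\<Sum>l\<in>B' (Suc 0). D' 0 z' l * v l)"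
    unfolding R'.image0 by blast
  from choice[OF this] obtain v where v: "\<forall>k. k \<in> B (Suc n) \<longrightarrow>
      u (Suc n, k, z') - (\<Sum>j\<in>B (Suc (Suc n)). D (Suc n) k j * w j) = (\<Sum>l\<in>B' (Suc 0). D' 0 z' l * v k l)" ..
  \<comment> \<open>\<open>w\<close> accounts for the top layer modulo I', and \<open>v\<close> for
    the remaining element of I', written through the first matrix of the second resolution.\<close>
  define w1 where "w1 = (\<lambda>(p, k, l). if p = Suc (Suc n) then w k else if p = Suc n then (-1) ^ Suc n * v k l else 0)"
  have w1: "u (p, k, l) - Dop (Suc n) w1 (p, k, l) = 0" if x: "(p, k, l) \<in> TB (Suc n)" "Suc n \<le> p" for p k l
  proof -
    have p: "p = Suc n" "k \<in> B (Suc n)" "l = z'" using x R'.B0 by (auto simp: in_TB)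
    have "Dop (Suc n) w1 (p, k, l) = (\<Sum>j\<in>B (Suc (Suc n)). D (Suc n) k j * w j) +
        (-1) ^ Suc n * (\<Sum>l'\<in>B' (Suc 0). D' 0 z' l' * ((-1) ^ Suc n * v k l'))"
      by (simp add: Dop_def w1_def p)
    also have "(-1) ^ Suc n * (\<Sum>l'\<in>B' (Suc 0). D' 0 z' l' * ((-1) ^ Suc n * v k l')) =
        (-1) ^ Suc n * (-1) ^ Suc n * (\<Sum>l'\<in>B' (Suc 0). D' 0 z' l' * v k l')"
      by (simp add: sum_distrib_left mult_ac)
    also have "\<dots> = (\<Sum>l'\<in>B' (Suc 0). D' 0 z' l' * v k l')"
      by (simp add: power_mult_distrib[symmetric])
    finally show ?thesis using v p by (simp add: diff_eq_eq add.commute)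
  qed
  have "\<exists>w. \<forall>x\<in>TB (Suc n). u x - Dop (Suc n) w1 x = Dop (Suc n) w x"
  proof (rule exact_if_vanishing[where c = "Suc n"])
    show "Dop n (\<lambda>x. u x - Dop (Suc n) w1 x) x = 0" if "x \<in> TB n" for x
      using that u by (simp add: Dop_diff Dop_Dop)
  qed (use w1 in simp_all)
  then obtain w2 where "\<forall>x\<in>TB (Suc n). u x - Dop (Suc n) w1 x = Dop (Suc n) w2 x" ..
  then have "\<forall>x\<in>TB (Suc n). u x = Dop (Suc n) (\<lambda>x. w1 x + w2 x) x"
    by (simp add: Dop_add diff_eq_eq add.commute)
  then show ?thesis by blast
qed

theorem tensor_free_res: "free_res TB Ts TD (0, z, z') {a + b |a b. a \<in> I \<and> b \<in> I'}"
  unfolding free_res_def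
proof (intro conjI allI ballI impI)
  show "finite (TB i)" for i by (rule finite_TB)
  show "TB 0 = {(0, z, z')}" by (auto simp: TB_def R.B0 R'.B0)
  show "Ts 0 (0, z, z') = 0" by (simp add: Ts_def R.s0 R'.s0)
next
  fix i x y m assume x: "x \<in> TB i" and y: "y \<in> TB (Suc i)" and m: "m \<in> keys (TD i x y)"
  obtain p k l where x': "x = (p, k, l)" by (cases x)
  obtain p' k' l' where y': "y = (p', k', l')" by (cases y)
  have k1: "keys ((-1) ^ p * a) \<subseteq> keys a" for a :: "('w, 'k) mpoly"
    by (cases "even p") (auto simp: in_keys_iff)
  consider "p' = Suc p" "l' = l" "m \<in> keys (D p k k')" | "p' = p" "k' = k" "m \<in> keys (D' (i - p) l l')"
    using m k1 by (auto simp: TD_def x' y' split: if_splits)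
  then show "mdeg m + Ts i x = Ts (Suc i) y"
  proof cases
    case 1
    then have "mdeg m + s p k = s (Suc p) k'" using x y by (intro R.homogeneous) (auto simp: x' y' in_TB)
    then show ?thesis using 1 by (simp add: Ts_def x' y')
  next
    case 2
    have "Suc i - p = Suc (i - p)" using x by (auto simp: x' in_TB Suc_diff_le)
    then have "mdeg m + s' (i - p) l = s' (Suc (i - p)) l'" using 2 x y by (intro R'.homogeneous) (auto simp: x' y' in_TB)
    then show ?thesis using 2 \<open>Suc i - p = Suc (i - p)\<close> by (simp add: Ts_def x' y')
  qed
next
  fix i x y assume x: "x \<in> TB i" and y: "y \<in> TB (Suc i)"
  obtain p k l where x': "x = (p, k, l)" by (cases x)
  obtain p' k' l' where y': "y = (p', k', l')" by (cases y)
  have "const_coeff (D p k k') = 0" if "p' = Suc p"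
    using x y that by (intro R.minimal) (auto simp: x' y' in_TB)
  moreover have "const_coeff (D' (i - p) l l') = 0" if "p' = p"
    using x y that by (intro R'.minimal) (auto simp: x' y' in_TB Suc_diff_le)
  ultimately show "const_coeff (TD i x y) = 0"
    by (auto simp: TD_def x' y' const_coeff_mult)
next
  fix p
  have z: "(0, z, z') \<in> TB 0" by (simp add: in_TB R.B0 R'.B0)
  have "(\<Sum>y\<in>TB 1. TD 0 (0, z, z') y * w y) = (\<Sum>k\<in>B (Suc 0). D 0 z k * w (Suc 0, k, z')) + (\<Sum>l\<in>B' (Suc 0). D' 0 z' l * w (0, z, l))" for w
    using TD_apply[OF z, of w] by (simp add: Dop_def)
  note eq = this
  show "p \<in> {a + b |a b. a \<in> I \<and> b \<in> I'} \<longleftrightarrow> (\<exists>w. p = (\<Sum>y\<in>TB 1. TD 0 (0, z, z') y * w y))"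
  proof
    assume "p \<in> {a + b |a b. a \<in> I \<and> b \<in> I'}"
    then obtain a b where ab: "p = a + b" "a \<in> I" "b \<in> I'" by blast
    obtain w where w: "a = (\<Sum>k\<in>B (Suc 0). D 0 z k * w k)" using ab(2) unfolding R.image0 by (rule exE)
    obtain w' where w': "b = (\<Sum>l\<in>B' (Suc 0). D' 0 z' l * w' l)" using ab(3) unfolding R'.image0 by (rule exE)
    from w w' show "\<exists>w. p = (\<Sum>y\<in>TB 1. TD 0 (0, z, z') y * w y)"
      unfolding eq ab(1) by (intro exI[of _ "\<lambda>(p, k, l). if p = 0 then w' l else w k"]) simp
  next
    assume "\<exists>w. p = (\<Sum>y\<in>TB 1. TD 0 (0, z, z') y * w y)"
    then obtain w where "p = (\<Sum>y\<in>TB 1. TD 0 (0, z, z') y * w y)" by (rule exE)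
    moreover have "(\<Sum>k\<in>B (Suc 0). D 0 z k * w (Suc 0, k, z')) \<in> I"
      unfolding R.image0 by (rule exI[of _ "\<lambda>k. w (Suc 0, k, z')"]) simp
    moreover have "(\<Sum>l\<in>B' (Suc 0). D' 0 z' l * w (0, z, l)) \<in> I'"
      unfolding R'.image0 by (rule exI[of _ "\<lambda>l. w (0, z, l)"]) simp
    ultimately show "p \<in> {a + b |a b. a \<in> I \<and> b \<in> I'}"
      unfolding eq by blast
  qed
next
  fix i x y assume x: "x \<in> TB i" and y: "y \<in> TB (Suc (Suc i))"
  define u where "u y' = (if y' = y then 1 else (0 :: ('w, 'k) mpoly))" for y'
  have "TD (Suc i) j y = Dop (Suc i) u j" if "j \<in> TB (Suc i)" for j
    unfolding TD_apply[OF that, symmetric] using y finite_TB by (simp add: u_def if_distrib cong: if_cong)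
  then have "(\<Sum>j\<in>TB (Suc i). TD i x j * TD (Suc i) j y) = Dop i (Dop (Suc i) u) x"
    unfolding TD_apply[OF x, symmetric] by simp
  then show "(\<Sum>j\<in>TB (Suc i). TD i x j * TD (Suc i) j y) = 0" using Dop_Dop[OF x] by simp
next
  fix i u assume u: "\<forall>x\<in>TB i. (\<Sum>y\<in>TB (Suc i). TD i x y * u y) = 0"
  have "Dop i u x = 0" if "x \<in> TB i" for x using u that by (simp add: TD_apply)
  from tensor_exact_at[OF this] obtain w where "\<forall>x\<in>TB (Suc i). u x = Dop (Suc i) w x"
    by (rule exE)
  then show "\<exists>w. \<forall>k\<in>TB (Suc i). u k = (\<Sum>j\<in>TB (Suc (Suc i)). TD (Suc i) k j * w j)"
    by (intro exI[of _ w]) (simp add: TD_apply)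
qed

lemma card_TB:
  "card {x \<in> TB n. Ts n x = j} =
    (\<Sum>p\<le>n. \<Sum>a\<le>j. card {k \<in> B p. s p k = a} * card {l \<in> B' (n - p). s' (n - p) l = j - a})"
proof -
  define X where "X p a = {k \<in> B p. s p k = a}" for p a
  define Y where "Y p b = {l \<in> B' p. s' p l = b}" for p b
  have fin: "finite (X p a \<times> Y q b)" for p a q b
    by (simp add: X_def Y_def R.fin R'.fin)
  have disj: "(X p a \<times> Y q b) \<inter> (X p a' \<times> Y q b') = {}" if "a \<noteq> a'" for p a q b a' b'
    using that by (auto simp: X_def)
  have "{x \<in> TB n. Ts n x = j} = (SIGMA p:{..n}. \<Union>a\<in>{..j}. X p a \<times> Y (n - p) (j - a))"
    by (auto simp: TB_def Ts_def X_def Y_def)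
  then have "card {x \<in> TB n. Ts n x = j} = (\<Sum>p\<le>n. card (\<Union>a\<in>{..j}. X p a \<times> Y (n - p) (j - a)))"
    using fin by (simp only:) (rule card_SigmaI, auto)
  moreover have "card (\<Union>a\<in>{..j}. X p a \<times> Y (n - p) (j - a)) = (\<Sum>a\<le>j. card (X p a \<times> Y (n - p) (j - a)))" for p
    by (rule card_UN_disjoint) (use fin disj in auto)
  ultimately show ?thesis by (simp add: card_cartesian_product X_def Y_def)
qed

end

section \<open>Betti numbers from a minimal resolution\<close>

lemma kdim_strand: "kdim (strand F i j) = card {k. k < rnk F i \<and> shift F i k = j}"
  for F :: "('w, 'k::field) mpoly graded_free_seq"
proof -
  define K where "K = {k. k < rnk F i \<and> shift F i k = j}"
  have inj: "inj (unitv :: nat \<Rightarrow> nat \<Rightarrow> 'k)"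
    by (rule injI) (metis unitv_def zero_neq_one)
  define E :: "(nat \<Rightarrow> 'k) set" where "E = unitv ` K"
  have "kv.dim (strand F i j) = card K"
  proof (rule kv.dim_unique)
    show "E \<subseteq> strand F i j" by (auto simp: E_def K_def unitv_def strand_def free_mod_def)
    show "strand F i j \<subseteq> kv.span (E)"
    proof
      fix f assume "f \<in> strand F i j"
      then have "f k = 0" if "k \<notin> K" for k
        using that by (cases "k < rnk F i") (auto simp: K_def strand_def free_mod_def)
      then show "f \<in> kv.span (E)" unfolding E_def by (intro in_span_unitv) (simp_all add: K_def)
    qed
    show "kv.independent (E)"
      unfolding kv.dependent_def
    proof
      assume "\<exists>a\<in>E. a \<in> kv.span (E - {a})"
      then obtain a :: "nat \<Rightarrow> 'k" where a: "a \<in> E" "a \<in> kv.span (E - {a})" by (rule bexE)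
      then obtain k where "a = unitv k" by (auto simp: E_def)
      with a have k: "unitv k \<in> kv.span (E - {unitv k :: nat \<Rightarrow> 'k})" by simp
      have "kv.span (E - {unitv k}) \<subseteq> {f :: nat \<Rightarrow> 'k. f k = 0}"
        by (rule kv.span_minimal) (auto simp: E_def unitv_def kv.subspace_def)
      then show False using k by (auto simp: unitv_def)
    qed
    show "card (E) = card K" unfolding E_def using inj by (intro card_image) (auto simp: inj_on_def)
  qed
  then show ?thesis by (simp add: kdim_def K_def)
qed

text \<open>Minimality kills the reduced differentials, so Tor in degree \<open>j\<close> is the
  whole strand and has the basis elements of degree \<open>j\<close> as a basis. Most of the proof
  renumbers abstract bases by initial segments of the natural numbers.\<close>

theorem free_res_betti:
  fixes I :: "('w::finite, 'k::field) mpoly set"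
  assumes res: "free_res B s D z I" and I: "homog_ideal I"
  shows "betti I i j = card {b \<in> B i. s i b = j}"
proof -
  interpret resolution B s D z I by unfold_locales (rule res)
  have "\<forall>i. \<exists>e. bij_betw e {..<card (B i)} (B i)"
    using ex_bij_betw_nat_finite[OF fin] by (simp add: atLeast0LessThan)
  from choice[OF this] obtain e where e: "\<And>i. bij_betw (e i) {..<card (B i)} (B i)" by blast
  have eB: "e i k \<in> B i" if "k < card (B i)" for i k using bij_betwE[OF e] that by blast
  have ex: "\<exists>k<card (B i). b = e i k" if "b \<in> B i" for i b
    using e[of i] that unfolding bij_betw_def by blast
  define e' where "e' i = inv_into {..<card (B i)} (e i)" for i
  have e'e: "e' i (e i k) = k" if "k < card (B i)" for i k
    unfolding e'_def using bij_betw_inv_into_left[OF e] that by blast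
  have re: "(\<Sum>k<card (B i). f (e i k)) = (\<Sum>b\<in>B i. f b)" for f :: "'a \<Rightarrow> ('w, 'k) mpoly" and i
    by (rule sum.reindex_bij_betw[OF e])
  define F where "F = \<lparr>rnk = \<lambda>i. card (B i), shift = \<lambda>i k. s i (e i k), diff = \<lambda>i l k. D i (e i l) (e (Suc i) k)\<rparr>"
  have F [simp]: "rnk F i = card (B i)" "shift F i k = s i (e i k)" "diff F i l k = D i (e i l) (e (Suc i) k)" for i l k
    by (simp_all add: F_def)
  have c0: "card (B 0) = 1" "e 0 0 = z" using B0 eB[of 0 0] by simp_all
  have app: "mat_app (card (B i)) (card (B (Suc i))) (diff F i) f l =
      (\<Sum>b\<in>B (Suc i). D i (e i l) b * f (e' (Suc i) b))" if "l < card (B i)" for i f l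
    unfolding re[symmetric] using that by (auto simp: mat_app_def e'e intro!: sum.cong)
  have app': "mat_app (card (B i)) (card (B (Suc i))) (diff F i) (\<lambda>k. if k < card (B (Suc i)) then w (e (Suc i) k) else 0) l =
      (\<Sum>b\<in>B (Suc i). D i (e i l) b * w b)" if "l < card (B i)" for i w l
    unfolding re[symmetric] using that by (auto simp: mat_app_def intro!: sum.cong)
  have "graded_free_resolution F I"
    unfolding graded_free_resolution_def
  proof (intro exI[of _ "\<lambda>_. 1"] conjI allI impI ballI)
    fix k m assume "k < rnk F 0" "m \<in> keys (1 :: ('w, 'k) mpoly)"
    then show "mdeg m = shift F 0 k" using c0 s0 by (simp add: in_keys_iff lookup_one when_def split: if_splits)
  next
    fix i l k m assume "l < rnk F i" "k < rnk F (Suc i)" "m \<in> keys (diff F i l k)"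
    then show "mdeg m + shift F i l = shift F (Suc i) k"
      using homogeneous[of "e i l" i "e (Suc i) k" m] eB by simp
  next
    fix p
    have "0 \<in> I" using I by (simp add: homog_ideal_def)
    then show "\<exists>f\<in>free_mod (rnk F 0). p - (\<Sum>k<rnk F 0. f k * 1) \<in> I"
      using c0 by (intro bexI[of _ "\<lambda>k. if k = 0 then p else 0"]) (auto simp: free_mod_def)
  next
    show "{f \<in> free_mod (rnk F 0). (\<Sum>k<rnk F 0. f k * 1) \<in> I} = mat_app (rnk F 0) (rnk F 1) (diff F 0) ` free_mod (rnk F 1)"
    proof (intro equalityI subsetI)
      fix f assume "f \<in> {f \<in> free_mod (rnk F 0). (\<Sum>k<rnk F 0. f k * 1) \<in> I}"
      then have f: "f \<in> free_mod 1" "f 0 \<in> I" using c0 by auto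
      then obtain w where w: "f 0 = (\<Sum>b\<in>B (Suc 0). D 0 z b * w b)" unfolding image0 by (rule_tac exE)
      define w' where "w' = (\<lambda>k. if k < card (B (Suc 0)) then w (e (Suc 0) k) else 0)"
      have "f = mat_app (rnk F 0) (rnk F 1) (diff F 0) w'"
      proof
        fix l show "f l = mat_app (rnk F 0) (rnk F 1) (diff F 0) w' l"
        proof (cases "l = 0")
          case True
          then show ?thesis using app'[of 0 0 w] c0 w by (simp add: w'_def)
        next
          case False
          then show ?thesis using f c0 by (simp add: free_mod_def mat_app_def)
        qed
      qed
      moreover have "w' \<in> free_mod (rnk F 1)" by (simp add: w'_def free_mod_def)
      ultimately show "f \<in> mat_app (rnk F 0) (rnk F 1) (diff F 0) ` free_mod (rnk F 1)" by blast
    next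
      fix f assume "f \<in> mat_app (rnk F 0) (rnk F 1) (diff F 0) ` free_mod (rnk F 1)"
      then obtain w where w: "f = mat_app (rnk F 0) (rnk F 1) (diff F 0) w" by blast
      then have "f 0 = (\<Sum>b\<in>B (Suc 0). D 0 z b * w (e' (Suc 0) b))" using app[of 0 0 w] c0 by simp
      then have "f 0 \<in> I" unfolding image0 by (rule exI[of _ "\<lambda>b. w (e' (Suc 0) b)"])
      then show "f \<in> {f \<in> free_mod (rnk F 0). (\<Sum>k<rnk F 0. f k * 1) \<in> I}"
        using c0 w by (simp add: free_mod_def mat_app_def)
    qed
  next
    fix i
    show "{f \<in> free_mod (rnk F (Suc i)). mat_app (rnk F i) (rnk F (Suc i)) (diff F i) f = 0} =
        mat_app (rnk F (Suc i)) (rnk F (Suc (Suc i))) (diff F (Suc i)) ` free_mod (rnk F (Suc (Suc i)))"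
    proof (intro equalityI subsetI)
      fix f assume f: "f \<in> {f \<in> free_mod (rnk F (Suc i)). mat_app (rnk F i) (rnk F (Suc i)) (diff F i) f = 0}"
      have "(\<Sum>b\<in>B (Suc i). D i l b * f (e' (Suc i) b)) = 0" if l: "l \<in> B i" for l
      proof -
        obtain k where k: "k < card (B i)" "l = e i k" using ex[OF l] by blast
        have "mat_app (card (B i)) (card (B (Suc i))) (diff F i) f k = 0" using f by (simp add: fun_eq_iff)
        then show ?thesis unfolding k(2) app[OF k(1)] .
      qed
      from exact[OF this] obtain w where w: "\<And>b. b \<in> B (Suc i) \<Longrightarrow>
          f (e' (Suc i) b) = (\<Sum>j\<in>B (Suc (Suc i)). D (Suc i) b j * w j)" by blast
      define w' where "w' = (\<lambda>k. if k < card (B (Suc (Suc i))) then w (e (Suc (Suc i)) k) else 0)"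
      have "f = mat_app (rnk F (Suc i)) (rnk F (Suc (Suc i))) (diff F (Suc i)) w'"
      proof
        fix l show "f l = mat_app (rnk F (Suc i)) (rnk F (Suc (Suc i))) (diff F (Suc i)) w' l"
        proof (cases "l < card (B (Suc i))")
          case True
          then show ?thesis using app'[OF True, of w] w[OF eB[OF True]] e'e[OF True] by (simp add: w'_def)
        next
          case False
          then show ?thesis using f by (simp add: free_mod_def mat_app_def)
        qed
      qed
      moreover have "w' \<in> free_mod (rnk F (Suc (Suc i)))" by (simp add: w'_def free_mod_def)
      ultimately show "f \<in> mat_app (rnk F (Suc i)) (rnk F (Suc (Suc i))) (diff F (Suc i)) ` free_mod (rnk F (Suc (Suc i)))" by blast
    next
      fix f assume "f \<in> mat_app (rnk F (Suc i)) (rnk F (Suc (Suc i))) (diff F (Suc i)) ` free_mod (rnk F (Suc (Suc i)))"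
      then obtain w where w: "f = mat_app (rnk F (Suc i)) (rnk F (Suc (Suc i))) (diff F (Suc i)) w" by blast
      have "mat_app (rnk F i) (rnk F (Suc i)) (diff F i) f l = 0" for l
      proof (cases "l < card (B i)")
        case True
        have "f (e' (Suc i) b) = (\<Sum>j\<in>B (Suc (Suc i)). D (Suc i) b j * w (e' (Suc (Suc i)) j))" if b: "b \<in> B (Suc i)" for b
        proof -
          obtain k where k: "k < card (B (Suc i))" "b = e (Suc i) k" using ex[OF b] by blast
          then show ?thesis using app[OF k(1), of w] by (simp add: w e'e)
        qed
        then show ?thesis using app[OF True, of f] complex_apply[OF eB[OF True]] by simp
      qed (simp add: mat_app_def)
      then have "mat_app (rnk F i) (rnk F (Suc i)) (diff F i) f = 0" by (intro ext) (simp only: zero_fun_apply)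
      moreover have "f \<in> free_mod (rnk F (Suc i))" unfolding w free_mod_def mat_app_def by simp
      ultimately show "f \<in> {f \<in> free_mod (rnk F (Suc i)). mat_app (rnk F i) (rnk F (Suc i)) (diff F i) f = 0}"
        by (simp only: mem_Collect_eq)
    qed
  qed
  then have b: "betti I i j = tor_dim F i j" using betti_eq_tor_dim I by metis
  have sm: "strand_map F i f = 0" for i f
  proof
    fix l show "strand_map F i f l = 0 l"
      unfolding strand_map_def mat_app_def using minimal eB by simp
  qed
  have "tor_cycles F i j = strand F i j" by (cases i) (auto simp: tor_cycles_def sm)
  moreover have "tor_boundaries F i j = {0}"
  proof -
    have "0 \<in> strand F (Suc i) j" by (simp add: strand_def free_mod_def)
    then show ?thesis by (auto simp: tor_boundaries_def sm)
  qed
  moreover have "kdim ({0} :: (nat \<Rightarrow> 'k) set) = 0"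
    using kv.dim_le_card[of "{0}" "{}"] by (simp add: kdim_def)
  ultimately have "tor_dim F i j = card {k. k < card (B i) \<and> s i (e i k) = j}"
    by (simp add: tor_dim_def kdim_strand)
  also have "\<dots> = card (e i ` {k. k < card (B i) \<and> s i (e i k) = j})"
    using e[of i] by (intro card_image[symmetric]) (auto simp: bij_betw_def inj_on_def)
  also have "e i ` {k. k < card (B i) \<and> s i (e i k) = j} = {b \<in> B i. s i b = j}"
    using eB ex by force
  finally show ?thesis using b by simp
qed

lemma homog_ideal_ideal_gen:
  fixes Gs :: "('w::finite, 'k::field) mpoly set"
  assumes Gs: "\<And>p. p \<in> Gs \<Longrightarrow> \<exists>e. homog e p"
  shows "homog_ideal (ideal_gen Gs)"
  unfolding homog_ideal_def
proof (intro conjI ballI allI)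
  fix p e assume "p \<in> ideal_gen Gs"
  then show "hpart_shift e 0 p \<in> ideal_gen Gs"
    unfolding ideal_gen_def
  proof (induction rule: ringmod.span_induct_alt)
    case base
    then show ?case by (simp add: hpart_shift_def ringmod.span_zero)
  next
    case (step c x y)
    obtain d where d: "homog d x" using Gs step(1) by blast
    have "hpart_shift e 0 (c * x + y) = hpart_shift e d c * x + hpart_shift e 0 y"
      using hpart_shift_mult[of x 0 d e c] d by (simp add: hpart_shift_def push_add homog_def mult.commute)
    then show ?case using step by (simp add: ringmod.span_add ringmod.span_scale ringmod.span_base)
  qed
qed (auto simp: ideal_gen_def ringmod.span_zero ringmod.span_add ringmod.span_scale)

lemma ideal_gen_Un: "ideal_gen (A \<union> C) = {a + b |a b. a \<in> ideal_gen A \<and> b \<in> ideal_gen C}"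
  unfolding ideal_gen_def by (auto simp: ringmod.span_Un)

section \<open>Coefficients and products of Betti polynomials\<close>

lemma coeff_betti_poly:
  assumes "finite {(i, j). betti I i j \<noteq> 0}"
  shows "coeff (coeff (betti_poly I) i) j = int (betti I i j)"
proof -
  have "coeff (coeff (betti_poly I) i) j = (\<Sum>(i', j')\<in>{(i, j). betti I i j \<noteq> 0}. if i' = i \<and> j' = j then int (betti I i j) else 0)"
    unfolding betti_poly_def coeff_sum by (rule sum.cong) (auto simp: coeff_monom split_def)
  also have "\<dots> = (\<Sum>x\<in>{(i, j). betti I i j \<noteq> 0}. if x = (i, j) then int (betti I i j) else 0)"
    by (rule sum.cong) (auto split: if_splits)
  also have "\<dots> = int (betti I i j)" using assms by simp
  finally show ?thesis .
qed

lemma betti_poly_infinite: "infinite {(i, j). betti I i j \<noteq> 0} \<Longrightarrow> betti_poly I = 0"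
  by (simp add: betti_poly_def)

text \<open>Positivity at (0, 0) embeds the support of each factor into the support of
  \<open>betti I\<close>, so an infinite support on the right forces one on the left. If both are
  finite, so is the convolution, and the coefficients are compared by the Cauchy product.\<close>

lemma betti_poly_mult:
  fixes I I1 I2 :: "('w::finite, 'k::field) mpoly set"
  assumes conv: "\<And>n j. betti I n j = (\<Sum>p\<le>n. \<Sum>a\<le>j. betti I1 p a * betti I2 (n - p) (j - a))"
    and b0: "betti I1 0 0 > 0" "betti I2 0 0 > 0"
  shows "betti_poly I = betti_poly I1 * betti_poly I2"
proof -
  define S where "S J = {(i, j). betti J i j \<noteq> 0}" for J :: "('w, 'k) mpoly set"
  have le: "betti I1 p a * betti I2 q b \<le> betti I (p + q) (a + b)" for p a q b
  proof -
    have "betti I1 p a * betti I2 (p + q - p) (a + b - a) \<le> (\<Sum>a'\<le>a + b. betti I1 p a' * betti I2 (p + q - p) (a + b - a'))"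
      by (rule member_le_sum) auto
    also have "\<dots> \<le> betti I (p + q) (a + b)"
      unfolding conv by (rule member_le_sum) auto
    finally show ?thesis by simp
  qed
  have s1: "S I1 \<subseteq> S I"
  proof
    fix x assume "x \<in> S I1"
    then have "betti I1 (fst x) (snd x) * betti I2 0 0 > 0" using b0 by (auto simp: S_def)
    then show "x \<in> S I" using order.strict_trans2[OF _ le[of "fst x" "snd x" 0 0]] by (simp add: S_def split_def)
  qed
  have s2: "S I2 \<subseteq> S I"
  proof
    fix x assume "x \<in> S I2"
    then have "betti I1 0 0 * betti I2 (fst x) (snd x) > 0" using b0 by (auto simp: S_def)
    then show "x \<in> S I" using order.strict_trans2[OF _ le[of 0 0 "fst x" "snd x"]] by (simp add: S_def split_def)
  qed
  show ?thesis
  proof (cases "finite (S I1) \<and> finite (S I2)")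
    case False
    then have "infinite (S I)" using s1 s2 finite_subset by blast
    moreover have "betti_poly I1 = 0 \<or> betti_poly I2 = 0" using False betti_poly_infinite by (auto simp: S_def)
    ultimately show ?thesis using betti_poly_infinite[of I] by (auto simp: S_def)
  next
    case True
    have "S I \<subseteq> (\<lambda>((p, a), (q, b)). (p + q, a + b)) ` (S I1 \<times> S I2)"
    proof
      fix x assume "x \<in> S I"
      then obtain n j where x: "x = (n, j)" "betti I n j \<noteq> 0" by (auto simp: S_def)
      then obtain p a where pa: "p \<le> n" "a \<le> j" "betti I1 p a * betti I2 (n - p) (j - a) \<noteq> 0"
        unfolding conv by (meson atMost_iff sum.neutral)
      then show "x \<in> (\<lambda>((p, a), (q, b)). (p + q, a + b)) ` (S I1 \<times> S I2)"
        by (intro image_eqI[of _ _ "((p, a), (n - p, j - a))"]) (auto simp: x S_def)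
    qed
    then have fin: "finite (S I)" using True by (meson finite_SigmaI finite_imageI finite_subset)
    show ?thesis
    proof (intro poly_eqI)
      fix n j
      have "coeff (coeff (betti_poly I1 * betti_poly I2) n) j =
          (\<Sum>p\<le>n. \<Sum>a\<le>j. coeff (coeff (betti_poly I1) p) a * coeff (coeff (betti_poly I2) (n - p)) (j - a))"
        by (simp add: coeff_mult coeff_sum)
      also have "\<dots> = int (betti I n j)"
        using True unfolding S_def by (simp add: coeff_betti_poly conv)
      finally show "coeff (coeff (betti_poly I) n) j = coeff (coeff (betti_poly I1 * betti_poly I2) n) j"
        using fin unfolding S_def by (simp add: coeff_betti_poly)
    qed
  qed
qed

section \<open>Decompositions\<close>

lemma edge_binomial_homog:
  "homog 2 (Var (Inl i) * Var (Inr j) - Var (Inl j) * Var (Inr i) :: ('v::finite, 'k::field) xy_poly)"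
  and edge_binomial_in_polys_in:
  "{Inl i, Inr i, Inl j, Inr j} \<subseteq> W \<Longrightarrow>
    Var (Inl i) * Var (Inr j) - Var (Inl j) * Var (Inr i) \<in> (polys_in W :: ('v, 'k) xy_poly set)"
proof -
  have k: "keys (Var (Inl i) * Var (Inr j) - Var (Inl j) * Var (Inr i) :: ('v, 'k) xy_poly) \<subseteq>
      {single (Inl i) 1 + single (Inr j) 1, single (Inl j) 1 + single (Inr i) 1}"
    by (auto simp: Var_def mult_single in_keys_iff lookup_minus lookup_single when_def split: if_splits)
  then show "homog 2 (Var (Inl i) * Var (Inr j) - Var (Inl j) * Var (Inr i) :: ('v, 'k) xy_poly)"
    by (auto simp: homog_def mdeg_add)
  assume "{Inl i, Inr i, Inl j, Inr j} \<subseteq> W"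
  then have "keys m \<subseteq> W" if "m \<in> {single (Inl i) (1::nat) + single (Inr j) 1, single (Inl j) 1 + single (Inr i) 1}" for m
    using that keys_add[of "single (Inl i) (1::nat)" "single (Inr j) 1"]
      keys_add[of "single (Inl j) (1::nat)" "single (Inr i) 1"] by (auto split: if_splits)
  then show "Var (Inl i) * Var (Inr j) - Var (Inl j) * Var (Inr i) \<in> (polys_in W :: ('v, 'k) xy_poly set)"
    using k unfolding polys_in_def by blast
qed

theorem proposition1p3:
  fixes G G1 G2 :: "'v::{finite,linorder} sgraph" and v :: 'v
  assumes "simple_graph G" and "verts G = UNIV"
    and "connected_graph G" and "decomposable G"
    and "decomposition G G1 G2 v"
  shows "betti_poly (binomial_edge_ideal G :: ('v, 'k::field) xy_poly set) =
    betti_poly (binomial_edge_ideal G1 :: ('v, 'k) xy_poly set) *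
    betti_poly (binomial_edge_ideal G2 :: ('v, 'k) xy_poly set)"
proof -
  have G1: "simple_graph G1" and G2: "simple_graph G2"
    and E: "edges G = edges G1 \<union> edges G2" and V: "verts G1 \<inter> verts G2 = {v}"
    and f1: "free_vertex G1 v" and f2: "free_vertex G2 v"
    using assms(5) by (auto simp: decomposition_def subgraph_def graph_union_def)
  interpret H1: graph_with_free_vertex G1 v by unfold_locales (rule G1, rule f1)
  interpret H2: graph_with_free_vertex G2 v by unfold_locales (rule G2, rule f2)
  define gens :: "'v sgraph \<Rightarrow> ('v, 'k) xy_poly set" where
    "gens H = {Var (Inl i) * Var (Inr j) - Var (Inl j) * Var (Inr i) | i j. {i, j} \<in> edges H \<and> i < j}" for H
  have J: "binomial_edge_ideal H = ideal_gen (gens H)" for H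
    by (simp add: binomial_edge_ideal_def gens_def)
  have gens_homog: "homog 2 p" if "p \<in> gens H" for p H
    using that edge_binomial_homog by (auto simp: gens_def)
  have I: "homog_ideal (ideal_gen (gens H))" for H
    by (rule homog_ideal_ideal_gen) (use gens_homog in blast)
  \<comment> \<open>The vertices of \<open>G1\<close> other than \<open>v\<close> lie outside
    \<open>G2\<close>, so the generators involve only variables of \<open>T\<close> taken with
    respect to \<open>G2\<close>.\<close>
  have "p \<in> polys_in H2.W" if p: "p \<in> gens G1" for p
  proof -
    obtain i j where ij: "{i, j} \<in> edges G1" "p = Var (Inl i) * Var (Inr j) - Var (Inl j) * Var (Inr i)"
      using p by (auto simp: gens_def)
    have "i \<notin> H2.U" "j \<notin> H2.U" using H1.edgeD[OF ij(1)] V by (auto simp: H2.U_def)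
    then show ?thesis unfolding ij(2) by (intro edge_binomial_in_polys_in) (auto simp: H2.W_def)
  qed
  then have "\<forall>p\<in>gens G1. p \<in> polys_in H2.W \<and> (\<exists>e>0. homog e p)"
    using gens_homog zero_less_numeral by blast
  from minimal_resolution_exists[OF this] obtain r s D where
    res: "free_res (\<lambda>i. {..<r i}) s D (0::nat) (ideal_gen (gens G1))"
    and DW: "\<forall>i. \<forall>l<r i. \<forall>k<r (Suc i). D i l k \<in> polys_in H2.W"
    by (elim exE conjE) (rule that)
  have "\<forall>p\<in>gens G2. p \<in> polys_in UNIV \<and> (\<exists>e>0. homog e p)"
    using gens_homog zero_less_numeral unfolding polys_in_def by blast
  from minimal_resolution_exists[OF this] obtain r' s' D' where
    res': "free_res (\<lambda>i. {..<r' i}) s' D' (0::nat) (ideal_gen (gens G2))"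
    by (elim exE conjE) (rule that)
  interpret tensor_resolution "\<lambda>i. {..<r i}" s D 0 "ideal_gen (gens G1)" "\<lambda>i. {..<r' i}" s' D' 0 "ideal_gen (gens G2)"
  proof unfold_locales
    fix i u assume u: "\<And>l. l \<in> {..<r i} \<Longrightarrow> (\<Sum>k<r (Suc i). D i l k * u k) \<in> ideal_gen (gens G2)"
    show "\<exists>w. \<forall>k\<in>{..<r (Suc i)}. u k - (\<Sum>j<r (Suc (Suc i)). D (Suc i) k j * w j) \<in> ideal_gen (gens G2)"
    proof (rule H2.tensor_exact[OF res, of i u, unfolded J])
      show "D i l k \<in> polys_in H2.W" if "l \<in> {..<r i}" "k \<in> {..<r (Suc i)}" for i l k
        using DW that by simp
      \<comment> \<open>Regularity of y_v on the first factor comes from freeness of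
        \<open>v\<close> in \<open>G1\<close>; freeness in \<open>G2\<close> supplies the
        decomposition into powers.\<close>
      show "p \<in> ideal_gen (gens G1)" if "Var (Inr v) * p \<in> ideal_gen (gens G1)" for p
        using H1.Var_v_nonzerodivisor[of p] that by (simp add: J)
    qed (rule u)
  qed (rule res, rule res')
  have "gens G = gens G1 \<union> gens G2" by (auto simp: gens_def E)
  then have eq: "{a + b |a b. a \<in> ideal_gen (gens G1) \<and> b \<in> ideal_gen (gens G2)} = ideal_gen (gens G)"
    by (simp only: ideal_gen_Un)
  have resG: "free_res TB Ts TD (0, 0, 0) (ideal_gen (gens G))"
    using tensor_free_res unfolding eq .
  show ?thesis
    unfolding J
  proof (rule betti_poly_mult)
    fix n j
    show "betti (ideal_gen (gens G)) n j =
        (\<Sum>p\<le>n. \<Sum>a\<le>j. betti (ideal_gen (gens G1)) p a * betti (ideal_gen (gens G2)) (n - p) (j - a))"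
      unfolding free_res_betti[OF resG I] free_res_betti[OF res I] free_res_betti[OF res' I] by (rule card_TB)
  next
    show "betti (ideal_gen (gens G1)) 0 0 > 0" "betti (ideal_gen (gens G2)) 0 0 > 0"
      unfolding free_res_betti[OF res I] free_res_betti[OF res' I] using R.B0 R.s0 R'.B0 R'.s0 by (auto simp: card_gt_0_iff)
  qed
qed

end
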